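(* Let $B : [0,1] \to [0,+\infty)$ be a $C^1$ function such that $B(0)=B(1)=0$, $B(u)>0$ for all $u \in (0,1)$, and $B'(0)>0>B'(1)$. Define the energy functional \[ \mathscr{W}[\mu] = \int_{x\in\mathbb{R}} B(F_\mu(x))\,\mathrm{d}x, \qquad \mu\in\mathcal{P}(\mathbb{R}), \] where $F_\mu$ is the cumulative distribution function of $\mu$. Then the associated sequence $\overline{\mathbb{P}}_n$, $n\geq 2$, is well defined, and it satisfies a large deviation principle (with speed $n$) on $\overline{\mathcal{P}}(\mathbb{R})$ with good rate function \[ \overline{\mathscr{I}}[\overline\mu] := \overline{\mathscr{F}}[\overline\mu]-\mathscr{F}_\star, \qquad \overline\mu\in\overline{\mathcal{P}}(\mathbb{R}). \]
   Context: Throughout, the dimension is $d=1$ and $\sigma^2>0$ is fixed. Spaces. $\mathcal{P}(\mathbb{R})$ is the set of Borel probability measures on $\mathbb{R}$ with the topology of weak convergence; $\mathcal{P}_1(\mathbb{R})$ is the set of those with finite first moment. For $y \in \mathbb{R}$, $\tau_y\mu$ is the pushforward of $\mu$ by $x \mapsto x+y$. $\overline{\mathcal{P}}(\mathbb{R})$ is the orbit space of the action $(y,\mu)\mapsto\tau_y\mu$ of $\mathbb{R}$ on $\mathcal{P}(\mathbb{R})$, $\rho(\mu)=\{\tau_y\mu : y\in\mathbb{R}\}$ is the orbit map, and $\overline{\mathcal{P}}(\mathbb{R})$ carries the quotient topology (the strongest topology making $\rho$ continuous), which is metrisable. Gibbs measure. For $n \geq 2$ and $\mathbf{x} \in \mathbb{R}^n$,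 $\pi_n(\mathbf{x}) := \frac1n\sum_{i=1}^n \delta_{x_i}$ and $W_n(\mathbf{x}) := \mathscr{W}[\pi_n(\mathbf{x})]$. $M_{1,n} := \{\widetilde{\mathbf{x}} \in \mathbb{R}^n : \widetilde x_1+\cdots+\widetilde x_n=0\}$, with Lebesgue measure $\mathrm{d}\widetilde{\mathbf{x}}$. $\widetilde{P}_n$ is the probability measure on $\mathbb{R}^n$, concentrated on $M_{1,n}$, with density $\widetilde{Z}_n^{-1}\exp(-\frac{2n}{\sigma^2}W_n(\widetilde{\mathbf{x}}))$ with respect to $\mathrm{d}\widetilde{\mathbf{x}}$, where $\widetilde Z_n := \int_{M_{1,n}} \exp(-\frac{2n}{\sigma^2}W_n(\widetilde{\mathbf{x}}))\,\mathrm{d}\widetilde{\mathbf{x}}$; it is well defined when $\widetilde Z_n\in(0,+\infty)$. Set $\widetilde{\mathbb{P}}_n := \widetilde{P}_n \circ \pi_n^{-1}$ (a Borel probability measure on $\mathcal{P}(\mathbb{R})$) and $\overline{\mathbb{P}}_n := \widetilde{\mathbb{P}}_n\circ\rho^{-1}$. Free energy. $\mathscr{S}[\mu] := \int p\log p\,\mathrm{d}x \in (-\infty,+\infty]$ if $\mu \in \mathcal{P}_1(\mathbb{R})$ has Lebesgue density $p$, and $\mathscr{S}[\mu]:=+\infty$ otherwise. $\mathscr{F}[\mu] := \mathscr{S}[\mu]+\frac{2}{\sigma^2}\mathscr{W}[\mu]$, $\mathscr{F}_\star := \inf_{\mu\in\mathcal{P}(\mathbb{R})}\mathscr{F}[\mu]$,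 and $\overline{\mathscr{F}}[\rho(\mu)]:=\mathscr{F}[\mu]$ (well defined by translation invariance of $\mathscr{F}$). A good rate function on a metric space is a proper function with compact level sets. *)

theory Defs
  imports "HOL-Probability.Probability"
begin

section \<open>Probability measures on the line and their orbits under translation\<close>

abbreviation prob_measures :: "real measure set"
  where "prob_measures \<equiv> space (prob_algebra borel)"

lemma prob_measures_iff: "\<mu> \<in> prob_measures \<longleftrightarrow> prob_space \<mu> \<and> sets \<mu> = sets borel"
  by (auto simp: space_prob_algebra)

text \<open>The weak topology is the initial topology for the maps sending a measure to the integral of
  \<open>f\<close>, over all bounded continuous \<open>f\<close>; \<^term>\<open>euclidean\<close> is the product topology here.\<close>

definition weak_topology :: "real measure topology"
  where "weak_topology =
    pullback_topology prob_measures
      (\<lambda>\<mu> (f :: real \<Rightarrow>\<^sub>C real). integral\<^sup>L \<mu> (apply_bcontfun f)) euclidean"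

lemma topspace_weak_topology: "topspace weak_topology = prob_measures"
  by (simp add: weak_topology_def topspace_pullback_topology)

definition translate :: "real \<Rightarrow> real measure \<Rightarrow> real measure"
  where "translate y \<mu> = distr \<mu> borel (\<lambda>x. x + y)"

definition orbit :: "real measure \<Rightarrow> real measure set"
  where "orbit \<mu> = {translate y \<mu> | y. True}"

definition quotient_topology :: "'a topology \<Rightarrow> ('a \<Rightarrow> 'b) \<Rightarrow> 'b topology"
  where "quotient_topology X f =
    topology (\<lambda>U. U \<subseteq> f ` topspace X \<and> openin X {x \<in> topspace X. f x \<in> U})"

lemma openin_quotient_topology:
  "openin (quotient_topology X f) U \<longleftrightarrow>
     U \<subseteq> f ` topspace X \<and> openin X {x \<in> topspace X. f x \<in> U}"
proof -
  have "istopology (\<lambda>U. U \<subseteq> f ` topspace X \<and> openin X {x \<in> topspace X. f x \<in> U})"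
    unfolding istopology_def
  proof (intro conjI allI impI)
    fix S T assume "S \<subseteq> f ` topspace X \<and> openin X {x \<in> topspace X. f x \<in> S}"
      and "T \<subseteq> f ` topspace X \<and> openin X {x \<in> topspace X. f x \<in> T}"
    moreover have "{x \<in> topspace X. f x \<in> S \<inter> T} =
        {x \<in> topspace X. f x \<in> S} \<inter> {x \<in> topspace X. f x \<in> T}" by auto
    ultimately show "S \<inter> T \<subseteq> f ` topspace X" "openin X {x \<in> topspace X. f x \<in> S \<inter> T}"
      by (auto simp: openin_Int)
  next
    fix K assume K: "\<forall>S\<in>K. S \<subseteq> f ` topspace X \<and> openin X {x \<in> topspace X. f x \<in> S}"
    have "{x \<in> topspace X. f x \<in> \<Union>K} = (\<Union>S\<in>K. {x \<in> topspace X. f x \<in> S})" by auto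
    with K show "\<Union>K \<subseteq> f ` topspace X" "openin X {x \<in> topspace X. f x \<in> \<Union>K}"
      by auto
  qed
  then show ?thesis
    by (simp add: quotient_topology_def topology_inverse')
qed

lemma topspace_quotient_topology: "topspace (quotient_topology X f) = f ` topspace X"
proof -
  have "openin (quotient_topology X f) (f ` topspace X)"
    by (auto simp: openin_quotient_topology conj_absorb cong: conj_cong)
  then show ?thesis
    by (meson openin_quotient_topology openin_subset openin_topspace subset_antisym)
qed

lemma quotient_map_quotient_topology: "quotient_map X (quotient_topology X f) f"
  by (auto simp: quotient_map_def topspace_quotient_topology openin_quotient_topology)

definition orbit_topology :: "real measure set topology"
  where "orbit_topology = quotient_topology weak_topology orbit"

definition borel_of :: "'a topology \<Rightarrow> 'a measure"
  where "borel_of X = sigma (topspace X) {U. openin X U}"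

section \<open>Energy, entropy and free energy\<close>

definition energy :: "(real \<Rightarrow> real) \<Rightarrow> real measure \<Rightarrow> ennreal"
  where "energy B \<mu> = (\<integral>\<^sup>+x. ennreal (B (cdf \<mu> x)) \<partial>lborel)"

text \<open>A finite first moment forces the negative part of \<open>p log p\<close> to be integrable, so that the
  difference below never reads \<open>\<infinity> - \<infinity>\<close>.\<close>

definition entropy_fun :: "real measure \<Rightarrow> ereal"
  where "entropy_fun \<mu> =
    (if \<mu> \<in> prob_measures \<and> integrable \<mu> (\<lambda>x. x) \<and> absolutely_continuous lborel \<mu>
     then let p = (\<lambda>x. enn2real (RN_deriv lborel \<mu> x))
          in enn2ereal (\<integral>\<^sup>+x. ennreal (p x * ln (p x)) \<partial>lborel)
             - enn2ereal (\<integral>\<^sup>+x. ennreal (- (p x * ln (p x))) \<partial>lborel)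
     else \<infinity>)"

definition free_energy :: "(real \<Rightarrow> real) \<Rightarrow> real \<Rightarrow> real measure \<Rightarrow> ereal"
  where "free_energy B \<sigma> \<mu> = entropy_fun \<mu> + ereal (2 / \<sigma>\<^sup>2) * enn2ereal (energy B \<mu>)"

definition free_energy_inf :: "(real \<Rightarrow> real) \<Rightarrow> real \<Rightarrow> ereal"
  where "free_energy_inf B \<sigma> = (INF \<mu>\<in>prob_measures. free_energy B \<sigma> \<mu>)"

text \<open>The free energy is constant on orbits, so that its image of an orbit is a singleton;
  see \<open>orbit_free_energy_orbit\<close> below.\<close>

definition orbit_free_energy :: "(real \<Rightarrow> real) \<Rightarrow> real \<Rightarrow> real measure set \<Rightarrow> ereal"
  where "orbit_free_energy B \<sigma> A = the_elem (free_energy B \<sigma> ` A)"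

definition rate_fun :: "(real \<Rightarrow> real) \<Rightarrow> real \<Rightarrow> real measure set \<Rightarrow> ereal"
  where "rate_fun B \<sigma> A = orbit_free_energy B \<sigma> A - free_energy_inf B \<sigma>"

lemma translate_in_prob_measures:
  assumes "\<mu> \<in> prob_measures"
  shows "translate y \<mu> \<in> prob_measures"
proof -
  have [measurable_cong]: "sets \<mu> = sets borel" and "prob_space \<mu>"
    using assms by (auto simp: prob_measures_iff)
  then show ?thesis
    by (auto simp: prob_measures_iff translate_def intro!: prob_space.prob_space_distr)
qed

lemma translate_translate:
  assumes "sets \<mu> = sets borel"
  shows "translate z (translate y \<mu>) = translate (y + z) \<mu>"
proof -
  note [measurable_cong] = assms
  show ?thesis
    by (simp add: translate_def distr_distr comp_def add.assoc)
qed

lemma translate_0: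
  assumes "sets \<mu> = sets borel"
  shows "translate 0 \<mu> = \<mu>"
  using distr_id2[OF assms[symmetric]] by (simp add: translate_def)

lemma orbit_eq_iff:
  assumes "\<mu> \<in> prob_measures" "\<nu> \<in> prob_measures"
  shows "orbit \<mu> = orbit \<nu> \<longleftrightarrow> (\<exists>y. \<nu> = translate y \<mu>)"
proof
  have sets: "sets \<mu> = sets borel" "sets \<nu> = sets borel"
    using assms by (auto simp: prob_measures_iff)
  { assume "orbit \<mu> = orbit \<nu>"
    moreover have "\<nu> \<in> orbit \<nu>"
      using translate_0[OF sets(2)] unfolding orbit_def by (auto intro!: exI[of _ 0])
    ultimately show "\<exists>y. \<nu> = translate y \<mu>"
      by (auto simp: orbit_def) }
  { assume "\<exists>y. \<nu> = translate y \<mu>"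
    then obtain y where y: "\<nu> = translate y \<mu>" by blast
    have "translate z \<mu> = translate (z - y) \<nu>" for z
      by (simp add: y translate_translate sets)
    then have "orbit \<mu> \<subseteq> orbit \<nu>"
      by (auto simp: orbit_def)
    moreover have "translate z \<nu> = translate (y + z) \<mu>" for z
      by (simp add: y translate_translate sets)
    then have "orbit \<nu> \<subseteq> orbit \<mu>"
      by (auto simp: orbit_def)
    ultimately show "orbit \<mu> = orbit \<nu>"
      by blast }
qed

lemma cdf_translate:
  assumes "sets \<mu> = sets borel"
  shows "cdf (translate y \<mu>) x = cdf \<mu> (x - y)"
proof -
  note [measurable_cong] = assms
  have "(\<lambda>u. u + y) -` {..x} \<inter> space \<mu> = {..x - y}"
    using sets_eq_imp_space_eq[OF assms] by auto
  then show ?thesis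
    by (simp add: cdf_def translate_def measure_distr)
qed

lemma lborel_shift: "distr lborel borel (\<lambda>x. x + y) = (lborel :: real measure)"
proof -
  have "(\<lambda>x. x + y) = (+) y" by (simp add: fun_eq_iff)
  then show ?thesis using lborel_distr_plus[of y] by simp
qed

lemma energy_translate:
  assumes mu: "\<mu> \<in> prob_measures" and B: "continuous_on {0..1} B"
  shows "energy B (translate y \<mu>) = energy B \<mu>"
proof -
  have sets: "sets \<mu> = sets borel" and "prob_space \<mu>"
    using mu by (auto simp: prob_measures_iff)
  then interpret real_distribution \<mu>
    by (simp add: real_distribution_def real_distribution_axioms_def)
  have "mono (cdf \<mu>)"
    by (auto intro!: monoI cdf_nondecreasing)
  then have [measurable]: "cdf \<mu> \<in> borel_measurable borel"
    by (rule borel_measurable_mono)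
  have "continuous_on UNIV (\<lambda>u. B (max 0 (min 1 u)))"
    by (rule continuous_on_compose2[OF B]) (auto intro!: continuous_intros)
  then have [measurable]: "(\<lambda>u. B (max 0 (min 1 u))) \<in> borel_measurable borel"
    by (rule borel_measurable_continuous_onI)
  have eq: "B (max 0 (min 1 (cdf \<mu> x))) = B (cdf \<mu> x)" for x
    using cdf_nonneg[of x] cdf_bounded_prob[of x] by simp
  have "energy B (translate y \<mu>) = (\<integral>\<^sup>+x. ennreal (B (max 0 (min 1 (cdf \<mu> (x - y))))) \<partial>lborel)"
    by (simp add: energy_def cdf_translate sets eq)
  also have "\<dots> = (\<integral>\<^sup>+x. ennreal (B (max 0 (min 1 (cdf \<mu> (x - y)))))
      \<partial>distr lborel borel (\<lambda>x. x + y))"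
    by (simp add: lborel_shift)
  also have "\<dots> = energy B \<mu>"
    by (subst nn_integral_distr) (measurable, simp add: energy_def eq)
  finally show ?thesis .
qed

lemma absolutely_continuous_translate:
  assumes "sets \<mu> = sets borel" "absolutely_continuous lborel \<mu>"
  shows "absolutely_continuous lborel (translate y \<mu>)"
proof -
  note [measurable_cong] = assms(1)
  have "absolutely_continuous (distr lborel borel (\<lambda>x. x + y)) (distr \<mu> borel (\<lambda>x. x + y))"
    unfolding absolutely_continuous_def
  proof
    fix A assume A: "A \<in> null_sets (distr lborel borel (\<lambda>x::real. x + y))"
    then have m: "A \<in> sets borel" by auto
    with A have "(\<lambda>x. x + y) -` A \<inter> space lborel \<in> null_sets lborel"
      by (subst (asm) null_sets_distr_iff) auto
    then have "(\<lambda>x. x + y) -` A \<inter> space lborel \<in> null_sets \<mu>"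
      using assms(2) by (auto simp: absolutely_continuous_def)
    with m show "A \<in> null_sets (distr \<mu> borel (\<lambda>x. x + y))"
      by (subst null_sets_distr_iff) (auto simp: sets_eq_imp_space_eq[OF assms(1)])
  qed
  then show ?thesis
    by (simp add: lborel_shift translate_def)
qed

lemma entropy_fun_translate_aux:
  assumes mu: "\<mu> \<in> prob_measures" "integrable \<mu> (\<lambda>x. x)" "absolutely_continuous lborel \<mu>"
  shows "integrable (translate y \<mu>) (\<lambda>x. x)"
    and "entropy_fun (translate y \<mu>) = entropy_fun \<mu>"
proof -
  have sets[measurable_cong]: "sets \<mu> = sets borel" and "prob_space \<mu>"
    using mu by (auto simp: prob_measures_iff)
  interpret prob_space \<mu> by fact
  show int: "integrable (translate y \<mu>) (\<lambda>x. x)"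
  proof -
    have "integrable \<mu> (\<lambda>x. x + y)"
      using mu(2) by (intro Bochner_Integration.integrable_add) simp_all
    moreover have "(\<lambda>x. x + y) \<in> \<mu> \<rightarrow>\<^sub>M borel" by measurable
    ultimately show ?thesis
      unfolding translate_def by (simp add: integrable_distr_eq)
  qed
  have ac: "absolutely_continuous lborel (translate y \<mu>)"
    using absolutely_continuous_translate sets mu by blast
  let ?p = "\<lambda>x. enn2real (RN_deriv lborel \<mu> x)"
  let ?q = "\<lambda>x. enn2real (RN_deriv lborel (translate y \<mu>) x)"
  have "AE x in lborel. RN_deriv (distr lborel borel (\<lambda>x. x + y))
      (distr \<mu> borel (\<lambda>x. x + y)) (x + y) = RN_deriv lborel \<mu> x"
    by (rule sigma_finite_measure.RN_deriv_distr[OF sigma_finite_lborel, where T' = "\<lambda>x. x - y"])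
       (use ac in \<open>auto simp: lborel_shift translate_def sets\<close>)
  then have AE: "AE x in lborel. ?q (x + y) = ?p x"
    unfolding lborel_shift translate_def by eventually_elim simp
  have *: "(\<integral>\<^sup>+x. ennreal (h (?q x)) \<partial>lborel) = (\<integral>\<^sup>+x. ennreal (h (?p x)) \<partial>lborel)"
    if [measurable]: "h \<in> borel_measurable borel" for h :: "real \<Rightarrow> real"
  proof -
    have "(\<integral>\<^sup>+x. ennreal (h (?q x)) \<partial>lborel) =
        (\<integral>\<^sup>+x. ennreal (h (?q x)) \<partial>distr lborel borel (\<lambda>x. x + y))"
      by (simp add: lborel_shift)
    also have "\<dots> = (\<integral>\<^sup>+x. ennreal (h (?q (x + y))) \<partial>lborel)"
      by (rule nn_integral_distr) measurable
    also have "\<dots> = (\<integral>\<^sup>+x. ennreal (h (?p x)) \<partial>lborel)"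
      by (rule nn_integral_cong_AE, use AE in eventually_elim) simp
    finally show ?thesis .
  qed
  show "entropy_fun (translate y \<mu>) = entropy_fun \<mu>"
  proof -
    have h: "(\<lambda>t::real. t * ln t) \<in> borel_measurable borel"
      "(\<lambda>t::real. - (t * ln t)) \<in> borel_measurable borel"
      by measurable
    show ?thesis
      unfolding entropy_fun_def Let_def
      by (simp only: mu int ac translate_in_prob_measures[OF mu(1)] if_True simp_thms
          *[OF h(1)] *[OF h(2)])
  qed
qed

lemma entropy_fun_translate:
  assumes mu: "\<mu> \<in> prob_measures"
  shows "entropy_fun (translate y \<mu>) = entropy_fun \<mu>"
proof -
  let ?nu = "translate y \<mu>"
  have sets: "sets \<mu> = sets borel" "sets ?nu = sets borel" and nu: "?nu \<in> prob_measures"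
    using mu translate_in_prob_measures[OF mu, of y] by (auto simp: prob_measures_iff)
  have shift_back: "translate (- y) ?nu = \<mu>"
    by (simp add: translate_translate translate_0 sets)
  show ?thesis
  proof (cases "integrable \<mu> (\<lambda>x. x) \<and> absolutely_continuous lborel \<mu>")
    case True
    then show ?thesis using entropy_fun_translate_aux(2)[OF mu] by blast
  next
    case False
    have "\<not> (integrable ?nu (\<lambda>x. x) \<and> absolutely_continuous lborel ?nu)"
      using False entropy_fun_translate_aux(1)[OF nu, of "- y"]
        absolutely_continuous_translate[OF sets(2), of "- y"] shift_back by metis
    with False show ?thesis by (auto simp: entropy_fun_def)
  qed
qed

lemma orbit_free_energy_orbit:
  assumes "\<mu> \<in> prob_measures" "continuous_on {0..1} B"
  shows "orbit_free_energy B \<sigma> (orbit \<mu>) = free_energy B \<sigma> \<mu>"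
proof -
  have "free_energy B \<sigma> ` orbit \<mu> = {free_energy B \<sigma> \<mu>}"
    using assms
    by (auto simp: orbit_def free_energy_def energy_translate entropy_fun_translate
        image_def set_eq_iff)
  then show ?thesis by (simp add: orbit_free_energy_def)
qed

section \<open>The Gibbs measure of the centred particle system\<close>

definition empirical :: "nat \<Rightarrow> (nat \<Rightarrow> real) \<Rightarrow> real measure"
  where "empirical n x = distr (uniform_count_measure {1..n}) borel x"

lemma emeasure_empirical:
  assumes "A \<in> sets borel" "n \<ge> 1"
  shows "emeasure (empirical n x) A = ennreal ((1 / n) * (\<Sum>i=1..n. indicator A (x i)))"
proof -
  have "x \<in> uniform_count_measure {1..n} \<rightarrow>\<^sub>M borel"
    by (simp add: measurable_def sets_uniform_count_measure space_uniform_count_measure)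
  moreover have "(\<Sum>i=1..n. indicator A (x i) :: real) = card (x -` A \<inter> {1..n})"
    by (simp add: indicator_def sum.If_cases Int_commute vimage_def)
  ultimately show ?thesis
    using assms
    by (simp add: empirical_def emeasure_distr space_uniform_count_measure
        emeasure_uniform_count_measure)
qed

text \<open>Lebesgue measure on the hyperplane \<open>x\<^sub>1 + \<dots> + x\<^sub>n = 0\<close> with its Euclidean structure,
  in the chart given by the first \<open>n - 1\<close> coordinates.  The factor \<open>sqrt n\<close> is the surface
  element of the graph of \<open>- (x\<^sub>1 + \<dots> + x\<^sub>n\<^sub>-\<^sub>1)\<close>.\<close>

definition hyperplane_lebesgue :: "nat \<Rightarrow> (nat \<Rightarrow> real) measure"
  where "hyperplane_lebesgue n =
    scale_measure (ennreal (sqrt n))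
      (distr (\<Pi>\<^sub>M i\<in>{1..<n}. lborel) (\<Pi>\<^sub>M i\<in>{1..n}. borel)
        (\<lambda>x. \<lambda>i\<in>{1..n}. if i < n then x i else - (\<Sum>j=1..<n. x j)))"

text \<open>The energy of an empirical measure of \<open>n \<ge> 1\<close> points is finite for bounded \<open>B\<close>, hence
  nothing is lost by \<^const>\<open>enn2real\<close>.\<close>

definition gibbs_weight :: "(real \<Rightarrow> real) \<Rightarrow> real \<Rightarrow> nat \<Rightarrow> (nat \<Rightarrow> real) \<Rightarrow> ennreal"
  where "gibbs_weight B \<sigma> n x =
    ennreal (exp (- (2 * n / \<sigma>\<^sup>2) * enn2real (energy B (empirical n x))))"

definition partition_fun :: "(real \<Rightarrow> real) \<Rightarrow> real \<Rightarrow> nat \<Rightarrow> ennreal"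
  where "partition_fun B \<sigma> n = (\<integral>\<^sup>+x. gibbs_weight B \<sigma> n x \<partial>hyperplane_lebesgue n)"

definition gibbs :: "(real \<Rightarrow> real) \<Rightarrow> real \<Rightarrow> nat \<Rightarrow> (nat \<Rightarrow> real) measure"
  where "gibbs B \<sigma> n =
    density (hyperplane_lebesgue n) (\<lambda>x. gibbs_weight B \<sigma> n x / partition_fun B \<sigma> n)"

definition empirical_law :: "(real \<Rightarrow> real) \<Rightarrow> real \<Rightarrow> nat \<Rightarrow> real measure measure"
  where "empirical_law B \<sigma> n = distr (gibbs B \<sigma> n) (borel_of weak_topology) (empirical n)"

definition orbit_law :: "(real \<Rightarrow> real) \<Rightarrow> real \<Rightarrow> nat \<Rightarrow> real measure set measure"
  where "orbit_law B \<sigma> n = distr (empirical_law B \<sigma> n) (borel_of orbit_topology) orbit"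

section \<open>Large deviations\<close>

text \<open>Rate functions take values in \<open>[0, \<infinity>]\<close>.\<close>

definition good_rate_function :: "'a topology \<Rightarrow> ('a \<Rightarrow> ereal) \<Rightarrow> bool"
  where "good_rate_function X I \<longleftrightarrow>
    (\<forall>x\<in>topspace X. 0 \<le> I x) \<and>
    (\<exists>x\<in>topspace X. I x < \<infinity>) \<and>
    (\<forall>a::real. compactin X {x \<in> topspace X. I x \<le> ereal a})"

definition log_prob :: "'a measure \<Rightarrow> 'a set \<Rightarrow> ereal"
  where "log_prob M A = (if measure M A = 0 then - \<infinity> else ereal (ln (measure M A)))"

definition large_deviation_principle ::
  "'a topology \<Rightarrow> (nat \<Rightarrow> real) \<Rightarrow> (nat \<Rightarrow> 'a measure) \<Rightarrow> ('a \<Rightarrow> ereal) \<Rightarrow> bool"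
  where "large_deviation_principle X s P I \<longleftrightarrow>
    (\<forall>G. openin X G \<longrightarrow>
       - (INF x\<in>G. I x) \<le> liminf (\<lambda>n. ereal (1 / s n) * log_prob (P n) G)) \<and>
    (\<forall>C. closedin X C \<longrightarrow>
       limsup (\<lambda>n. ereal (1 / s n) * log_prob (P n) C) \<le> - (INF x\<in>C. I x))"

end

theory Submission
  imports Defs
begin

text \<open>Everything is compared with integrals over all of \<open>\<real>\<^sup>n\<close>: for a translation invariant weight, the
  integral over the hyperplane is, up to the factor \<open>sqrt n\<close>, the integral over the configurations
  having an \<open>\<alpha>\<close>-quantile in \<open>(0, 1]\<close>, and the level \<open>\<alpha>\<close> is free.  On such configurations the energy
  controls the first moment, because \<open>B\<close> dominates a multiple of \<open>tent u = min u (1 - u)\<close>.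

  Upper bound: giving away a fraction \<open>\<epsilon>\<close> of \<open>tent\<close> turns the energy into a lower semicontinuous part plus
  a factor \<open>exp (- \<theta> \<bar>x\<^sub>i\<bar>)\<close> per particle.  Tilting by a bounded continuous \<open>h\<close> then makes the
  integral a product, and optimising over \<open>\<epsilon>\<close> and \<open>h\<close> gives the free energy by the variational formula
  for the entropy; energy sublevels of located measures are compact by Helly selection.
  Lower bound: under the product measure \<open>\<mu>\<^sup>n\<close> the distribution function of the sample converges to
  that of \<open>\<mu>\<close> in \<open>L\<^sup>1\<close>, hence so does the energy (\<open>B\<close> is Lipschitz), and \<open>ln p\<close> obeys the law of large
  numbers; the level \<open>\<alpha>\<close> is chosen such that \<open>\<mu>\<close> is located strictly.\<close>

section \<open>Weak convergence of sequences\<close>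

text \<open>The obstacle is translation invariance: a nonempty sublevel set of the energy is not
  tight, and centring at the mean does not help, because the mean is not continuous under weak
  convergence. Quantiles behave better: \<open>located\<close> survives weak limits, and every
  measure has a located translate. Passing from means to quantiles costs nothing, since the shifts
  that move the quantile of a given configuration into (0, 1] form a set of length exactly one. The
  partition function is never estimated on its own. The Gibbs probability of a set of orbits is a
  quotient of two unnormalised masses on the n-dimensional space, and the same bounds applied to the
  whole space produce the infimum of the free energy. The level has to vary because the law of large
  numbers keeps a sample located only if the inequalities at both ends of the window are strict. For
  a fixed level this can fail for every translate, namely when the distribution function is constant
  at that level on a long interval.\<close>

lemma prob_measures_iff_real_distribution: "\<mu> \<in> prob_measures \<longleftrightarrow> real_distribution \<mu>"
  unfolding prob_measures_iff real_distribution_def real_distribution_axioms_def by simp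

lemma isCont_cts_step: "a < b \<Longrightarrow> isCont (cts_step a b) x"
  using uniformly_continuous_imp_continuous[OF cts_step_uniformly_continuous, of a b]
  by (simp add: continuous_on_eq_continuous_at)

lemma cts_step_bounds: "0 \<le> cts_step a b x" "cts_step a b x \<le> 1"
  by (auto simp: cts_step_def divide_simps)

lemma bcontfun_cts_step: "a < b \<Longrightarrow> cts_step a b \<in> bcontfun"
  unfolding bcontfun_def
proof (intro CollectI conjI)
  show "bounded (range (cts_step a b))"
    by (rule boundedI[of _ 1]) (auto simp: cts_step_bounds)
qed (auto intro!: continuous_at_imp_continuous_on isCont_cts_step)

lemma tendsto_fun_iff:
  fixes l :: "'i \<Rightarrow> 'b::topological_space"
  shows "(f \<longlongrightarrow> l) F \<longleftrightarrow> (\<forall>i. ((\<lambda>n. f n i) \<longlongrightarrow> l i) F)"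
  using limitin_componentwise[of "\<lambda>_::'i. euclidean :: 'b topology" UNIV f l F]
  by (simp add: euclidean_product_topology)

text \<open>Countably many test functions, so that the target is a metrisable product and sequential
  arguments become available for the weak topology. The value 0 for pairs that are not increasing is
  a filler.\<close>

definition step_coords :: "real measure \<Rightarrow> rat \<times> rat \<Rightarrow> real"
  where "step_coords \<mu> q =
    (if fst q < snd q then integral\<^sup>L \<mu> (cts_step (of_rat (fst q)) (of_rat (snd q))) else 0)"

text \<open>The integral of \<open>cts_step a b\<close> lies between \<open>cdf M a\<close> and
  \<open>cdf M b\<close>. At a continuity point x, rationals a < b close to x on one side turn
  convergence of these integrals into one-sided bounds for the distribution functions at x.\<close>

lemma weak_conv_m_if_step_coords:
  assumes \<mu>: "\<And>n. real_distribution (\<mu> n)" and M: "real_distribution M"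
    and conv: "(\<lambda>n. step_coords (\<mu> n)) \<longlonglongrightarrow> step_coords M"
  shows "weak_conv_m \<mu> M"
  unfolding weak_conv_m_def weak_conv_def
proof (intro allI impI)
  interpret M: real_distribution M by fact
  interpret \<mu>: real_distribution "\<mu> n" for n by fact
  fix x assume cont: "isCont (cdf M) x"
  have step: "(\<lambda>n. integral\<^sup>L (\<mu> n) (cts_step (of_rat a) (of_rat b)))
      \<longlonglongrightarrow> integral\<^sup>L M (cts_step (of_rat a) (of_rat b))" if "a < b" for a b
    using tendsto_fun_iff[THEN iffD1, rule_format, OF conv, of "(a, b)"] that
        by (simp add: step_coords_def)
  show "(\<lambda>n. cdf (\<mu> n) x) \<longlonglongrightarrow> cdf M x"
  proof (rule order_tendstoI)
    fix l assume l: "l < cdf M x"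
    have "(cdf M \<longlongrightarrow> cdf M x) (at_left x)"
      using cont by (auto simp: continuous_at intro: tendsto_within_subset)
    from order_tendstoD(1)[OF this l] obtain y where y: "y < x" "l < cdf M y"
      unfolding eventually_at_left_field by (metis dense)
    obtain b where b: "y < of_rat b" "of_rat b < x" using of_rat_dense[OF y(1)] by blast
    obtain a where a: "y < of_rat a" "of_rat a < (of_rat b :: real)" using of_rat_dense[OF b(1)]
        by blast
    then have "a < b" by (simp add: of_rat_less)
    have "l < cdf M (of_rat a)" using y(2) M.cdf_nondecreasing[of y "of_rat a"] a(1) by linarith
    also have "\<dots> \<le> integral\<^sup>L M (cts_step (of_rat a) (of_rat b))"
      using a by (intro M.cdf_cts_step)
    finally have "\<forall>\<^sub>F n in sequentially. l < integral\<^sup>L (\<mu> n) (cts_step (of_rat a) (of_rat b))"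
      by (rule order_tendstoD(1)[OF step[OF \<open>a < b\<close>]])
    then show "\<forall>\<^sub>F n in sequentially. l < cdf (\<mu> n) x"
    proof eventually_elim
      case (elim n)
      then show ?case
        using \<mu>.cdf_cts_step(2)[OF a(2), of n] \<mu>.cdf_nondecreasing[of "of_rat b" x n] b(2)
            by linarith
    qed
  next
    fix l assume l: "cdf M x < l"
    have "(cdf M \<longlongrightarrow> cdf M x) (at_right x)"
      using cont by (auto simp: continuous_at intro: tendsto_within_subset)
    from order_tendstoD(2)[OF this l] obtain y where y: "x < y" "cdf M y < l"
      unfolding eventually_at_right_field by (metis dense)
    obtain b where b: "x < of_rat b" "of_rat b < y" using of_rat_dense[OF y(1)] by blast
    obtain a where a: "x < of_rat a" "of_rat a < (of_rat b :: real)" using of_rat_dense[OF b(1)]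
        by blast
    then have "a < b" by (simp add: of_rat_less)
    have "integral\<^sup>L M (cts_step (of_rat a) (of_rat b)) \<le> cdf M (of_rat b)"
      using a by (intro M.cdf_cts_step)
    also have "\<dots> < l" using y(2) M.cdf_nondecreasing[of "of_rat b" y] b(2) by linarith
    finally have "\<forall>\<^sub>F n in sequentially. integral\<^sup>L (\<mu> n) (cts_step (of_rat a) (of_rat b)) < l"
      by (rule order_tendstoD(2)[OF step[OF \<open>a < b\<close>]])
    then show "\<forall>\<^sub>F n in sequentially. cdf (\<mu> n) x < l"
    proof eventually_elim
      case (elim n)
      then show ?case
        using \<mu>.cdf_cts_step(1)[OF a(2), of n] \<mu>.cdf_nondecreasing[of x "of_rat a" n] a(1)
            by linarith
    qed
  qed
qed

lemma weak_conv_m_integral_bcontfun: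
  fixes f :: "real \<Rightarrow>\<^sub>C real"
  assumes "\<And>n. real_distribution (\<mu> n)" "real_distribution M" "weak_conv_m \<mu> M"
  shows "(\<lambda>n. integral\<^sup>L (\<mu> n) (apply_bcontfun f)) \<longlonglongrightarrow> integral\<^sup>L M (apply_bcontfun f)"
proof (rule weak_conv_imp_integral_bdd_continuous_conv[OF assms])
  show "isCont (apply_bcontfun f) x" for x
    by (meson continuous_on_apply_bcontfun continuous_on_eq_continuous_at open_UNIV UNIV_I)
  show "norm (apply_bcontfun f x) \<le> norm f" for x by (rule norm_bounded)
qed

lemma step_coords_tendsto:
  assumes "\<And>n. real_distribution (\<mu> n)" "real_distribution M" "weak_conv_m \<mu> M"
  shows "(\<lambda>n. step_coords (\<mu> n)) \<longlonglongrightarrow> step_coords M"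
proof (rule tendsto_fun_iff[THEN iffD2, rule_format])
  fix q
  show "(\<lambda>n. step_coords (\<mu> n) q) \<longlonglongrightarrow> step_coords M q"
  proof (cases "fst q < snd q")
    case True
    then have "(of_rat (fst q) :: real) < of_rat (snd q)" by (simp add: of_rat_less)
    from weak_conv_m_integral_bcontfun[OF assms, of "Bcontfun (cts_step (of_rat (fst q)) (of_rat
        (snd q)))"]
    show ?thesis using True
      by (simp add: step_coords_def Bcontfun_inverse[OF bcontfun_cts_step[OF \<open>(of_rat (fst q) ::
          real) < _\<close>]])
  qed (simp add: step_coords_def)
qed

text \<open>The weak topology is the initial topology for the countable coordinates
  \<open>step_coords\<close>. Sequential criteria for closedness and compactness, and Borel
  measurability of the empirical measure, rest on this reduction.\<close>

lemma openin_weak_topology_iff: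
  "openin weak_topology U \<longleftrightarrow> (\<exists>V. open V \<and> U = step_coords -` V \<inter> prob_measures)"
proof
  assume "\<exists>V. open V \<and> U = step_coords -` V \<inter> prob_measures"
  then obtain V where V: "open V" "U = step_coords -` V \<inter> prob_measures" by blast
  \<comment> \<open>\<open>G\<close> picks the step functions out of all bounded continuous
    functions. It is continuous for the product topologies, so \<open>step_coords\<close> factors
    continuously through the map that defines the weak topology.\<close>
  define G :: "((real \<Rightarrow>\<^sub>C real) \<Rightarrow> real) \<Rightarrow> rat \<times> rat \<Rightarrow> real" where
    "G \<phi> q = (if fst q < snd q then \<phi> (Bcontfun (cts_step (of_rat (fst q)) (of_rat (snd q)))) else
        0)" for \<phi> q
  have "continuous_on UNIV G"
  proof (rule continuous_on_coordinatewise_then_product)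
    fix q show "continuous_on UNIV (\<lambda>\<phi>. G \<phi> q)"
      by (cases "fst q < snd q") (simp_all add: G_def continuous_on_product_coordinates)
  qed
  then have "open (G -` V)" using V(1) by (simp add: open_vimage)
  moreover have "step_coords \<mu> = G (\<lambda>f. integral\<^sup>L \<mu> (apply_bcontfun f))" for \<mu>
    by (auto simp: G_def step_coords_def fun_eq_iff of_rat_less Bcontfun_inverse bcontfun_cts_step)
  ultimately show "openin weak_topology U"
    unfolding weak_topology_def openin_pullback_topology V(2) by auto
next
  assume "openin weak_topology U"
  then have "\<exists>W. open W \<and> U = (\<lambda>\<mu> (f :: real \<Rightarrow>\<^sub>C real). integral\<^sup>L \<mu> (apply_bcontfun f))
      -` W \<inter> prob_measures"
    unfolding weak_topology_def openin_pullback_topology open_openin[symmetric] .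
  then obtain W where W: "open W" "U = (\<lambda>\<mu> (f :: real \<Rightarrow>\<^sub>C real). integral\<^sup>L \<mu> (apply_bcontfun f))
      -` W \<inter> prob_measures"
    by (elim exE conjE)
  \<comment> \<open>Otherwise measures outside \<open>U\<close> converge to \<mu> in the
    coordinates, hence weakly, hence against all bounded continuous functions, and they must enter
    \<open>U\<close>.\<close>
  have *: "\<exists>e>0. \<forall>\<nu>\<in>prob_measures. dist (step_coords \<nu>) (step_coords \<mu>) < e \<longrightarrow> \<nu> \<in> U"
    if \<mu>: "\<mu> \<in> U" for \<mu>
  proof (rule ccontr)
    assume "\<not> ?thesis"
    then have "\<forall>n. \<exists>\<nu>. \<nu> \<in> prob_measures \<and> dist (step_coords \<nu>) (step_coords \<mu>) < inverse (Suc n)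
        \<and> \<nu> \<notin> U"
      by (metis inverse_Suc)
    then obtain \<nu> where \<nu>: "\<And>n. \<nu> n \<in> prob_measures"
      "\<And>n. dist (step_coords (\<nu> n)) (step_coords \<mu>) < inverse (Suc n)" "\<And>n. \<nu> n \<notin> U"
      by metis
    have d: "real_distribution (\<nu> n)" "real_distribution \<mu>" for n
      using \<nu>(1) \<mu> W(2) prob_measures_iff_real_distribution by blast+
    have "(\<lambda>n. step_coords (\<nu> n)) \<longlonglongrightarrow> step_coords \<mu>"
      by (rule metric_tendsto_imp_tendsto[OF LIMSEQ_inverse_real_of_nat])
         (use less_imp_le[OF \<nu>(2)] in \<open>auto intro!: always_eventually simp del: of_nat_Suc\<close>)
    then have "weak_conv_m \<nu> \<mu>" by (rule weak_conv_m_if_step_coords[OF d])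
    then have "(\<lambda>n (f :: real \<Rightarrow>\<^sub>C real). integral\<^sup>L (\<nu> n) (apply_bcontfun f))
        \<longlonglongrightarrow> (\<lambda>f. integral\<^sup>L \<mu> (apply_bcontfun f))"
      by (intro tendsto_fun_iff[THEN iffD2, rule_format] weak_conv_m_integral_bcontfun d)
    then have "\<forall>\<^sub>F n in sequentially. (\<lambda>f. integral\<^sup>L (\<nu> n) (apply_bcontfun f)) \<in> W"
      using W \<mu> by (intro topological_tendstoD) auto
    then show False using \<nu> W by (auto dest: eventually_happens)
  qed
  then obtain e where e: "\<And>\<mu>. \<mu> \<in> U \<Longrightarrow> e \<mu> > 0"
    "\<And>\<mu> \<nu>. \<mu> \<in> U \<Longrightarrow> \<nu> \<in> prob_measures \<Longrightarrow> dist (step_coords \<nu>) (step_coords \<mu>) < e \<mu> \<Longrightarrow> \<nu> \<in> U"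
    by metis
  define V where "V = (\<Union>\<mu>\<in>U. ball (step_coords \<mu>) (e \<mu>))"
  have "open V" unfolding V_def by (intro open_UN ballI open_ball)
  moreover have "U = step_coords -` V \<inter> prob_measures"
  proof (intro set_eqI iffI)
    fix \<mu> assume \<mu>: "\<mu> \<in> U"
    with e(1) have "step_coords \<mu> \<in> V" unfolding V_def by (intro UN_I) auto
    moreover have "\<mu> \<in> prob_measures" using \<mu> unfolding W(2) by (rule IntD2)
    ultimately show "\<mu> \<in> step_coords -` V \<inter> prob_measures" by simp
  next
    fix \<nu> assume "\<nu> \<in> step_coords -` V \<inter> prob_measures"
    then show "\<nu> \<in> U" using e(2) unfolding V_def by (auto simp: dist_commute)
  qed
  ultimately show "\<exists>V. open V \<and> U = step_coords -` V \<inter> prob_measures" by (intro exI[of _ V] conjI)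
qed

lemma openin_weak_topology_eventually:
  assumes U: "openin weak_topology U" "M \<in> U" and \<mu>: "\<And>n. \<mu> n \<in> prob_measures"
      and conv: "weak_conv_m \<mu> M"
  shows "\<forall>\<^sub>F n in sequentially. \<mu> n \<in> U"
proof -
  obtain V where V: "open V" "U = step_coords -` V \<inter> prob_measures"
    using U(1) openin_weak_topology_iff by blast
  have "(\<lambda>n. step_coords (\<mu> n)) \<longlonglongrightarrow> step_coords M"
    using \<mu> U(2) V(2) conv prob_measures_iff_real_distribution by (intro step_coords_tendsto) blast+
  from topological_tendstoD[OF this V(1)] show ?thesis
    using \<mu> U(2) V(2) by (auto elim!: eventually_mono)
qed

text \<open>The coordinate space is metric, so a measure whose coordinates lie in the closure of the
  image of \<open>C\<close> is a weak limit of a sequence from \<open>C\<close>.\<close>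

lemma closedin_weak_topology_sequentialI:
  assumes C: "C \<subseteq> prob_measures"
    and lim: "\<And>\<mu> M. (\<And>n. \<mu> n \<in> C) \<Longrightarrow> M \<in> prob_measures \<Longrightarrow> weak_conv_m \<mu> M \<Longrightarrow> M \<in> C"
  shows "closedin weak_topology C"
proof -
  have "prob_measures - C = step_coords -` (- closure (step_coords ` C)) \<inter> prob_measures"
  proof (intro set_eqI iffI)
    fix M assume "M \<in> prob_measures - C"
    then have M: "M \<in> prob_measures" "M \<notin> C" by auto
    have "step_coords M \<notin> closure (step_coords ` C)"
    proof
    assume "step_coords M \<in> closure (step_coords ` C)"
    then obtain s where s: "\<And>n. s n \<in> step_coords ` C" "s \<longlonglongrightarrow> step_coords M"
      unfolding closure_sequential by blast
    then have "\<forall>n. \<exists>\<nu>\<in>C. s n = step_coords \<nu>" by auto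
    then obtain \<mu> where \<mu>: "\<And>n. \<mu> n \<in> C" "\<And>n. s n = step_coords (\<mu> n)" by metis
    have s': "s = (\<lambda>n. step_coords (\<mu> n))" using \<mu>(2) by blast
    have "weak_conv_m \<mu> M"
    proof (rule weak_conv_m_if_step_coords)
      show "real_distribution (\<mu> n)" for n
        using \<mu>(1) C prob_measures_iff_real_distribution by blast
      show "real_distribution M" using M(1) prob_measures_iff_real_distribution by blast
    qed (use s(2) s' in simp)
    with lim \<mu>(1) M show False by blast
    qed
    with M show "M \<in> step_coords -` (- closure (step_coords ` C)) \<inter> prob_measures" by blast
  next
    fix M assume M: "M \<in> step_coords -` (- closure (step_coords ` C)) \<inter> prob_measures"
    then have "M \<notin> C" using closure_subset[of "step_coords ` C"] by blast
    with M show "M \<in> prob_measures - C" by blast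
  qed
  then have "openin weak_topology (prob_measures - C)"
    unfolding openin_weak_topology_iff by blast
  with C show ?thesis by (simp add: closedin_def topspace_weak_topology)
qed

text \<open>Weakly convergent subsequences make the image under \<open>step_coords\<close>
  sequentially compact, hence compact. Weakly open sets are full preimages of open sets, so a finite
  subcover of the image pulls back to \<open>K\<close>.\<close>

lemma compactin_weak_topology_sequentialI:
  assumes K: "K \<subseteq> prob_measures"
    and sub: "\<And>\<mu>. (\<And>n. \<mu> n \<in> K) \<Longrightarrow> \<exists>M\<in>K. \<exists>r::nat\<Rightarrow>nat. strict_mono r \<and> weak_conv_m (\<mu> \<circ> r) M"
  shows "compactin weak_topology K"
proof -
  have "seq_compact (step_coords ` K)"
  proof (rule seq_compactI)
    fix s :: "nat \<Rightarrow> rat \<times> rat \<Rightarrow> real" assume s: "\<forall>n. s n \<in> step_coords ` K"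
    define \<mu> where "\<mu> n = inv_into K step_coords (s n)" for n
    have \<mu>: "\<mu> n \<in> K" "s n = step_coords (\<mu> n)" for n
      unfolding \<mu>_def using s inv_into_into[of "s n" step_coords K] f_inv_into_f[of "s n"
          step_coords K]
      by simp_all
    from sub[of \<mu>, OF \<mu>(1)] obtain M r where M: "M
        \<in> K" "strict_mono (r::nat\<Rightarrow>nat)" "weak_conv_m (\<mu> \<circ> r) M"
      by blast
    have "(\<lambda>n. step_coords ((\<mu> \<circ> r) n)) \<longlonglongrightarrow> step_coords M"
    proof (rule step_coords_tendsto[OF _ _ M(3)])
      show "real_distribution ((\<mu> \<circ> r) n)" for n
        using \<mu>(1)[of "r n"] K prob_measures_iff_real_distribution by auto
      show "real_distribution M" using M(1) K prob_measures_iff_real_distribution by blast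
    qed
    then show "\<exists>l\<in>step_coords ` K. \<exists>r. strict_mono r \<and> (s \<circ> r) \<longlonglongrightarrow> l"
      by (intro bexI[of _ "step_coords M"] exI[of _ r] conjI imageI M) (simp add: comp_def
          \<mu>(2)[abs_def])
  qed
  then have cpt: "compact (step_coords ` K)" by (simp add: compact_eq_seq_compact_metric)
  show ?thesis
    unfolding compactin_def topspace_weak_topology
  proof (intro conjI K allI impI)
    fix \<U> assume \<U>: "(\<forall>U\<in>\<U>. openin weak_topology U) \<and> K \<subseteq> \<Union>\<U>"
    then obtain V where V: "\<And>U. U \<in> \<U> \<Longrightarrow> open (V U)" "\<And>U. U \<in> \<U> \<Longrightarrow> U = step_coords
        -` V U \<inter> prob_measures"
      unfolding openin_weak_topology_iff by metis
    have "step_coords ` K \<subseteq> (\<Union>U\<in>\<U>. V U)" using \<U> V(2) by blast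
    then obtain \<F> where "\<F> \<subseteq> \<U>" "finite \<F>" "step_coords ` K \<subseteq> (\<Union>U\<in>\<F>. V U)"
      using compactE_image[OF cpt, of \<U> V, OF V(1)] by blast
    moreover have "K \<subseteq> \<Union>\<F>"
    proof
      fix M assume "M \<in> K"
      then obtain U where "U \<in> \<F>" "step_coords M \<in> V U" using calculation(3) by blast
      then show "M \<in> \<Union>\<F>" using \<open>M \<in> K\<close> K V(2) calculation(1) by blast
    qed
    ultimately show "\<exists>\<F>. finite \<F> \<and> \<F> \<subseteq> \<U> \<and> K \<subseteq> \<Union>\<F>" by (intro exI[of _ \<F>] conjI)
  qed
qed

section \<open>Energy and first moments\<close>

definition tent :: "real \<Rightarrow> real"
  where "tent u = min u (1 - u)"

text \<open>Some \<open>\<alpha>\<close>-quantile lies in \<open>[l, r]\<close>; in this form the condition is closed under weak limits.\<close>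

definition located :: "real \<Rightarrow> real \<Rightarrow> real \<Rightarrow> real measure \<Rightarrow> bool"
  where "located \<alpha> l r \<mu> \<longleftrightarrow> measure \<mu> {..<l} \<le> \<alpha> \<and> \<alpha> \<le> cdf \<mu> r"

lemma (in real_distribution) measurable_cdf [measurable]: "cdf M \<in> borel_measurable borel"
  by (rule borel_measurable_mono) (auto intro!: monoI cdf_nondecreasing)

text \<open>\<open>B\<close> is controlled only on [0, 1]; clamping the argument extends it
  continuously to the line without changing its values on distribution functions.\<close>

lemma (in real_distribution) measurable_comp_cdf:
  fixes B :: "real \<Rightarrow> real"
  assumes "continuous_on {0..1} B"
  shows "(\<lambda>x. B (cdf M x)) \<in> borel_measurable borel"
proof -
  have "continuous_on UNIV (\<lambda>u. B (max 0 (min 1 u)))"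
    by (rule continuous_on_compose2[OF assms]) (auto intro!: continuous_intros)
  then have [measurable]: "(\<lambda>u. B (max 0 (min 1 u))) \<in> borel_measurable borel"
    by (rule borel_measurable_continuous_onI)
  have "B (max 0 (min 1 (cdf M x))) = B (cdf M x)" for x
    using cdf_nonneg[of x] cdf_bounded_prob[of x] by simp
  moreover have "(\<lambda>x. B (max 0 (min 1 (cdf M x)))) \<in> borel_measurable borel" by measurable
  ultimately show ?thesis by simp
qed

lemma AE_lborel_isCont_cdf:
  assumes "real_distribution M"
  shows "AE x in lborel. isCont (cdf M) x"
proof -
  interpret real_distribution M by fact
  have "countable {x. \<not> isCont (cdf M) x}"
    using countable_support by (simp add: isCont_cdf)
  from countable_imp_null_set_lborel[OF this] show ?thesis
    by (rule AE_I') auto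
qed

text \<open>Fatou's lemma: the distribution functions converge at the continuity points of the
  limit, and the other points form a countable null set.\<close>

lemma energy_lsc:
  assumes \<mu>: "\<And>n. real_distribution (\<mu> n)" and M: "real_distribution M" and conv: "weak_conv_m \<mu> M"
    and B: "continuous_on {0..1} B"
  shows "energy B M \<le> liminf (\<lambda>n. energy B (\<mu> n))"
proof -
  interpret M: real_distribution M by fact
  interpret \<mu>: real_distribution "\<mu> n" for n by fact
  have [measurable]: "(\<lambda>x. ennreal (B (cdf (\<mu> n) x))) \<in> borel_measurable lborel" for n
    using \<mu>.measurable_comp_cdf[OF B] by simp
  have "energy B M = (\<integral>\<^sup>+x. liminf (\<lambda>n. ennreal (B (cdf (\<mu> n) x))) \<partial>lborel)"
    unfolding energy_def
  proof (rule nn_integral_cong_AE)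
    show "AE x in lborel. ennreal (B (cdf M x)) = liminf (\<lambda>n. ennreal (B (cdf (\<mu> n) x)))"
      using AE_lborel_isCont_cdf[OF M]
    proof eventually_elim
      case (elim x)
      have "(\<lambda>n. cdf (\<mu> n) x) \<longlonglongrightarrow> cdf M x"
        using conv elim by (auto simp: weak_conv_m_def weak_conv_def)
      then have "(\<lambda>n. B (cdf (\<mu> n) x)) \<longlonglongrightarrow> B (cdf M x)"
        by (intro continuous_on_tendsto_compose[OF B])
           (auto simp: \<mu>.cdf_nonneg \<mu>.cdf_bounded_prob M.cdf_nonneg M.cdf_bounded_prob)
      then have "(\<lambda>n. ennreal (B (cdf (\<mu> n) x))) \<longlonglongrightarrow> ennreal (B (cdf M x))"
        by (rule tendsto_ennrealI)
      from lim_imp_Liminf[OF _ this] show ?case by simp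
    qed
  qed
  also have "\<dots> \<le> liminf (\<lambda>n. energy B (\<mu> n))"
    unfolding energy_def by (rule nn_integral_liminf) measurable
  finally show ?thesis .
qed

lemma openin_energy_gt:
  assumes B: "continuous_on {0..1} B"
  shows "openin weak_topology {\<nu> \<in> prob_measures. w < energy B \<nu>}"
proof -
  have "closedin weak_topology {\<nu> \<in> prob_measures. energy B \<nu> \<le> w}"
  proof (rule closedin_weak_topology_sequentialI)
    fix \<mu> M assume \<mu>: "\<And>n. \<mu> n \<in> {\<nu> \<in> prob_measures. energy B \<nu> \<le> w}"
      and M: "M \<in> prob_measures" and conv: "weak_conv_m \<mu> M"
    have "energy B M \<le> liminf (\<lambda>n. energy B (\<mu> n))"
      using \<mu> M by (intro energy_lsc[OF _ _ conv B]) (simp_all add: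
          prob_measures_iff_real_distribution)
    also have "\<dots> \<le> w"
      using \<mu> by (intro Liminf_le) (auto intro!: always_eventually)
    finally show "M \<in> {\<nu> \<in> prob_measures. energy B \<nu> \<le> w}" using M by simp
  qed auto
  then have "openin weak_topology (prob_measures - {\<nu> \<in> prob_measures. energy B \<nu> \<le> w})"
    by (simp add: closedin_def topspace_weak_topology)
  also have "prob_measures - {\<nu> \<in> prob_measures. energy B \<nu> \<le> w} = {\<nu> \<in> prob_measures. w
      < energy B \<nu>}"
    by auto
  finally show ?thesis .
qed

lemma openin_integral_gt:
  fixes h :: "real \<Rightarrow> real"
  assumes h: "\<And>x. isCont h x" "\<And>x. \<bar>h x\<bar> \<le> k"
  shows "openin weak_topology {\<nu> \<in> prob_measures. s < integral\<^sup>L \<nu> h}"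
proof -
  have "closedin weak_topology {\<nu> \<in> prob_measures. integral\<^sup>L \<nu> h \<le> s}"
  proof (rule closedin_weak_topology_sequentialI)
    fix \<mu> M assume \<mu>: "\<And>n. \<mu> n \<in> {\<nu> \<in> prob_measures. integral\<^sup>L \<nu> h \<le> s}"
      and M: "M \<in> prob_measures" and conv: "weak_conv_m \<mu> M"
    have "(\<lambda>n. integral\<^sup>L (\<mu> n) h) \<longlonglongrightarrow> integral\<^sup>L M h"
      using \<mu> M h
      by (intro weak_conv_imp_integral_bdd_continuous_conv[OF _ _ conv])
         (simp_all add: prob_measures_iff_real_distribution)
    then have "integral\<^sup>L M h \<le> s" using \<mu> by (intro LIMSEQ_le_const2) auto
    then show "M \<in> {\<nu> \<in> prob_measures. integral\<^sup>L \<nu> h \<le> s}" using M by simp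
  qed auto
  then have "openin weak_topology (prob_measures - {\<nu> \<in> prob_measures. integral\<^sup>L \<nu> h \<le> s})"
    by (simp add: closedin_def topspace_weak_topology)
  also have "prob_measures - {\<nu> \<in> prob_measures. integral\<^sup>L \<nu> h \<le> s} = {\<nu> \<in> prob_measures. s
      < integral\<^sup>L \<nu> h}"
    by auto
  finally show ?thesis .
qed

text \<open>Layer cake formula: the absolute value of x is the length of the interval between 0 and
  x, and Tonelli exchanges the two integrals. Half-open intervals make the inner measure exactly
  \<open>1 - cdf M t\<close> or \<open>cdf M t\<close>, also at atoms.\<close>

lemma (in real_distribution) nn_integral_abs_eq_cdf:
  "(\<integral>\<^sup>+x. ennreal \<bar>x\<bar> \<partial>M) = (\<integral>\<^sup>+t. ennreal (if 0 \<le> t then 1 - cdf M t else cdf M t) \<partial>lborel)"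
proof -
  interpret pair_sigma_finite M lborel ..
  define f :: "real \<Rightarrow> real \<Rightarrow> ennreal" where
    "f x t = indicator {z. (0 \<le> snd z \<and> snd z < fst z) \<or> (fst z \<le> snd z \<and> snd z < 0)} (x, t)"
        for x t
  have [measurable]: "case_prod f \<in> borel_measurable (M \<Otimes>\<^sub>M lborel)"
    unfolding f_def by (simp add: split_beta') measurable
  have "(\<integral>\<^sup>+t. (\<integral>\<^sup>+x. f x t \<partial>M) \<partial>lborel) = (\<integral>\<^sup>+x. (\<integral>\<^sup>+t. f x t \<partial>lborel) \<partial>M)"
    by (rule Fubini') measurable
  moreover have "(\<integral>\<^sup>+t. f x t \<partial>lborel) = ennreal \<bar>x\<bar>" for x
  proof -
    have "(\<integral>\<^sup>+t. f x t \<partial>lborel) = (\<integral>\<^sup>+t. indicator (if 0 \<le> x then {0..<x} else {x..<0}) t \<partial>lborel)"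
      by (intro nn_integral_cong) (auto simp: f_def indicator_def)
    also have "\<dots> = ennreal \<bar>x\<bar>" by auto
    finally show ?thesis .
  qed
  moreover have "(\<integral>\<^sup>+x. f x t \<partial>M) = ennreal (if 0 \<le> t then 1 - cdf M t else cdf M t)" for t
  proof -
    have "(\<integral>\<^sup>+x. f x t \<partial>M) = (\<integral>\<^sup>+x. indicator (if 0 \<le> t then UNIV - {..t} else {..t}) x \<partial>M)"
      by (intro nn_integral_cong) (auto simp: f_def indicator_def)
    also have "\<dots> = emeasure M (if 0 \<le> t then UNIV - {..t} else {..t})"
      by (intro nn_integral_indicator) (auto simp: Compl_eq_Diff_UNIV[symmetric])
    also have "\<dots> = ennreal (if 0 \<le> t then 1 - cdf M t else cdf M t)"
      using prob_compl[of "{..t}"] by (simp add: emeasure_eq_measure cdf_def)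
    finally show ?thesis .
  qed
  ultimately show ?thesis by simp
qed

lemma continuous_on_tent: "continuous_on S tent"
  unfolding tent_def[abs_def] by (intro continuous_intros)

text \<open>Inside the window the layer cake integrand is at most 1, which costs the length r - l.
  Left of it the value F of the distribution function satisfies F \<le> \<alpha>, so
  \<open>tent \<alpha> * F\<close> is below F and below 1 - \<alpha> \<le> 1 - F, hence below
  \<open>tent F\<close>; the right side is symmetric.\<close>

lemma abs_moment_le_energy_tent:
  assumes M: "real_distribution M" and \<alpha>: "0 < \<alpha>" "\<alpha> < 1" and lr: "l \<le> 0" "0 \<le> r"
    and loc: "located \<alpha> l r M"
  shows "ennreal (tent \<alpha>) * (\<integral>\<^sup>+x. ennreal \<bar>x\<bar> \<partial>M) \<le> ennreal (tent \<alpha> * (r - l)) + energy tent M"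
proof -
  interpret real_distribution M by fact
  have \<gamma>: "0 < tent \<alpha>" "tent \<alpha> \<le> \<alpha>" "tent \<alpha> \<le> 1 - \<alpha>" "tent \<alpha> \<le> 1" using \<alpha> by (auto simp: tent_def)
  have [measurable]: "(\<lambda>t. tent (cdf M t)) \<in> borel_measurable borel"
    by (rule measurable_comp_cdf[OF continuous_on_tent])
  have pt: "ennreal (tent \<alpha>) * ennreal (if 0 \<le> t then 1 - cdf M t else cdf M t)
      \<le> ennreal (tent \<alpha>) * indicator {l..r} t + ennreal (tent (cdf M t))" for t
  proof -
    let ?F = "cdf M t"
    have F: "0 \<le> ?F" "?F \<le> 1" using cdf_nonneg cdf_bounded_prob by auto
    have "tent \<alpha> * (if 0 \<le> t then 1 - ?F else ?F) \<le> tent \<alpha> * indicator {l..r} t + tent ?F"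
    proof (cases "t \<in> {l..r}")
      case True
      have "tent \<alpha> * (if 0 \<le> t then 1 - ?F else ?F) \<le> tent \<alpha> * 1"
        using F \<gamma> by (intro mult_left_mono) auto
      moreover have "0 \<le> tent ?F" using F by (simp add: tent_def)
      ultimately show ?thesis using True by simp
    next
      case False
      then consider "t < l" | "r < t" by force
      then show ?thesis
      proof cases
        case 1
        have "?F \<le> measure M {..<l}" unfolding cdf_def using 1 by (intro finite_measure_mono) auto
        then have "?F \<le> \<alpha>" using loc by (simp add: located_def)
        moreover have "tent \<alpha> * ?F \<le> ?F" "tent \<alpha> * ?F \<le> tent \<alpha>"
          using F \<gamma> by (auto intro!: mult_left_le_one_le mult_left_le)
        ultimately show ?thesis using 1 lr False \<gamma>(2-4) by (auto simp: tent_def[of "cdf M t"])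
      next
        case 2
        then have "\<alpha> \<le> ?F" using loc cdf_nondecreasing[of r t] by (simp add: located_def)
        moreover have "tent \<alpha> * (1 - ?F) \<le> (1 - ?F)" "tent \<alpha> * (1 - ?F) \<le> tent \<alpha>"
          using F \<gamma> by (auto intro!: mult_left_le_one_le mult_left_le)
        ultimately show ?thesis using 2 lr False \<gamma>(2-4) by (auto simp add: tent_def[of "cdf M t"])
      qed
    qed
    then have "ennreal (tent \<alpha> * (if 0 \<le> t then 1 - ?F else ?F)) \<le> ennreal (tent \<alpha>
        * indicator {l..r} t + tent ?F)"
      by (rule ennreal_leI)
    moreover have "ennreal (tent \<alpha> * indicator {l..r} t + tent ?F) = ennreal (tent \<alpha>)
        * indicator {l..r} t + ennreal (tent ?F)"
      using \<gamma> F by (subst ennreal_plus) (auto simp: tent_def indicator_def)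
    ultimately show ?thesis using \<gamma> F by (simp add: ennreal_mult)
  qed
  have "ennreal (tent \<alpha>) * (\<integral>\<^sup>+x. ennreal \<bar>x\<bar> \<partial>M)
      = (\<integral>\<^sup>+t. ennreal (tent \<alpha>) * ennreal (if 0 \<le> t then 1 - cdf M t else cdf M t) \<partial>lborel)"
    unfolding nn_integral_abs_eq_cdf by (rule nn_integral_cmult[symmetric]) measurable
  also have "\<dots> \<le> (\<integral>\<^sup>+t. ennreal (tent \<alpha>) * indicator {l..r} t + ennreal (tent (cdf M t)) \<partial>lborel)"
    by (intro nn_integral_mono pt)
  also have "\<dots> = ennreal (tent \<alpha>) * ennreal (r - l) + energy tent M"
    unfolding energy_def using lr by (simp add: nn_integral_add nn_integral_cmult)
  finally show ?thesis using \<gamma> lr by (simp add: ennreal_mult)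
qed

text \<open>The two bounds pass to the limit at points without atoms, just left of l and just right
  of r. One-sided limits of the distribution function then recover the mass of the open half-line
  below l and the value at r, which is why \<open>located\<close> is stated with these two
  quantities.\<close>

lemma located_weak_limit:
  assumes \<mu>: "\<And>n. real_distribution (\<mu> n)" and M: "real_distribution M" and conv: "weak_conv_m \<mu> M"
    and loc: "\<And>n. located \<alpha> l r (\<mu> n)"
  shows "located \<alpha> l r M"
proof -
  interpret M: real_distribution M by fact
  interpret \<mu>: real_distribution "\<mu> n" for n by fact
  have lim: "(\<lambda>n. cdf (\<mu> n) y) \<longlonglongrightarrow> cdf M y" if "measure M {y} = 0" for y
    using conv that M.isCont_cdf by (auto simp: weak_conv_m_def weak_conv_def)
  have "cdf M z \<le> \<alpha>" if z: "z < l" for z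
  proof -
    obtain y where y: "z < y" "y < l" "measure M {y} = 0"
      using open_minus_countable[OF M.countable_support, of "{z<..<l}"] z by auto
    have "cdf (\<mu> n) y \<le> \<alpha>" for n
    proof -
      have "cdf (\<mu> n) y \<le> measure (\<mu> n) {..<l}"
        unfolding cdf_def using y by (intro \<mu>.finite_measure_mono) auto
      then show ?thesis using loc[of n] by (simp add: located_def)
    qed
    then have "cdf M y \<le> \<alpha>" using lim[OF y(3)] by (intro LIMSEQ_le_const2) auto
    then show ?thesis using M.cdf_nondecreasing[of z y] y by simp
  qed
  then have "measure M {..<l} \<le> \<alpha>"
    by (intro tendsto_upperbound[OF M.cdf_at_left[of l]])
       (auto simp: eventually_at_filter intro!: always_eventually)
  moreover have "\<alpha> \<le> cdf M z" if z: "r < z" for z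
  proof -
    obtain y where y: "r < y" "y < z" "measure M {y} = 0"
      using open_minus_countable[OF M.countable_support, of "{r<..<z}"] z by auto
    have "\<alpha> \<le> cdf (\<mu> n) y" for n
      using loc[of n] \<mu>.cdf_nondecreasing[of r y n] y by (simp add: located_def)
    then have "\<alpha> \<le> cdf M y" using lim[OF y(3)] by (intro LIMSEQ_le_const) auto
    then show ?thesis using M.cdf_nondecreasing[of y z] y by simp
  qed
  then have "\<alpha> \<le> cdf M r"
    using M.cdf_is_right_cont[of r]
    by (intro tendsto_lowerbound[of "cdf M" "cdf M r" "at_right r"])
       (auto simp: eventually_at_filter continuous_within intro!: always_eventually)
  ultimately show ?thesis by (simp add: located_def)
qed

lemma tight_if_bounded_abs_moment:
  assumes \<mu>: "\<And>n. real_distribution (\<mu> n)" and C: "\<And>n. (\<integral>\<^sup>+x. ennreal \<bar>x\<bar> \<partial>\<mu> n) \<le> ennreal C"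
  shows "tight \<mu>"
  unfolding tight_def
proof (intro conjI allI impI \<mu>)
  interpret \<mu>: real_distribution "\<mu> n" for n by fact
  fix e :: real assume e: "e > 0"
  \<comment> \<open>Threshold for Markov's inequality; the summand 1 keeps \<open>R\<close> positive
    and makes the tail bound strictly smaller than e.\<close>
  define R where "R = \<bar>C\<bar> / e + 1"
  have R: "R > 0" "\<bar>C\<bar> < e * R" using e by (auto simp: R_def add_nonneg_pos field_simps)
  have "measure (\<mu> n) {- R<..R} > 1 - e" for n
  proof -
    have "ennreal R * emeasure (\<mu> n) {x. R \<le> \<bar>x\<bar>} = (\<integral>\<^sup>+x. ennreal R * indicator {x. R \<le> \<bar>x\<bar>} x
        \<partial>\<mu> n)"
      by (subst nn_integral_cmult) (auto)
    also have "\<dots> \<le> (\<integral>\<^sup>+x. ennreal \<bar>x\<bar> \<partial>\<mu> n)"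
      by (intro nn_integral_mono) (auto simp: indicator_def ennreal_leI)
    also have "\<dots> \<le> ennreal \<bar>C\<bar>" using C[of n] by (rule order_trans) (simp add: ennreal_leI)
    finally have "R * measure (\<mu> n) {x. R \<le> \<bar>x\<bar>} \<le> \<bar>C\<bar>"
      using R by (simp add: \<mu>.emeasure_eq_measure ennreal_mult[symmetric])
    also note R(2)
    finally have "measure (\<mu> n) {x. R \<le> \<bar>x\<bar>} < e" using R(1) by (simp add: mult.commute)
    moreover have "1 = measure (\<mu> n) UNIV" using \<mu>.prob_space[of n] by simp
    moreover have "measure (\<mu> n) UNIV \<le> measure (\<mu> n) ({- R<..R} \<union> {x. R \<le> \<bar>x\<bar>})"
      by (intro \<mu>.finite_measure_mono) auto
    moreover have "\<dots> \<le> measure (\<mu> n) {- R<..R} + measure (\<mu> n) {x. R \<le> \<bar>x\<bar>}"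
      by (intro measure_Un_le) auto
    ultimately show ?thesis by linarith
  qed
  moreover have "- R < R" using R(1) by simp
  ultimately show "\<exists>a b. a < b \<and> (\<forall>n. 1 - e < measure (\<mu> n) {a<..b})" by blast
qed

text \<open>Location breaks the translation invariance: together with the comparison with
  \<open>tent\<close> it bounds the first moments uniformly, which gives tightness. Weak limits stay
  in the set because the energy is lower semicontinuous and location is closed.\<close>

lemma compactin_energy_sublevel:
  assumes \<alpha>: "0 < \<alpha>" "\<alpha> < 1" and B: "continuous_on {0..1} B" and \<kappa>: "0 < \<kappa>"
    and tent: "\<And>u. u \<in> {0..1} \<Longrightarrow> \<kappa> * tent u \<le> B u"
  shows "compactin weak_topology {\<nu> \<in> prob_measures. energy B \<nu> \<le> ennreal w \<and> located \<alpha> 0 1 \<nu>}"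
    (is "compactin _ ?K")
proof (rule compactin_weak_topology_sequentialI)
  fix \<mu> :: "nat \<Rightarrow> real measure" assume \<mu>: "\<And>n. \<mu> n \<in> ?K"
  then have d: "real_distribution (\<mu> n)" for n using prob_measures_iff_real_distribution by blast
  have \<gamma>: "0 < tent \<alpha>" using \<alpha> by (auto simp: tent_def)
  \<comment> \<open>Solves \<open>\<kappa> * tent \<alpha> * m \<le> \<kappa> * tent \<alpha> +
    |w|\<close> for the moment m; the first summand on the right stems from the window [0, 1] of
    length 1.\<close>
  define C where "C = 1 + \<bar>w\<bar> / (\<kappa> * tent \<alpha>)"
  have "(\<integral>\<^sup>+x. ennreal \<bar>x\<bar> \<partial>\<mu> n) \<le> ennreal C" for n
  proof -
    interpret real_distribution "\<mu> n" by (rule d)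
    have [measurable]: "(\<lambda>t. tent (cdf (\<mu> n) t)) \<in> borel_measurable borel"
      by (rule measurable_comp_cdf[OF continuous_on_tent])
    have "ennreal \<kappa> * energy tent (\<mu> n) = (\<integral>\<^sup>+x. ennreal \<kappa> * ennreal (tent (cdf (\<mu> n) x)) \<partial>lborel)"
      unfolding energy_def by (rule nn_integral_cmult[symmetric]) measurable
    also have "\<dots> \<le> energy B (\<mu> n)"
      unfolding energy_def
    proof (rule nn_integral_mono)
      fix x
      have "\<kappa> * tent (cdf (\<mu> n) x) \<le> B (cdf (\<mu> n) x)"
        using cdf_nonneg cdf_bounded_prob by (intro tent) auto
      then show "ennreal \<kappa> * ennreal (tent (cdf (\<mu> n) x)) \<le> ennreal (B (cdf (\<mu> n) x))"
        using \<kappa> by (subst ennreal_mult'[symmetric]) (auto intro: ennreal_leI)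
    qed
    also have "\<dots> \<le> ennreal \<bar>w\<bar>" using \<mu>[of n] by (auto intro: order_trans ennreal_leI)
    finally have 1: "ennreal \<kappa> * energy tent (\<mu> n) \<le> ennreal \<bar>w\<bar>" .
    have 2: "ennreal (tent \<alpha>) * (\<integral>\<^sup>+x. ennreal \<bar>x\<bar> \<partial>\<mu> n) \<le> ennreal (tent \<alpha>) + energy tent (\<mu> n)"
      using abs_moment_le_energy_tent[OF d \<alpha>, of 0 1 n] \<mu>[of n] by simp
    have "ennreal (\<kappa> * tent \<alpha>) * (\<integral>\<^sup>+x. ennreal \<bar>x\<bar> \<partial>\<mu> n) \<le> ennreal \<kappa> * (ennreal (tent \<alpha>)
        + energy tent (\<mu> n))"
      using mult_left_mono[OF 2, of "ennreal \<kappa>"] \<kappa> \<gamma> by (simp add: ennreal_mult mult.assoc)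
    also have "\<dots> \<le> ennreal (\<kappa> * tent \<alpha>) + ennreal \<bar>w\<bar>"
      using 1 \<kappa> \<gamma> by (simp add: distrib_left ennreal_mult add_left_mono)
    also have "\<dots> = ennreal (\<kappa> * tent \<alpha>) * ennreal C"
      using \<kappa> \<gamma> by (simp add: C_def ennreal_mult[symmetric] ennreal_plus[symmetric] field_simps del:
          ennreal_plus)
    finally show ?thesis
      using \<kappa> \<gamma> by (simp add: ennreal_mult_le_mult_iff)
  qed
  with d have "tight \<mu>" by (rule tight_if_bounded_abs_moment)
  from tight_imp_convergent_subsubsequence[OF this strict_mono_id]
  obtain r M where r: "strict_mono (r :: nat \<Rightarrow> nat)" "real_distribution M" "weak_conv_m (\<mu> \<circ> r) M"
    by (auto simp: comp_def)
  have d': "real_distribution ((\<mu> \<circ> r) n)" for n using d by simp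
  have "energy B M \<le> liminf (\<lambda>n. energy B ((\<mu> \<circ> r) n))"
    by (rule energy_lsc[OF d' r(2,3) B])
  also have "\<dots> \<le> ennreal w"
    using \<mu> by (intro Liminf_le) (auto intro!: always_eventually)
  finally have "energy B M \<le> ennreal w" .
  moreover have "located \<alpha> 0 1 M"
    using \<mu> by (intro located_weak_limit[OF d' r(2,3)]) auto
  ultimately have "M \<in> ?K" using r(2) prob_measures_iff_real_distribution by blast
  with r show "\<exists>M\<in>?K. \<exists>r::nat\<Rightarrow>nat. strict_mono r \<and> weak_conv_m (\<mu> \<circ> r) M" by blast
qed auto

section \<open>Empirical measures and integration over the hyperplane\<close>

lemma prob_space_uniform_count: "n \<ge> 1 \<Longrightarrow> prob_space (uniform_count_measure {1..n::nat})"
  by (intro prob_space_uniform_count_measure) auto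

lemma measurable_uniform_count: "x \<in> uniform_count_measure {1..n::nat} \<rightarrow>\<^sub>M borel"
  by (simp add: measurable_def sets_uniform_count_measure space_uniform_count_measure)

lemma real_distribution_empirical: "n \<ge> 1 \<Longrightarrow> real_distribution (empirical n x)"
  using prob_space.prob_space_distr[OF prob_space_uniform_count measurable_uniform_count]
  by (auto simp: empirical_def real_distribution_def real_distribution_axioms_def)

lemma integral_empirical:
  fixes h :: "real \<Rightarrow> real"
  assumes [measurable]: "h \<in> borel_measurable borel"
  shows "integral\<^sup>L (empirical n x) h = (\<Sum>i=1..n. h (x i)) / n"
proof -
  have "integral\<^sup>L (empirical n x) h = integral\<^sup>L (uniform_count_measure {1..n}) (\<lambda>i. h (x i))"
    unfolding empirical_def by (rule integral_distr[OF measurable_uniform_count]) simp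
  also have "\<dots> = (\<Sum>i=1..n. h (x i)) / n"
    by (simp add: integral_uniform_count_measure)
  finally show ?thesis .
qed

lemma nn_integral_empirical:
  fixes h :: "real \<Rightarrow> real"
  assumes [measurable]: "h \<in> borel_measurable borel" and "\<And>t. 0 \<le> h t" and "n \<ge> 1"
  shows "(\<integral>\<^sup>+t. ennreal (h t) \<partial>empirical n x) = ennreal ((\<Sum>i=1..n. h (x i)) / n)"
proof -
  have "(\<integral>\<^sup>+t. ennreal (h t) \<partial>empirical n x) = (\<integral>\<^sup>+i. ennreal (h (x i))
      \<partial>uniform_count_measure {1..n})"
    unfolding empirical_def by (rule nn_integral_distr[OF measurable_uniform_count]) simp
  also have "\<dots> = ennreal ((\<Sum>i=1..n. h (x i)) / n)"
    using assms by (simp add: uniform_count_measure_def nn_integral_point_measure_finite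
        ennreal_mult[symmetric] sum_ennreal sum_divide_distrib)
  finally show ?thesis .
qed

lemma cdf_empirical: "cdf (empirical n x) t = (\<Sum>i=1..n. indicator {..t} (x i)) / n"
  using integral_empirical[of "indicator {..t}" n x]
  by (simp add: cdf_def empirical_def)

lemma empirical_translate:
  "empirical n (\<lambda>i\<in>{1..n}. x i + y) = translate y (empirical n x)"
proof -
  have "distr (distr (uniform_count_measure {1..n}) borel x) borel (\<lambda>t. t + y)
      = distr (uniform_count_measure {1..n}) borel ((\<lambda>t. t + y) \<circ> x)"
    by (rule distr_distr[OF _ measurable_uniform_count]) simp
  also have "\<dots> = distr (uniform_count_measure {1..n}) borel (\<lambda>i\<in>{1..n}. x i + y)"
    by (rule distr_cong) (auto simp: space_uniform_count_measure)
  finally show ?thesis by (simp add: empirical_def translate_def)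
qed

lemma measurable_cdf_empirical [measurable]:
  "(\<lambda>x. cdf (empirical n x) t) \<in> borel_measurable (\<Pi>\<^sub>M i\<in>{1..n}. borel)"
  unfolding cdf_empirical by measurable

lemma measurable_step_coords_empirical:
  "(\<lambda>x. step_coords (empirical n x)) \<in> (\<Pi>\<^sub>M i\<in>{1..n}. borel) \<rightarrow>\<^sub>M borel"
proof (rule measurable_coordinatewise_then_product)
  fix q :: "rat \<times> rat"
  show "(\<lambda>x. step_coords (empirical n x) q) \<in> borel_measurable (\<Pi>\<^sub>M i\<in>{1..n}. borel)"
  proof (cases "fst q < snd q")
    case True
    then have "isCont (cts_step (of_rat (fst q)) (of_rat (snd q))) t" for t
      by (intro isCont_cts_step) (simp add: of_rat_less)
    then have [measurable]: "cts_step (of_rat (fst q)) (of_rat (snd q)) \<in> borel_measurable borel"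
      by (intro borel_measurable_continuous_onI continuous_at_imp_continuous_on) auto
    show ?thesis
      using True by (simp add: step_coords_def integral_empirical)
  qed (simp add: step_coords_def)
qed

text \<open>Open sets of the weak topology are preimages under \<open>step_coords\<close>, so
  measurability reduces to countably many real coordinates.\<close>

lemma measurable_empirical:
  assumes "n \<ge> 1"
  shows "empirical n \<in> (\<Pi>\<^sub>M i\<in>{1..n}. borel) \<rightarrow>\<^sub>M borel_of weak_topology"
  unfolding borel_of_def
proof (rule measurable_measure_of)
  show "{U. openin weak_topology U} \<subseteq> Pow (topspace weak_topology)"
    using openin_subset by auto
  show "empirical n \<in> space (\<Pi>\<^sub>M i\<in>{1..n}. borel) \<rightarrow> topspace weak_topology"
    using real_distribution_empirical[OF assms] prob_measures_iff_real_distribution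
    by (simp add: topspace_weak_topology)
next
  fix U assume "U \<in> {U. openin weak_topology U}"
  then obtain V where V: "open V" "U = step_coords -` V \<inter> prob_measures"
    using openin_weak_topology_iff by blast
  have "empirical n -` U \<inter> space (\<Pi>\<^sub>M i\<in>{1..n}. borel)
      = (\<lambda>x. step_coords (empirical n x)) -` V \<inter> space (\<Pi>\<^sub>M i\<in>{1..n}. borel)"
    using real_distribution_empirical[OF assms] prob_measures_iff_real_distribution V(2) by auto
  also have "\<dots> \<in> sets (\<Pi>\<^sub>M i\<in>{1..n}. borel)"
    by (rule measurable_sets[OF measurable_step_coords_empirical]) (use V(1) in simp)
  finally show "empirical n -` U \<inter> space (\<Pi>\<^sub>M i\<in>{1..n}. borel) \<in> sets (\<Pi>\<^sub>M i\<in>{1..n}. borel)" .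
qed

text \<open>Joint measurability in configuration and level, since the energy of an empirical measure
  is an integral over the level.\<close>

lemma measurable_sum_of_bool_le:
  "(\<lambda>z. \<Sum>i=1..n. of_bool (fst z i \<le> snd z) :: real)
    \<in> borel_measurable ((\<Pi>\<^sub>M i\<in>{1..n::nat}. borel) \<Otimes>\<^sub>M (lborel :: real measure))"
proof (rule borel_measurable_sum)
  fix i assume i: "i \<in> {1..n}"
  define f where "f z = fst z i" for z :: "(nat \<Rightarrow> real) \<times> real"
  have [measurable]: "f \<in> borel_measurable ((\<Pi>\<^sub>M i\<in>{1..n}. borel) \<Otimes>\<^sub>M (lborel :: real measure))"
    unfolding f_def using i
    by (intro measurable_compose[OF measurable_fst] measurable_component_singleton)
  have "(\<lambda>z. of_bool (f z \<le> snd z) :: real) \<in> borel_measurable ((\<Pi>\<^sub>M i\<in>{1..n}. borel) \<Otimes>\<^sub>M (lborel ::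
      real measure))"
    by measurable
  then show "(\<lambda>z :: (nat \<Rightarrow> real) \<times> real. of_bool (fst z i \<le> snd z) :: real)
      \<in> borel_measurable ((\<Pi>\<^sub>M i\<in>{1..n}. borel) \<Otimes>\<^sub>M (lborel :: real measure))"
    by (simp only: f_def)
qed

lemma measurable_energy_empirical:
  assumes B: "continuous_on {0..1} B" and n: "n \<ge> 1"
  shows "(\<lambda>x. energy B (empirical n x)) \<in> borel_measurable (\<Pi>\<^sub>M i\<in>{1..n}. borel)"
proof -
  have "continuous_on UNIV (\<lambda>u. B (max 0 (min 1 u)))"
    by (rule continuous_on_compose2[OF B]) (auto intro!: continuous_intros)
  then have [measurable]: "(\<lambda>u. B (max 0 (min 1 u))) \<in> borel_measurable borel"
    by (rule borel_measurable_continuous_onI)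
  have "energy B (empirical n x) =
      (\<integral>\<^sup>+t. ennreal (B (max 0 (min 1 ((\<Sum>i=1..n. of_bool (x i \<le> t)) / n)))) \<partial>lborel)" for x
  proof -
    interpret real_distribution "empirical n x" by (rule real_distribution_empirical[OF n])
    have "max 0 (min 1 (cdf (empirical n x) t)) = cdf (empirical n x) t" for t
      using cdf_nonneg[of t] cdf_bounded_prob[of t] by simp
    then have "B (cdf (empirical n x) t) = B (max 0 (min 1 (cdf (empirical n x) t)))" for t
      by simp
    then show ?thesis
      unfolding energy_def by (simp add: cdf_empirical indicator_def)
  qed
  moreover have "(\<lambda>x :: nat \<Rightarrow> real. \<integral>\<^sup>+t. ennreal (B (max 0 (min 1 ((\<Sum>i=1..n. of_bool (x i
      \<le> t)) / n)))) \<partial>lborel)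
      \<in> borel_measurable (\<Pi>\<^sub>M i\<in>{1..n}. borel)"
  proof -
    note measurable_sum_of_bool_le [measurable]
    have "(\<lambda>z :: (nat \<Rightarrow> real) \<times> real. ennreal (B (max 0 (min 1 ((\<Sum>i=1..n. of_bool (fst z i
        \<le> snd z)) / n)))))
        \<in> borel_measurable ((\<Pi>\<^sub>M i\<in>{1..n}. borel) \<Otimes>\<^sub>M (lborel :: real measure))"
      by measurable
    then show ?thesis
      by (intro lborel.borel_measurable_nn_integral) (simp only: split_beta')
  qed
  ultimately show ?thesis by simp
qed

text \<open>Counterpart of \<open>abs_moment_le_energy_tent\<close>: \<open>tent F\<close> is below
  both branches of the layer cake integrand.\<close>

lemma energy_tent_le_abs_moment:
  assumes "real_distribution M"
  shows "energy tent M \<le> (\<integral>\<^sup>+x. ennreal \<bar>x\<bar> \<partial>M)"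
proof -
  interpret real_distribution M by fact
  show ?thesis
    unfolding energy_def nn_integral_abs_eq_cdf
    by (intro nn_integral_mono ennreal_leI) (auto simp: tent_def)
qed

lemma energy_mono:
  assumes "real_distribution M" "\<And>u. u \<in> {0..1} \<Longrightarrow> B u \<le> B' u"
  shows "energy B M \<le> energy B' M"
proof -
  interpret real_distribution M by fact
  show ?thesis
    unfolding energy_def
    using cdf_nonneg cdf_bounded_prob by (intro nn_integral_mono ennreal_leI assms) auto
qed

lemma energy_cmult:
  assumes "real_distribution M" "continuous_on {0..1} B" "0 \<le> c"
  shows "energy (\<lambda>u. c * B u) M = ennreal c * energy B M"
proof -
  interpret real_distribution M by fact
  have [measurable]: "(\<lambda>t. B (cdf M t)) \<in> borel_measurable borel"
    by (rule measurable_comp_cdf) fact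
  show ?thesis
    unfolding energy_def using assms(3)
    by (subst nn_integral_cmult[symmetric]) (auto simp: ennreal_mult')
qed

lemma energy_add:
  assumes "real_distribution M" "continuous_on {0..1} B" "continuous_on {0..1} C"
    and "\<And>u. u \<in> {0..1} \<Longrightarrow> 0 \<le> B u" "\<And>u. u \<in> {0..1} \<Longrightarrow> 0 \<le> C u"
  shows "energy (\<lambda>u. B u + C u) M = energy B M + energy C M"
proof -
  interpret real_distribution M by fact
  have [measurable]: "(\<lambda>t. B (cdf M t)) \<in> borel_measurable borel"
    by (rule measurable_comp_cdf) fact
  have [measurable]: "(\<lambda>t. C (cdf M t)) \<in> borel_measurable borel"
    by (rule measurable_comp_cdf) fact
  show ?thesis
    unfolding energy_def
    using cdf_nonneg cdf_bounded_prob assms(4,5)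
    by (subst nn_integral_add[symmetric]) (auto simp: ennreal_plus)
qed

section \<open>Disintegration of Lebesgue measure along common translations of all particles\<close>

lemma distr_PiM_lborel_shift:
  assumes "finite I"
  shows "distr (\<Pi>\<^sub>M i\<in>I. lborel) (\<Pi>\<^sub>M i\<in>I. lborel) (\<lambda>x. \<lambda>i\<in>I. x i + (m :: real))
      = (\<Pi>\<^sub>M i\<in>I. lborel)"
proof -
  interpret product_sigma_finite "\<lambda>_. lborel :: real measure" ..
  let ?f = "\<lambda>x. \<lambda>i\<in>I. x i + m"
  have f: "?f \<in> (\<Pi>\<^sub>M i\<in>I. lborel) \<rightarrow>\<^sub>M (\<Pi>\<^sub>M i\<in>I. lborel)" by measurable
  show ?thesis
  proof (rule PiM_eqI[OF assms])
    fix A :: "'a \<Rightarrow> real set" assume A: "\<And>i. i \<in> I \<Longrightarrow> A i \<in> sets lborel"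
    have vim: "(\<lambda>t. t + m) -` A i \<in> sets lborel" if "i \<in> I" for i
      using A[OF that] by (auto intro!: measurable_sets_borel[of "\<lambda>t. t + m" borel])
    have eq: "?f -` (Pi\<^sub>E I A) \<inter> space (\<Pi>\<^sub>M i\<in>I. lborel) = Pi\<^sub>E I (\<lambda>i. (\<lambda>t. t + m) -` A i)"
      by (auto simp: space_PiM PiE_iff)
    have "emeasure (distr (\<Pi>\<^sub>M i\<in>I. lborel) (\<Pi>\<^sub>M i\<in>I. lborel) ?f) (Pi\<^sub>E I A)
        = emeasure (\<Pi>\<^sub>M i\<in>I. lborel) (Pi\<^sub>E I (\<lambda>i. (\<lambda>t. t + m) -` A i))"
      using A assms by (subst emeasure_distr[OF f]) (auto simp: eq intro!: sets_PiM_I_finite)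
    also have "\<dots> = (\<Prod>i\<in>I. emeasure lborel ((\<lambda>t. t + m) -` A i))"
      using vim assms by (intro emeasure_PiM) auto
    also have "\<dots> = (\<Prod>i\<in>I. emeasure lborel (A i))"
    proof (rule prod.cong)
      fix i assume "i \<in> I"
      then have "A i \<in> sets borel" using A by simp
      then have "emeasure (distr lborel borel (\<lambda>t. t + m)) (A i) = emeasure lborel ((\<lambda>t. t + m)
          -` A i)"
        by (subst emeasure_distr) auto
      then show "emeasure lborel ((\<lambda>t. t + m) -` A i) = emeasure lborel (A i)"
        by (simp add: lborel_shift)
    qed simp
    finally show "emeasure (distr (\<Pi>\<^sub>M i\<in>I. lborel) (\<Pi>\<^sub>M i\<in>I. lborel) ?f) (Pi\<^sub>E I A)
        = (\<Prod>i\<in>I. emeasure lborel (A i))" .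
  qed simp
qed

text \<open>Every configuration is a centred one shifted by its mean. The last coordinate is traded
  for the mean, with Jacobian n, and the other coordinates are then shifted along with it.\<close>

lemma nn_integral_hyperplane:
  fixes G :: "(nat \<Rightarrow> real) \<Rightarrow> ennreal"
  assumes n: "n \<ge> 1" and [measurable]: "G \<in> borel_measurable (\<Pi>\<^sub>M i\<in>{1..n}. borel)"
  shows "(\<integral>\<^sup>+x. G x \<partial>(\<Pi>\<^sub>M i\<in>{1..n}. lborel)) =
    ennreal (sqrt n) * (\<integral>\<^sup>+x. (\<integral>\<^sup>+y. G (\<lambda>i\<in>{1..n}. x i + y) \<partial>lborel) \<partial>hyperplane_lebesgue n)"
proof -
  interpret product_sigma_finite "\<lambda>_. lborel :: real measure" ..
  let ?I = "{1..<n}" and ?P = "\<Pi>\<^sub>M i\<in>{1..<n}. (lborel :: real measure)"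
  interpret P: sigma_finite_measure ?P by (rule sigma_finite) simp
  interpret Q: pair_sigma_finite ?P "lborel :: real measure" ..
  have ins: "{1..n} = insert n ?I" using n by auto
  define T where "T x = (\<lambda>i\<in>{1..n}. if i < n then x i else - (\<Sum>j=1..<n. x j))" for x :: "nat \<Rightarrow> real"
  have T: "T \<in> ?P \<rightarrow>\<^sub>M (\<Pi>\<^sub>M i\<in>{1..n}. borel)"
    unfolding T_def
  proof (rule measurable_restrict)
    fix i assume "i \<in> {1..n}"
    then show "(\<lambda>x. if i < n then x i else - (\<Sum>j=1..<n. x j)) \<in> borel_measurable ?P"
      by (cases "i < n") auto
  qed
  note [measurable] = T
  have "sets (\<Pi>\<^sub>M i\<in>{1..n}. lborel :: real measure) = sets (\<Pi>\<^sub>M i\<in>{1..n}. borel)"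
    by (rule sets_PiM_cong) auto
  then have G': "G \<in> borel_measurable (\<Pi>\<^sub>M i\<in>insert n ?I. lborel)"
    unfolding ins[symmetric] using measurable_cong_sets by (metis assms(2))
  have upd: "(\<lambda>z. (fst z)(n := g (fst z) (snd z))) \<in> ?P \<Otimes>\<^sub>M lborel \<rightarrow>\<^sub>M (\<Pi>\<^sub>M i\<in>{1..n}. borel)"
    if [measurable]: "case_prod g \<in> borel_measurable (?P \<Otimes>\<^sub>M lborel)"
        for g :: "(nat \<Rightarrow> real) \<Rightarrow> real \<Rightarrow> real"
  proof (rule measurable_PiM_single')
    fix i assume "i \<in> {1..n}"
    then show "(\<lambda>z. ((fst z)(n := g (fst z) (snd z))) i) \<in> borel_measurable (?P \<Otimes>\<^sub>M lborel)"
      using that by (cases "i = n") (auto simp: split_beta')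
  next
    show "(\<lambda>z i. ((fst z)(n := g (fst z) (snd z))) i)
        \<in> space (?P \<Otimes>\<^sub>M lborel) \<rightarrow> (\<Pi>\<^sub>E i\<in>{1..n}. space borel)"
      using n by (auto simp: space_pair_measure space_PiM PiE_iff extensional_def)
  qed
  have meas2: "(\<lambda>z. G ((fst z)(n := g (fst z) (snd z)))) \<in> borel_measurable (?P \<Otimes>\<^sub>M lborel)"
    if "case_prod g \<in> borel_measurable (?P \<Otimes>\<^sub>M lborel)" for g :: "(nat \<Rightarrow> real) \<Rightarrow> real \<Rightarrow> real"
    using measurable_compose[OF upd[OF that] assms(2)] .
  have "(\<integral>\<^sup>+x. G x \<partial>(\<Pi>\<^sub>M i\<in>{1..n}. lborel)) = (\<integral>\<^sup>+x. (\<integral>\<^sup>+s. G (x(n := s)) \<partial>lborel) \<partial>?P)"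
    unfolding ins by (rule product_nn_integral_insert[OF _ _ G']) auto
  \<comment> \<open>The last coordinate becomes - (x_1 + ... + x_(n-1)) + n m, so that m is the mean
    of the configuration.\<close>
  also have "\<dots> = (\<integral>\<^sup>+x. ennreal n * (\<integral>\<^sup>+m. G (x(n := - (\<Sum>j\<in>?I. x j) + n * m)) \<partial>lborel) \<partial>?P)"
  proof (rule nn_integral_cong)
    fix x assume x: "x \<in> space ?P"
    have "(\<lambda>s. G (x(n := s))) \<in> borel_measurable borel"
      using measurable_compose[OF measurable_Pair1'[OF x] meas2[of "\<lambda>_ s. s"]] by simp
    from nn_integral_real_affine[OF this, of "real n" "- (\<Sum>j\<in>?I. x j)"] n
    show "(\<integral>\<^sup>+s. G (x(n := s)) \<partial>lborel) = ennreal n * (\<integral>\<^sup>+m. G (x(n := - (\<Sum>j\<in>?I. x j) + n * m))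
        \<partial>lborel)"
      by simp
  qed
  also have "\<dots> = ennreal n * (\<integral>\<^sup>+x. (\<integral>\<^sup>+m. G (x(n := - (\<Sum>j\<in>?I. x j) + n * m)) \<partial>lborel) \<partial>?P)"
  proof (rule nn_integral_cmult)
    have "(\<lambda>z. G ((fst z)(n := - (\<Sum>j\<in>?I. fst z j) + n * snd z))) \<in> borel_measurable (?P \<Otimes>\<^sub>M lborel)"
      by (rule meas2) measurable
    then show "(\<lambda>x. \<integral>\<^sup>+m. G (x(n := - (\<Sum>j\<in>?I. x j) + n * m)) \<partial>lborel) \<in> borel_measurable ?P"
      by (intro lborel.borel_measurable_nn_integral) (simp add: split_beta')
  qed
  also have "(\<integral>\<^sup>+x. (\<integral>\<^sup>+m. G (x(n := - (\<Sum>j\<in>?I. x j) + n * m)) \<partial>lborel) \<partial>?P)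
      = (\<integral>\<^sup>+m. (\<integral>\<^sup>+x. G (x(n := - (\<Sum>j\<in>?I. x j) + n * m)) \<partial>?P) \<partial>lborel)"
  proof (rule Q.Fubini'[symmetric])
    have "(\<lambda>z. G ((fst z)(n := - (\<Sum>j\<in>?I. fst z j) + n * snd z))) \<in> borel_measurable (?P \<Otimes>\<^sub>M lborel)"
      by (rule meas2) measurable
    then show "(\<lambda>(x, m). G (x(n := - (\<Sum>j\<in>?I. x j) + n * m))) \<in> borel_measurable (?P \<Otimes>\<^sub>M lborel)"
      by (simp add: split_beta')
  qed
  also have "\<dots> = (\<integral>\<^sup>+m. (\<integral>\<^sup>+x. G (\<lambda>i\<in>{1..n}. T x i + m) \<partial>?P) \<partial>lborel)"
  proof (rule nn_integral_cong)
    fix m :: real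
    have meas1: "(\<lambda>x. G (x(n := - (\<Sum>j\<in>?I. x j) + n * m))) \<in> borel_measurable ?P"
      using measurable_compose[OF measurable_Pair2'[of m lborel ?P] meas2[of "\<lambda>x m. - (\<Sum>j\<in>?I. x j)
          + n * m"]]
      by simp
    have "(\<integral>\<^sup>+x. G (x(n := - (\<Sum>j\<in>?I. x j) + n * m)) \<partial>?P)
        = (\<integral>\<^sup>+x. G (x(n := - (\<Sum>j\<in>?I. x j) + n * m)) \<partial>distr ?P ?P (\<lambda>x. \<lambda>i\<in>?I. x i + m))"
      by (simp add: distr_PiM_lborel_shift)
    also have "\<dots> = (\<integral>\<^sup>+x. G ((\<lambda>i\<in>?I. x i + m)(n := - (\<Sum>j\<in>?I. (\<lambda>i\<in>?I. x i + m) j) + n * m)) \<partial>?P)"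
    proof (rule nn_integral_distr)
      show "(\<lambda>x. \<lambda>i\<in>?I. x i + m) \<in> ?P \<rightarrow>\<^sub>M ?P" by measurable
    qed (use meas1 in \<open>simp only: measurable_distr_eq1\<close>)
    also have "\<dots> = (\<integral>\<^sup>+x. G (\<lambda>i\<in>{1..n}. T x i + m) \<partial>?P)"
    proof (rule nn_integral_cong)
      fix x
      \<comment> \<open>Shifting the first n - 1 coordinates by m changes their sum by (n - 1) m; of
        the n m in the last coordinate exactly one m is left, the same shift as in the
        others.\<close>
      have "(\<lambda>i\<in>?I. x i + m)(n := - (\<Sum>j\<in>?I. (\<lambda>i\<in>?I. x i + m) j) + n * m) = (\<lambda>i\<in>{1..n}. T x i + m)"
        using n by (auto simp: fun_eq_iff T_def sum.distrib of_nat_diff algebra_simps restrict_def)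
      then show "G ((\<lambda>i\<in>?I. x i + m)(n := - (\<Sum>j\<in>?I. (\<lambda>i\<in>?I. x i + m) j) + n * m))
          = G (\<lambda>i\<in>{1..n}. T x i + m)"
        by simp
    qed
    finally show "(\<integral>\<^sup>+x. G (x(n := - (\<Sum>j\<in>?I. x j) + n * m)) \<partial>?P) = (\<integral>\<^sup>+x. G (\<lambda>i\<in>{1..n}. T x i + m)
        \<partial>?P)" .
  qed
  also have "\<dots> = (\<integral>\<^sup>+x. (\<integral>\<^sup>+m. G (\<lambda>i\<in>{1..n}. T x i + m) \<partial>lborel) \<partial>?P)"
  proof (rule Q.Fubini')
    have "(\<lambda>z. \<lambda>i\<in>{1..n}. T (fst z) i + snd z) \<in> ?P \<Otimes>\<^sub>M lborel \<rightarrow>\<^sub>M (\<Pi>\<^sub>M i\<in>{1..n}. borel)"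
    proof (rule measurable_restrict)
      fix i assume "i \<in> {1..n}"
      then have "(\<lambda>z. T (fst z) i) \<in> borel_measurable (?P \<Otimes>\<^sub>M lborel)"
        by (intro measurable_compose[OF measurable_compose[OF measurable_fst T]
            measurable_component_singleton])
      then show "(\<lambda>z. T (fst z) i + snd z) \<in> borel_measurable (?P \<Otimes>\<^sub>M lborel)"
        by (rule borel_measurable_add) measurable
    qed
    from measurable_compose[OF this assms(2)]
    show "(\<lambda>(x, m). G (\<lambda>i\<in>{1..n}. T x i + m)) \<in> borel_measurable (?P \<Otimes>\<^sub>M lborel)"
      by (simp only: split_beta')
  qed
  \<comment> \<open>One factor \<open>sqrt n\<close> of the Jacobian is the surface element
    contained in \<open>hyperplane_lebesgue\<close>; the other one remains in the formula.\<close>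
  also have "ennreal n * \<dots> = ennreal (sqrt n) * (ennreal (sqrt n) * \<dots>)"
    by (simp add: mult.assoc[symmetric] ennreal_mult[symmetric])
  also have "ennreal (sqrt n) * (\<integral>\<^sup>+x. (\<integral>\<^sup>+m. G (\<lambda>i\<in>{1..n}. T x i + m) \<partial>lborel) \<partial>?P)
      = (\<integral>\<^sup>+x. (\<integral>\<^sup>+y. G (\<lambda>i\<in>{1..n}. x i + y) \<partial>lborel) \<partial>hyperplane_lebesgue n)"
  proof -
    have "(\<lambda>z. \<lambda>i\<in>{1..n}. fst z i + snd z) \<in> (\<Pi>\<^sub>M i\<in>{1..n}. borel) \<Otimes>\<^sub>M lborel \<rightarrow>\<^sub>M (\<Pi>\<^sub>M i\<in>{1..n}.
        (borel :: real measure))"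
    proof (rule measurable_restrict)
      fix i assume "i \<in> {1..n}"
      then have "(\<lambda>z. fst z i) \<in> borel_measurable ((\<Pi>\<^sub>M i\<in>{1..n}. borel) \<Otimes>\<^sub>M (lborel :: real
          measure))"
        by (intro measurable_compose[OF measurable_fst measurable_component_singleton])
      then show "(\<lambda>z. fst z i + snd z) \<in> borel_measurable ((\<Pi>\<^sub>M i\<in>{1..n}. borel) \<Otimes>\<^sub>M (lborel :: real
          measure))"
        by (rule borel_measurable_add) measurable
    qed
    from measurable_compose[OF this assms(2)]
    have K: "(\<lambda>x. \<integral>\<^sup>+y. G (\<lambda>i\<in>{1..n}. x i + y) \<partial>lborel) \<in> borel_measurable (\<Pi>\<^sub>M i\<in>{1..n}. borel)"
      by (intro lborel.borel_measurable_nn_integral) (simp only: split_beta')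
    have H: "hyperplane_lebesgue n = scale_measure (ennreal (sqrt n)) (distr ?P (\<Pi>\<^sub>M i\<in>{1..n}.
        borel) T)"
      unfolding hyperplane_lebesgue_def T_def[abs_def] ..
    have "(\<integral>\<^sup>+x. (\<integral>\<^sup>+y. G (\<lambda>i\<in>{1..n}. x i + y) \<partial>lborel) \<partial>hyperplane_lebesgue n)
        = ennreal (sqrt n) * (\<integral>\<^sup>+x. (\<integral>\<^sup>+y. G (\<lambda>i\<in>{1..n}. x i + y) \<partial>lborel)
            \<partial>distr ?P (\<Pi>\<^sub>M i\<in>{1..n}. borel) T)"
      unfolding H by (rule nn_integral_scale_measure) (simp only: measurable_distr_eq1 K)
    also have "(\<integral>\<^sup>+x. (\<integral>\<^sup>+y. G (\<lambda>i\<in>{1..n}. x i + y) \<partial>lborel) \<partial>distr ?P (\<Pi>\<^sub>M i\<in>{1..n}. borel) T)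
        = (\<integral>\<^sup>+x. (\<integral>\<^sup>+m. G (\<lambda>i\<in>{1..n}. T x i + m) \<partial>lborel) \<partial>?P)"
      by (rule nn_integral_distr[OF T]) (simp only: measurable_distr_eq1 K)
    finally show ?thesis ..
  qed
  finally show ?thesis .
qed

text \<open>With m the smallest \<alpha>-quantile, the admissible shifts are the half-open interval
  from - m to 1 - m. The strict and the weak inequality are paired so that it has length one also
  when the distribution function has jumps or flat parts.\<close>

lemma nn_integral_location:
  assumes M: "real_distribution M" and \<alpha>: "0 < \<alpha>" "\<alpha> < 1"
  shows "(\<integral>\<^sup>+y. indicator {y. cdf M (- y) < \<alpha> \<and> \<alpha> \<le> cdf M (1 - y)} y \<partial>lborel) = 1"
proof -
  interpret cdf_distribution M unfolding cdf_distribution_def by fact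
  define m where "m = Inf {x. \<alpha> \<le> cdf M x}"
  have *: "\<alpha> \<le> cdf M t \<longleftrightarrow> m \<le> t" for t
    unfolding m_def by (rule pseudoinverse) fact+
  have "cdf M t < \<alpha> \<longleftrightarrow> t < m" for t
    using *[of t] by (simp only: not_le[symmetric])
  with * have "{y. cdf M (- y) < \<alpha> \<and> \<alpha> \<le> cdf M (1 - y)} = {- m<..1 - m}"
    by auto
  then show ?thesis by simp
qed

text \<open>The indicator of located configurations integrates to 1 along each translation orbit, so
  inserting it turns an integral over the whole space into one over the hyperplane.\<close>

lemma nn_integral_hyperplane_invariant:
  fixes \<Phi> :: "(nat \<Rightarrow> real) \<Rightarrow> ennreal"
  assumes n: "n \<ge> 1" and [measurable]: "\<Phi> \<in> borel_measurable (\<Pi>\<^sub>M i\<in>{1..n}. borel)"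
    and inv: "\<And>x y. \<Phi> (\<lambda>i\<in>{1..n}. x i + y) = \<Phi> x" and \<alpha>: "0 < \<alpha>" "\<alpha> < 1"
  shows "ennreal (sqrt n) * (\<integral>\<^sup>+x. \<Phi> x \<partial>hyperplane_lebesgue n) =
    (\<integral>\<^sup>+x. \<Phi> x * indicator {x. cdf (empirical n x) 0 < \<alpha> \<and> \<alpha> \<le> cdf (empirical n x) 1} x
      \<partial>(\<Pi>\<^sub>M i\<in>{1..n}. lborel))"
proof -
  let ?\<psi> = "\<lambda>x. indicator {x. cdf (empirical n x) 0 < \<alpha> \<and> \<alpha> \<le> cdf (empirical n x) 1} x :: ennreal"
  have [measurable]: "?\<psi> \<in> borel_measurable (\<Pi>\<^sub>M i\<in>{1..n}. borel)"
  proof -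
    have "(\<lambda>x. if cdf (empirical n x) 0 < \<alpha> \<and> \<alpha> \<le> cdf (empirical n x) 1 then 1 else 0 :: ennreal)
        \<in> borel_measurable (\<Pi>\<^sub>M i\<in>{1..n}. borel)" by measurable
    then show ?thesis by (simp add: indicator_def of_bool_def cong: if_cong)
  qed
  have sets: "sets (empirical n x) = sets borel" for x by (simp add: empirical_def)
  have one: "(\<integral>\<^sup>+y. ?\<psi> (\<lambda>i\<in>{1..n}. x i + y) \<partial>lborel) = 1" for x
  proof -
    have "?\<psi> (\<lambda>i\<in>{1..n}. x i + y) = indicator {y. cdf (empirical n x) (- y) < \<alpha> \<and> \<alpha>
        \<le> cdf (empirical n x) (1 - y)} y" for y
      by (simp only: indicator_def mem_Collect_eq empirical_translate cdf_translate[OF sets] diff_0)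
    then show ?thesis
      using nn_integral_location[OF real_distribution_empirical[OF n, of x] \<alpha>] by (simp only:)
  qed
  have "(\<integral>\<^sup>+x. \<Phi> x * ?\<psi> x \<partial>(\<Pi>\<^sub>M i\<in>{1..n}. lborel))
      = ennreal (sqrt n) * (\<integral>\<^sup>+x. (\<integral>\<^sup>+y. \<Phi> (\<lambda>i\<in>{1..n}. x i + y) * ?\<psi> (\<lambda>i\<in>{1..n}. x i + y) \<partial>lborel)
          \<partial>hyperplane_lebesgue n)"
    by (rule nn_integral_hyperplane[OF n]) measurable
  also have "\<dots> = ennreal (sqrt n) * (\<integral>\<^sup>+x. \<Phi> x \<partial>hyperplane_lebesgue n)"
  proof (intro arg_cong2[where f = "(*)"] refl nn_integral_cong)
    fix x assume "x \<in> space (hyperplane_lebesgue n)"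
    then have x: "x \<in> space (\<Pi>\<^sub>M i\<in>{1..n}. (borel :: real measure))"
      by (simp add: hyperplane_lebesgue_def space_scale_measure)
    have [measurable]: "(\<lambda>y. \<lambda>i\<in>{1..n}. x i + y) \<in> lborel \<rightarrow>\<^sub>M (\<Pi>\<^sub>M i\<in>{1..n}. borel)"
      by measurable
    have "(\<integral>\<^sup>+y. \<Phi> (\<lambda>i\<in>{1..n}. x i + y) * ?\<psi> (\<lambda>i\<in>{1..n}. x i + y) \<partial>lborel)
        = (\<integral>\<^sup>+y. \<Phi> x * ?\<psi> (\<lambda>i\<in>{1..n}. x i + y) \<partial>lborel)"
      by (simp only: inv)
    also have "\<dots> = \<Phi> x * (\<integral>\<^sup>+y. ?\<psi> (\<lambda>i\<in>{1..n}. x i + y) \<partial>lborel)"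
      by (rule nn_integral_cmult) measurable
    finally show "(\<integral>\<^sup>+y. \<Phi> (\<lambda>i\<in>{1..n}. x i + y) * ?\<psi> (\<lambda>i\<in>{1..n}. x i + y) \<partial>lborel) = \<Phi> x"
      by (simp only: one mult_1_right)
  qed
  finally show ?thesis by simp
qed

section \<open>Approximation by continuous functions\<close>

text \<open>Dynkin argument: the sets that can be approximated in mean for all the finitely many
  measures at once contain the closed sets, an intersection-stable generator, and are closed under
  complements and disjoint unions.\<close>

lemma approx_indicator_continuous:
  fixes S :: "real measure set"
  assumes S: "finite S" "\<And>M. M \<in> S \<Longrightarrow> finite_measure M" "\<And>M. M \<in> S \<Longrightarrow> sets M = sets borel"
    and A: "A \<in> sets borel" and e: "0 < e"
  shows "\<exists>g::real\<Rightarrow>real. continuous_on UNIV g \<and> (\<forall>x. 0 \<le> g x \<and> g x \<le> 1) \<and>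
    (\<forall>M\<in>S. (\<integral>x. \<bar>indicator A x - g x\<bar> \<partial>M) < e)"
proof -
  have int: "integrable M f" if M: "M \<in> S" and f: "f \<in> borel_measurable borel" "\<And>x. \<bar>f x\<bar> \<le> b"
    for M and f :: "real \<Rightarrow> real" and b
  proof -
    interpret finite_measure M using S M by blast
    have "f \<in> borel_measurable M" using f(1) S(3)[OF M] by (metis measurable_cong_sets)
    then show ?thesis using f(2) by (intro integrable_const_bound[of _ b]) auto
  qed
  \<comment> \<open>Dominated convergence for each measure; as there are finitely many of them, one
    index serves all.\<close>
  have lim: "\<exists>n. \<forall>M\<in>S. (\<integral>x. F n x \<partial>M) < e"
    if F: "\<And>n. F n \<in> borel_measurable borel" "\<And>n x. \<bar>F n x\<bar> \<le> 1" "\<And>x. (\<lambda>n. F n x) \<longlonglongrightarrow> 0" and e: "0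
        < e"
    for F :: "nat \<Rightarrow> real \<Rightarrow> real" and e
  proof -
    have "\<forall>\<^sub>F n in sequentially. (\<integral>x. F n x \<partial>M) < e" if M: "M \<in> S" for M
    proof -
      interpret finite_measure M using S M by blast
      have m: "F n \<in> borel_measurable M" for n using F(1) S(3)[OF M] by (metis measurable_cong_sets)
      have "(\<lambda>n. \<integral>x. F n x \<partial>M) \<longlonglongrightarrow> (\<integral>x. 0 \<partial>M)"
        using m F by (intro integral_dominated_convergence[where w="\<lambda>_. 1"]) auto
      then show ?thesis using e by (intro order_tendstoD) auto
    qed
    then have "\<forall>\<^sub>F n in sequentially. \<forall>M\<in>S. (\<integral>x. F n x \<partial>M) < e"
      using S(1) by (intro eventually_ball_finite) auto
    then show ?thesis by (auto dest: eventually_happens)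
  qed
  define P where "P A e \<longleftrightarrow> (\<exists>g::real\<Rightarrow>real. continuous_on UNIV g \<and> (\<forall>x. 0 \<le> g x \<and> g x \<le> 1) \<and>
    (\<forall>M\<in>S. (\<integral>x. \<bar>indicator A x - g x\<bar> \<partial>M) < e))" for A e
  define Q where "Q A \<longleftrightarrow> (\<forall>e>0. P A e)" for A
  have "Int_stable (Collect closed :: real set set)" by (auto simp: Int_stable_def)
  moreover have "(Collect closed :: real set set) \<subseteq> Pow UNIV" by simp
  moreover have "A \<in> sigma_sets UNIV (Collect closed)"
  proof -
    have "sets borel = sigma_sets UNIV (Collect closed :: real set set)"
      unfolding borel_eq_closed by (rule sets_measure_of) simp
    with A show ?thesis by simp
  qed
  ultimately have "Q A"
  proof (induction rule: sigma_sets_induct_disjoint)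
    case (basic C)
    then have C: "closed C" by simp
    show ?case
    proof (cases "C = {}")
      case True
      then show ?thesis unfolding Q_def P_def by (auto intro!: exI[of _ "\<lambda>_. 0"])
    next
      case False
      \<comment> \<open>Continuous functions decreasing to the indicator of the closed set; the
        empty set is treated apart because \<open>infdist\<close> to it is 0 by convention.\<close>
      define g where "g n x = max 0 (1 - real n * infdist x C)" for n x
      have cont: "continuous_on UNIV (g n)" for n
        unfolding g_def[abs_def] by (intro continuous_intros)
      have bd: "0 \<le> g n x" "g n x \<le> 1" for n x by (auto simp: g_def infdist_nonneg)
      have gl: "(\<lambda>n. \<bar>indicator C x - g n x\<bar>) \<longlonglongrightarrow> 0" for x
      proof (cases "x \<in> C")
        case True
        then have "infdist x C = 0" by simp
        then show ?thesis using True by (simp add: g_def)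
      next
        case x: False
        then have pos: "infdist x C > 0" using C False by (simp add: infdist_pos_not_in_closed)
        obtain N :: nat where N: "1 / infdist x C < N" using reals_Archimedean2 by blast
        have "\<forall>\<^sub>F n in sequentially. \<bar>indicator C x - g n x\<bar> = 0"
        proof (rule eventually_sequentiallyI)
          fix n assume "N \<le> n"
          then have "1 / infdist x C < n" using N by linarith
          then have "1 < n * infdist x C" using pos by (simp add: field_simps)
          then show "\<bar>indicator C x - g n x\<bar> = 0" using x by (simp add: g_def)
        qed
        then show ?thesis by (rule tendsto_eventually)
      qed
      show ?thesis
        unfolding Q_def
      proof (intro allI impI)
        fix e :: real assume e: "e > 0"
        have "\<exists>n. \<forall>M\<in>S. (\<integral>x. \<bar>indicator C x - g n x\<bar> \<partial>M) < e"
        proof (rule lim[OF _ _ gl e])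
          show "(\<lambda>x. \<bar>indicator C x - g n x\<bar>) \<in> borel_measurable borel" for n
          proof -
            have [measurable]: "g n \<in> borel_measurable borel"
                by (rule borel_measurable_continuous_onI[OF cont])
            have [measurable]: "C \<in> sets borel" using C by simp
            show ?thesis by measurable
          qed
          show "\<bar>\<bar>indicator C x - g n x\<bar>\<bar> \<le> 1" for n x
            using bd[of n x] by (auto simp: indicator_def)
        qed
        then show "P C e"
          unfolding P_def using cont bd by blast
      qed
    qed
  next
    case empty
    then show ?case unfolding Q_def P_def by (auto intro!: exI[of _ "\<lambda>_. 0"])
  next
    case (compl A)
    show ?case
      unfolding Q_def
    proof (intro allI impI)
      fix e :: real assume "e > 0"
      with compl(2) obtain g where g: "continuous_on UNIV g" "\<And>x. 0 \<le> g x \<and> g x \<le> (1::real)"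
        "\<And>M. M \<in> S \<Longrightarrow> (\<integral>x. \<bar>indicator A x - g x\<bar> \<partial>M) < e" unfolding Q_def P_def by meson
      have "\<bar>indicator (UNIV - A) x - (1 - g x)\<bar> = \<bar>indicator A x - g x\<bar>" for x
        by (auto simp: indicator_def)
      with g show "P (UNIV - A) e"
        unfolding P_def
        by (intro exI[of _ "\<lambda>x. 1 - g x"]) (auto intro!: continuous_intros)
    qed
  next
    case (union A)
    have A: "A i \<in> sets borel" for i
      using union(2) unfolding borel_eq_closed by (auto simp: sets_measure_of)
    show ?case
      unfolding Q_def
    proof (intro allI impI)
      fix e :: real assume e: "e > 0"
      let ?U = "\<lambda>m. \<Union>i<m. A i"
      have "\<exists>m. \<forall>M\<in>S. (\<integral>x. \<bar>indicator (\<Union>i. A i) x - indicator (?U m) x\<bar> \<partial>M) < e / 2"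
      proof (rule lim)
        show "(\<lambda>x. \<bar>indicator (\<Union>i. A i) x - indicator (?U m) x :: real\<bar>) \<in> borel_measurable borel"
            for m
          using A by measurable
        show "(\<lambda>m. \<bar>indicator (\<Union>i. A i) x - indicator (?U m) x :: real\<bar>) \<longlonglongrightarrow> 0" for x
        proof (cases "x \<in> (\<Union>i. A i)")
          case True
          then obtain i where i: "x \<in> A i" by blast
          have "\<forall>\<^sub>F m in sequentially. \<bar>indicator (\<Union>i. A i) x - indicator (?U m) x :: real\<bar> = 0"
            by (rule eventually_sequentiallyI[of "Suc i"]) (use i in \<open>auto simp: indicator_def
                intro!: bexI[of _ i]\<close>)
          then show ?thesis by (rule tendsto_eventually)
        qed (auto simp: indicator_def)
      qed (use e in \<open>auto simp: indicator_def\<close>)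
      then obtain m where m: "\<And>M. M \<in> S \<Longrightarrow> (\<integral>x. \<bar>indicator (\<Union>i. A i) x - indicator (?U m) x\<bar> \<partial>M)
          < e / 2"
        by blast
      \<comment> \<open>At most m such errors add up to no more than e / 2; \<open>Suc m\<close>
        instead of m keeps the tolerance positive when m = 0.\<close>
      have "P (A i) (e / (2 * Suc m))" for i
        using union(3)[of i] e unfolding Q_def by simp
      then obtain g where g: "\<And>i. continuous_on UNIV (g i :: real \<Rightarrow> real)" "\<And>i x. 0 \<le> g i x \<and> g i x
          \<le> 1"
        "\<And>i M. M \<in> S \<Longrightarrow> (\<integral>x. \<bar>indicator (A i) x - g i x\<bar> \<partial>M) < e / (2 * Suc m)"
        unfolding P_def by metis
      \<comment> \<open>The cap at 1 does not increase the distance to an indicator, whose values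
        are at most 1.\<close>
      define G where "G x = min 1 (\<Sum>i<m. g i x)" for x
      have gm[measurable]: "g i \<in> borel_measurable borel" for i
        by (rule borel_measurable_continuous_onI[OF g(1)])
      have Gc: "continuous_on UNIV G"
        unfolding G_def[abs_def] by (intro continuous_intros g(1))
      then have Gm[measurable]: "G \<in> borel_measurable borel"
          by (rule borel_measurable_continuous_onI)
      have Gb: "0 \<le> G x" "G x \<le> 1" for x using g(2) by (auto simp: G_def intro!: sum_nonneg)
      have sumU: "indicator (?U m) x = (\<Sum>i<m. indicator (A i) x :: real)" for x
        using union(1) by (subst indicator_UN_disjoint) (auto simp: disjoint_family_on_def)
      have ptw: "\<bar>indicator (?U m) x - G x\<bar> \<le> (\<Sum>i<m. \<bar>indicator (A i) x - g i x\<bar>)" for x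
      proof -
        have "indicator (?U m) x = min 1 (\<Sum>i<m. indicator (A i) x :: real)"
          unfolding sumU[symmetric] by (auto split: split_indicator)
        then have "\<bar>indicator (?U m) x - G x\<bar> \<le> \<bar>(\<Sum>i<m. indicator (A i) x) - (\<Sum>i<m. g i x)\<bar>"
          unfolding G_def by linarith
        also have "\<dots> \<le> (\<Sum>i<m. \<bar>indicator (A i) x - g i x\<bar>)"
          unfolding sum_subtractf[symmetric] by (rule sum_abs)
        finally show ?thesis .
      qed
      have "(\<integral>x. \<bar>indicator (\<Union>i. A i) x - G x\<bar> \<partial>M) < e" if M: "M \<in> S" for M
      proof -
        have i1: "integrable M (\<lambda>x. \<bar>indicator (\<Union>i. A i) x - indicator (?U m) x :: real\<bar>)"
          using A by (intro int[OF M, of _ 1]) (measurable, auto simp: indicator_def)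
        have i2: "integrable M (\<lambda>x. \<bar>indicator (A i) x - g i x\<bar>)" for i
        proof (rule int[OF M])
          show "(\<lambda>x. \<bar>indicator (A i) x - g i x\<bar>) \<in> borel_measurable borel" using A by measurable
          show "\<bar>\<bar>indicator (A i) x - g i x\<bar>\<bar> \<le> 1" for x using g(2)[of i x]
              by (auto simp: indicator_def)
        qed
        have i3: "integrable M (\<lambda>x. \<bar>indicator (\<Union>i. A i) x - G x\<bar>)"
        proof (rule int[OF M])
          show "(\<lambda>x. \<bar>indicator (\<Union>i. A i) x - G x\<bar>) \<in> borel_measurable borel" using A by measurable
          show "\<bar>\<bar>indicator (\<Union>i. A i) x - G x\<bar>\<bar> \<le> 1" for x using Gb[of x]
              by (auto simp: indicator_def)
        qed
        have "(\<integral>x. \<bar>indicator (\<Union>i. A i) x - G x\<bar> \<partial>M)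
            \<le> (\<integral>x. \<bar>indicator (\<Union>i. A i) x - indicator (?U m) x\<bar> + (\<Sum>i<m. \<bar>indicator (A i) x
                - g i x\<bar>) \<partial>M)"
        proof (rule integral_mono[OF i3])
          show "integrable M (\<lambda>x. \<bar>indicator (\<Union>i. A i) x - indicator (?U m) x\<bar>
              + (\<Sum>i<m. \<bar>indicator (A i) x - g i x\<bar>))"
            by (intro Bochner_Integration.integrable_add i1 Bochner_Integration.integrable_sum i2)
          show "\<bar>indicator (\<Union>i. A i) x - G x\<bar> \<le> \<bar>indicator (\<Union>i. A i) x - indicator (?U m) x\<bar>
              + (\<Sum>i<m. \<bar>indicator (A i) x - g i x\<bar>)" for x
            using ptw[of x] by linarith
        qed
        also have "\<dots> = (\<integral>x. \<bar>indicator (\<Union>i. A i) x - indicator (?U m) x\<bar> \<partial>M)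
            + (\<Sum>i<m. \<integral>x. \<bar>indicator (A i) x - g i x\<bar> \<partial>M)"
          using i1 i2 by (simp add: Bochner_Integration.integral_add
              Bochner_Integration.integral_sum)
        also have "\<dots> < e / 2 + e / 2"
        proof (rule add_less_le_mono[OF m[OF M]])
          have "(\<Sum>i<m. \<integral>x. \<bar>indicator (A i) x - g i x\<bar> \<partial>M) \<le> (\<Sum>i<m. e / (2 * Suc m))"
            using g(3)[OF M] by (intro sum_mono less_imp_le)
          also have "\<dots> = (e / 2) * (m / Suc m)" by simp
          also have "\<dots> \<le> (e / 2) * 1" using e by (intro mult_left_mono) auto
          finally show "(\<Sum>i<m. \<integral>x. \<bar>indicator (A i) x - g i x\<bar> \<partial>M) \<le> e / 2" by simp
        qed
        finally show ?thesis by simp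
      qed
      with Gc Gb show "P (\<Union>i. A i) e"
        unfolding P_def
        by (intro exI[of _ G]) simp
    qed
  qed
  with e show ?thesis unfolding Q_def P_def by blast
qed

lemma staircase_approx:
  fixes y :: real
  assumes "0 \<le> y" "y \<le> real m"
  shows "\<bar>y - (\<Sum>j=1..m. of_bool (real j \<le> y))\<bar> \<le> 1"
proof -
  have "{j \<in> {1..m}. real j \<le> y} = {1..nat \<lfloor>y\<rfloor>}"
    using assms by (auto simp: le_nat_floor le_nat_iff le_floor_iff)
  then have "(\<Sum>j=1..m. of_bool (real j \<le> y)) = real (nat \<lfloor>y\<rfloor>)"
    by (simp add: sum.If_cases of_bool_def Int_def)
  then show ?thesis using assms by simp linarith
qed

text \<open>\<open>h\<close> is rescaled to [0, m] and replaced by a staircase, the sum of the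
  indicators of its superlevel sets at the integers 1 to m. Each indicator is then approximated by a
  continuous function.\<close>

lemma approx_bounded_continuous:
  fixes S :: "real measure set" and h :: "real \<Rightarrow> real"
  assumes S: "finite S" "\<And>M. M \<in> S \<Longrightarrow> finite_measure M" "\<And>M. M \<in> S \<Longrightarrow> sets M = sets borel"
    and h: "h \<in> borel_measurable borel" "\<And>x. \<bar>h x\<bar> \<le> k" and k: "0 < k" and e: "0 < e"
  shows "\<exists>g::real\<Rightarrow>real. continuous_on UNIV g \<and> (\<forall>x. \<bar>g x\<bar> \<le> k) \<and>
    (\<forall>M\<in>S. (\<integral>x. \<bar>h x - g x\<bar> \<partial>M) < e)"
proof -
  define T where "T = (\<Sum>M\<in>S. measure M UNIV)"
  have T: "measure M UNIV \<le> T" if "M \<in> S" for M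
    unfolding T_def using that S(1) by (intro member_le_sum) auto
  have T0: "0 \<le> T" unfolding T_def by (intro sum_nonneg) simp
  \<comment> \<open>The staircase is off by at most one step of height 2 k / m; this m makes its
    integral smaller than e / 2 for every measure, \<open>T\<close> being a common bound for the
    total masses.\<close>
  obtain m :: nat where m: "4 * k * (T + 1) / e < m" using reals_Archimedean2 by blast
  have "0 \<le> 4 * k * (T + 1) / e" using k e T0 by simp
  with m have m0: "0 < m" by linarith
  have mT: "2 * k / m * T < e / 2"
  proof -
    have "4 * k * (T + 1) < m * e" using m e by (simp add: field_simps)
    then have "4 * k * T < m * e" using k by (simp add: distrib_left)
    then show ?thesis using m0 by (simp add: field_simps)
  qed
  define y where "y x = (h x + k) * m / (2 * k)" for x
  have y: "0 \<le> y x" "y x \<le> m" for x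
  proof -
    have hk: "0 \<le> h x + k" "h x + k \<le> 2 * k" using h(2)[of x] by (auto simp: abs_le_iff)
    then show "0 \<le> y x" using k by (simp add: y_def)
    have "(h x + k) * m \<le> (2 * k) * m" using hk by (intro mult_right_mono) auto
    then show "y x \<le> m" using k by (simp add: y_def pos_divide_le_eq mult.commute)
  qed
  define A where "A j = {x. real j \<le> y x}" for j :: nat
  have [measurable]: "y \<in> borel_measurable borel" unfolding y_def[abs_def] using h(1) by measurable
  have A: "A j \<in> sets borel" for j unfolding A_def by measurable
  \<comment> \<open>The m layers, each weighted with 2 k / m, contribute at most e / 2 in
    total.\<close>
  have e': "0 < e / (4 * k)" using e k by simp
  have "\<exists>g::real\<Rightarrow>real. continuous_on UNIV g \<and> (\<forall>x. 0 \<le> g x \<and> g x \<le> 1) \<and>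
    (\<forall>M\<in>S. (\<integral>x. \<bar>indicator (A j) x - g x\<bar> \<partial>M) < e / (4 * k))" for j
    by (rule approx_indicator_continuous[OF S A e'])
  then obtain g where g: "\<And>j. continuous_on UNIV (g j :: real \<Rightarrow> real)" "\<And>j x. 0 \<le> g j x \<and> g j x \<le> 1"
    "\<And>j M. M \<in> S \<Longrightarrow> (\<integral>x. \<bar>indicator (A j) x - g j x\<bar> \<partial>M) < e / (4 * k)"
    by metis
  have [measurable]: "g j \<in> borel_measurable borel" for j
    by (rule borel_measurable_continuous_onI[OF g(1)])
  define G where "G x = - k + 2 * k / m * (\<Sum>j=1..m. g j x)" for x
  have Gc: "continuous_on UNIV G" unfolding G_def[abs_def] by (intro continuous_intros g(1))
  have [measurable]: "G \<in> borel_measurable borel" by (rule borel_measurable_continuous_onI[OF Gc])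
  have Gb: "\<bar>G x\<bar> \<le> k" for x
  proof -
    have "0 \<le> (\<Sum>j=1..m. g j x)" "(\<Sum>j=1..m. g j x) \<le> m"
      using g(2) sum_bounded_above[of "{1..m}" "\<lambda>j. g j x" 1] by (auto intro!: sum_nonneg)
    then have "0 \<le> 2 * k / m * (\<Sum>j=1..m. g j x)" "2 * k / m * (\<Sum>j=1..m. g j x) \<le> 2 * k / m * m"
      using k m0 by (auto intro!: mult_left_mono simp del: times_divide_eq_left)
    then show ?thesis using m0 by (simp add: G_def abs_le_iff)
  qed
  have ptw: "\<bar>h x - G x\<bar> \<le> 2 * k / m + 2 * k / m * (\<Sum>j=1..m. \<bar>indicator (A j) x - g j x\<bar>)" for x
  proof -
    have hx: "h x = - k + 2 * k / m * y x" using k m0 by (simp add: y_def field_simps)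
    have "h x - G x = 2 * k / m * ((y x - (\<Sum>j=1..m. of_bool (real j \<le> y x)))
        + (\<Sum>j=1..m. indicator (A j) x - g j x))"
      unfolding hx G_def by (simp add: sum_subtractf A_def indicator_def algebra_simps)
    then have "\<bar>h x - G x\<bar> = 2 * k / m * \<bar>(y x - (\<Sum>j=1..m. of_bool (real j \<le> y x)))
        + (\<Sum>j=1..m. indicator (A j) x - g j x)\<bar>"
      using k by (simp add: abs_mult)
    also have "\<dots> \<le> 2 * k / m * (1 + (\<Sum>j=1..m. \<bar>indicator (A j) x - g j x\<bar>))"
      using k staircase_approx[OF y] sum_abs[of "\<lambda>j. indicator (A j) x - g j x" "{1..m}"]
      by (intro mult_left_mono) (auto intro!: order_trans[OF abs_triangle_ineq] add_mono)
    finally show ?thesis by (simp add: distrib_left)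
  qed
  have "(\<integral>x. \<bar>h x - G x\<bar> \<partial>M) < e" if M: "M \<in> S" for M
  proof -
    interpret finite_measure M using S M by blast
    note [measurable_cong] = S(3)[OF M]
    have sp: "space M = UNIV" using sets_eq_imp_space_eq[OF S(3)[OF M]] by simp
    have i2: "integrable M (\<lambda>x. \<bar>indicator (A j) x - g j x\<bar>)" for j
    proof (rule integrable_const_bound[of _ 1])
      have "\<bar>indicator (A j) x - g j x\<bar> \<le> 1" for x using g(2)[of j x] by (auto simp: indicator_def)
      then show "AE x in M. norm \<bar>indicator (A j) x - g j x\<bar> \<le> 1" by simp
      show "(\<lambda>x. \<bar>indicator (A j) x - g j x\<bar>) \<in> borel_measurable M" using A by measurable
    qed
    have i3: "integrable M (\<lambda>x. \<bar>h x - G x\<bar>)"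
    proof (rule integrable_const_bound[of _ "2 * k"])
      show "AE x in M. norm \<bar>h x - G x\<bar> \<le> 2 * k"
        using h(2) Gb by (intro always_eventually allI) (smt (verit) real_norm_def)
      show "(\<lambda>x. \<bar>h x - G x\<bar>) \<in> borel_measurable M" using h(1) by measurable
    qed
    have "(\<integral>x. \<bar>h x - G x\<bar> \<partial>M) \<le> (\<integral>x. 2 * k / m + 2 * k / m * (\<Sum>j=1..m. \<bar>indicator (A j) x - g j x\<bar>)
        \<partial>M)"
      by (rule integral_mono[OF i3 _ ptw]) (use i2 in auto)
    also have "\<dots> = 2 * k / m * measure M UNIV + 2 * k / m * (\<Sum>j=1..m. \<integral>x. \<bar>indicator (A j) x
        - g j x\<bar> \<partial>M)"
      using i2 by (simp add: Bochner_Integration.integral_add Bochner_Integration.integral_sum sp)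
    also have "\<dots> < e / 2 + e / 2"
    proof (rule add_less_le_mono)
      have "2 * k / m * measure M UNIV \<le> 2 * k / m * T" using k T[OF M]
          by (intro mult_left_mono) auto
      then show "2 * k / m * measure M UNIV < e / 2" using mT by linarith
      have "(\<Sum>j=1..m. \<integral>x. \<bar>indicator (A j) x - g j x\<bar> \<partial>M) \<le> (\<Sum>j=1..m. e / (4 * k))"
        using g(3)[OF M] by (intro sum_mono less_imp_le)
      then have "2 * k / m * (\<Sum>j=1..m. \<integral>x. \<bar>indicator (A j) x - g j x\<bar> \<partial>M) \<le> 2 * k / m * (m
          * (e / (4 * k)))"
        using k by (intro mult_left_mono) auto
      also have "\<dots> = e / 2" using k m0 by (simp add: field_simps)
      finally show "2 * k / m * (\<Sum>j=1..m. \<integral>x. \<bar>indicator (A j) x - g j x\<bar> \<partial>M) \<le> e / 2" .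
    qed
    finally show ?thesis by simp
  qed
  with Gc Gb show ?thesis by blast
qed

section \<open>The variational formula for the entropy\<close>

text \<open>Young's inequality for the conjugate pair t ln t - t and exp g, with equality at g = ln
  t.\<close>

lemma mult_ln_ge:
  fixes t g :: real
  assumes "0 \<le> t"
  shows "t * g - exp g + t \<le> t * ln t"
proof (cases "t = 0")
  case False
  with assms have t: "0 < t" by simp
  have "ln (exp g / t) \<le> exp g / t - 1" using t by (intro ln_le_minus_one) simp
  then have "g - ln t \<le> exp g / t - 1" using t by (simp add: ln_div)
  then have "t * (g - ln t) \<le> t * (exp g / t - 1)" using t by (intro mult_left_mono) auto
  then show ?thesis using t by (simp add: algebra_simps)
qed simp

lemma abs_exp_diff_le:
  fixes a b :: real
  assumes "\<bar>a\<bar> \<le> k" "\<bar>b\<bar> \<le> k"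
  shows "\<bar>exp a - exp b\<bar> \<le> exp k * \<bar>a - b\<bar>"
proof -
  have *: "exp x - exp y \<le> exp k * (x - y)" if "y \<le> x" "x \<le> k" for x y :: real
  proof -
    have "exp x - exp y = exp x * (1 - exp (y - x))" by (simp add: algebra_simps exp_diff)
    also have "\<dots> \<le> exp x * (x - y)"
    proof (rule mult_left_mono)
      show "1 - exp (y - x) \<le> x - y" using exp_ge_add_one_self[of "y - x"] by linarith
    qed simp
    also have "\<dots> \<le> exp k * (x - y)" using that by (intro mult_right_mono) auto
    finally show ?thesis .
  qed
  show ?thesis
  proof (cases "a \<le> b")
    case True
    then have "exp a \<le> exp b" by simp
    with *[of a b] True assms show ?thesis by (simp add: abs_le_iff)
  next
    case False
    then have "exp b \<le> exp a" by simp
    with *[of b a] False assms show ?thesis by (simp add: abs_le_iff)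
  qed
qed

lemma nn_integral_exp_abs_le:
  assumes "0 < \<theta>"
  shows "(\<integral>\<^sup>+x. ennreal (exp (- \<theta> * \<bar>x\<bar>)) \<partial>lborel) \<le> ennreal (2 / \<theta>)"
proof -
  have "emeasure (density lborel (exponential_density \<theta>)) UNIV = 1"
    using prob_space.emeasure_space_1[OF prob_space_exponential_density[OF assms]] by simp
  then have one: "(\<integral>\<^sup>+x. ennreal (exponential_density \<theta> x) \<partial>lborel) = 1"
    by (simp add: emeasure_density)
  have "(\<integral>\<^sup>+x. ennreal (exponential_density \<theta> (- x)) \<partial>lborel) = 1"
    using nn_integral_real_affine[of "\<lambda>x. ennreal (exponential_density \<theta> x)" "-1" 0] one by simp
  with one have two: "(\<integral>\<^sup>+x. ennreal (exponential_density \<theta> x)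
      + ennreal (exponential_density \<theta> (- x)) \<partial>lborel) = 2"
    by (simp add: nn_integral_add)
  have "(\<integral>\<^sup>+x. ennreal (exp (- \<theta> * \<bar>x\<bar>)) \<partial>lborel)
      \<le> (\<integral>\<^sup>+x. ennreal (1 / \<theta>) * (ennreal (exponential_density \<theta> x)
          + ennreal (exponential_density \<theta> (- x))) \<partial>lborel)"
  proof (rule nn_integral_mono)
    fix x
    have nn: "0 \<le> exponential_density \<theta> x" "0 \<le> exponential_density \<theta> (- x)"
      using assms by (auto simp: exponential_density_def)
    have "exp (- \<theta> * \<bar>x\<bar>) \<le> (1 / \<theta>) * (exponential_density \<theta> x + exponential_density \<theta> (- x))"
      using assms by (auto simp: exponential_density_def field_simps)
    then show "ennreal (exp (- \<theta> * \<bar>x\<bar>))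
        \<le> ennreal (1 / \<theta>) * (ennreal (exponential_density \<theta> x)
            + ennreal (exponential_density \<theta> (- x)))"
      using assms nn by (simp add: ennreal_plus[symmetric] ennreal_mult[symmetric] ennreal_leI del:
          ennreal_plus)
  qed
  also have "\<dots> = ennreal (1 / \<theta>) * 2" by (subst nn_integral_cmult) (auto simp: two)
  also have "\<dots> = ennreal (2 / \<theta>)"
    using assms ennreal_mult'[of 2 "1 / \<theta>"] by (simp add: mult.commute)
  finally show ?thesis .
qed

lemma
  fixes h :: "real \<Rightarrow> real"
  assumes \<theta>: "0 < \<theta>" and h[measurable]: "h \<in> borel_measurable borel" and k: "\<And>x. \<bar>h x\<bar> \<le> k"
  shows integrable_exp_weight: "integrable lborel (\<lambda>x. exp (h x - \<theta> * \<bar>x\<bar>))"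
    and exp_weight_pos: "0 < (\<integral>x. exp (h x - \<theta> * \<bar>x\<bar>) \<partial>lborel)"
proof -
  have "(\<integral>\<^sup>+x. ennreal (norm (exp (h x - \<theta> * \<bar>x\<bar>))) \<partial>lborel) \<le> (\<integral>\<^sup>+x. ennreal (exp k)
      * ennreal (exp (- \<theta> * \<bar>x\<bar>)) \<partial>lborel)"
    using k by (intro nn_integral_mono)
      (auto simp: ennreal_mult[symmetric] exp_add[symmetric] abs_le_iff intro!: ennreal_leI)
  also have "\<dots> = ennreal (exp k) * (\<integral>\<^sup>+x. ennreal (exp (- \<theta> * \<bar>x\<bar>)) \<partial>lborel)"
    by (rule nn_integral_cmult) measurable
  also have "\<dots> < \<infinity>"
    using nn_integral_exp_abs_le[OF \<theta>] by (auto simp: ennreal_mult_less_top intro: le_less_trans)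
  finally show int: "integrable lborel (\<lambda>x. exp (h x - \<theta> * \<bar>x\<bar>))"
    by (intro integrableI_bounded) auto
  have "0 < (\<integral>x. exp (- k - \<theta>) * indicator {0..1::real} x \<partial>lborel)" by simp
  also have "\<dots> \<le> (\<integral>x. exp (h x - \<theta> * \<bar>x\<bar>) \<partial>lborel)"
  proof (rule integral_mono[OF _ int])
    show "integrable lborel (\<lambda>x. exp (- k - \<theta>) * indicator {0..1::real} x)" by simp
    fix x :: real
    have "- k \<le> h x" using k[of x] by (simp add: abs_le_iff)
    then show "exp (- k - \<theta>) * indicator {0..1} x \<le> exp (h x - \<theta> * \<bar>x\<bar>)"
      using \<theta> by (auto simp: indicator_def mult_left_le intro!: add_mono diff_mono)
  qed
  finally show "0 < (\<integral>x. exp (h x - \<theta> * \<bar>x\<bar>) \<partial>lborel)" .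
qed

text \<open>A probability measure is sigma-finite, so its Radon-Nikodym derivative is finite almost
  everywhere and \<open>enn2real\<close> changes it only on a null set.\<close>

lemma absolutely_continuous_densityE:
  assumes "real_distribution \<mu>" "absolutely_continuous lborel \<mu>"
  defines "p \<equiv> (\<lambda>x. enn2real (RN_deriv lborel \<mu> x))"
  shows "\<mu> = density lborel (\<lambda>x. ennreal (p x))"
proof -
  interpret real_distribution \<mu> by fact
  have "density lborel (RN_deriv lborel \<mu>) = \<mu>"
    by (rule sigma_finite_measure.density_RN_deriv[OF sigma_finite_lborel]) (use assms in auto)
  moreover have "AE x in lborel. RN_deriv lborel \<mu> x \<noteq> \<infinity>"
    by (rule sigma_finite_measure.RN_deriv_finite[OF sigma_finite_lborel])
       (use assms in \<open>auto intro: sigma_finite_measure_axioms\<close>)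
  then have "density lborel (RN_deriv lborel \<mu>) = density lborel (\<lambda>x. ennreal (p x))"
    unfolding p_def by (intro density_cong) (auto simp: less_top elim!: eventually_mono)
  ultimately show ?thesis by simp
qed

text \<open>Young's inequality with g = - \<theta> |x|: the negative part of p ln p is controlled by
  the first moment and an integrable exponential.\<close>

lemma nn_integral_neg_entropy_le:
  fixes p :: "real \<Rightarrow> real"
  assumes [measurable]: "p \<in> borel_measurable lborel" and p: "\<And>x. 0 \<le> p x"
    and \<mu>: "\<mu> = density lborel (\<lambda>x. ennreal (p x))" and \<theta>: "0 < \<theta>"
  shows "(\<integral>\<^sup>+x. ennreal (- (p x * ln (p x))) \<partial>lborel)
    \<le> ennreal \<theta> * (\<integral>\<^sup>+x. ennreal \<bar>x\<bar> \<partial>\<mu>) + ennreal (2 / \<theta>)"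
proof -
  have "(\<integral>\<^sup>+x. ennreal (- (p x * ln (p x))) \<partial>lborel)
      \<le> (\<integral>\<^sup>+x. ennreal \<theta> * (ennreal (p x) * ennreal \<bar>x\<bar>) + ennreal (exp (- \<theta> * \<bar>x\<bar>)) \<partial>lborel)"
  proof (rule nn_integral_mono)
    fix x
    have "- (p x * ln (p x)) \<le> \<theta> * (p x * \<bar>x\<bar>) + exp (- \<theta> * \<bar>x\<bar>)"
      using mult_ln_ge[OF p[of x], of "- \<theta> * \<bar>x\<bar>"] p[of x] by (simp add: algebra_simps)
    then have "ennreal (- (p x * ln (p x))) \<le> ennreal (\<theta> * (p x * \<bar>x\<bar>) + exp (- \<theta> * \<bar>x\<bar>))"
      by (rule ennreal_leI)
    also have "\<dots> = ennreal \<theta> * (ennreal (p x) * ennreal \<bar>x\<bar>) + ennreal (exp (- \<theta> * \<bar>x\<bar>))"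
      using p \<theta> by (subst ennreal_plus) (auto simp: ennreal_mult)
    finally show "ennreal (- (p x * ln (p x))) \<le> \<dots>" .
  qed
  also have "\<dots> = ennreal \<theta> * (\<integral>\<^sup>+x. ennreal (p x) * ennreal \<bar>x\<bar> \<partial>lborel) + (\<integral>\<^sup>+x. ennreal (exp (- \<theta>
      * \<bar>x\<bar>)) \<partial>lborel)"
    by (subst nn_integral_add) (auto simp: nn_integral_cmult)
  also have "\<dots> \<le> ennreal \<theta> * (\<integral>\<^sup>+x. ennreal \<bar>x\<bar> \<partial>\<mu>) + ennreal (2 / \<theta>)"
    unfolding \<mu> using nn_integral_exp_abs_le[OF \<theta>]
    by (subst nn_integral_density) (auto intro!: add_left_mono)
  finally show ?thesis .
qed

lemma entropy_fun_density:
  assumes \<mu>: "real_distribution \<mu>" and int: "integrable \<mu> (\<lambda>x. x)"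
      and ac: "absolutely_continuous lborel \<mu>"
  obtains p where "p \<in> borel_measurable lborel" "\<And>x. 0 \<le> p x" "\<mu>
      = density lborel (\<lambda>x. ennreal (p x))"
    "(\<integral>\<^sup>+x. ennreal (- (p x * ln (p x))) \<partial>lborel) < \<infinity>"
    "entropy_fun \<mu> = enn2ereal (\<integral>\<^sup>+x. ennreal (p x * ln (p x)) \<partial>lborel)
             - enn2ereal (\<integral>\<^sup>+x. ennreal (- (p x * ln (p x))) \<partial>lborel)"
proof -
  define p where "p = (\<lambda>x. enn2real (RN_deriv lborel \<mu> x))"
  have p: "p \<in> borel_measurable lborel" "\<And>x. 0 \<le> p x" by (auto simp: p_def)
  have dens: "\<mu> = density lborel (\<lambda>x. ennreal (p x))"
    unfolding p_def by (rule absolutely_continuous_densityE[OF \<mu> ac])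
  have "(\<integral>\<^sup>+x. ennreal \<bar>x\<bar> \<partial>\<mu>) < \<infinity>" using int by (simp add: integrable_iff_bounded)
  then have neg: "(\<integral>\<^sup>+x. ennreal (- (p x * ln (p x))) \<partial>lborel) < \<infinity>"
    using nn_integral_neg_entropy_le[OF p dens, of 1] by (auto intro: le_less_trans)
  have "\<mu> \<in> prob_measures" using \<mu> prob_measures_iff_real_distribution by blast
  then have "entropy_fun \<mu> = enn2ereal (\<integral>\<^sup>+x. ennreal (p x * ln (p x)) \<partial>lborel)
             - enn2ereal (\<integral>\<^sup>+x. ennreal (- (p x * ln (p x))) \<partial>lborel)"
    using int ac by (simp add: entropy_fun_def p_def Let_def)
  from that[OF p dens neg this] show ?thesis .
qed

lemma entropy_fun_finiteE:
  assumes fin: "entropy_fun \<mu> \<noteq> \<infinity>"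
  obtains p where "p \<in> borel_measurable lborel" "\<And>x. 0 \<le> p x" "\<mu>
      = density lborel (\<lambda>x. ennreal (p x))"
    "integrable \<mu> (\<lambda>x. x)" "integrable lborel (\<lambda>x. p x * ln (p x))"
    "entropy_fun \<mu> = ereal (\<integral>x. p x * ln (p x) \<partial>lborel)"
proof -
  have \<mu>: "real_distribution \<mu>" "integrable \<mu> (\<lambda>x. x)" "absolutely_continuous lborel \<mu>"
    using fin prob_measures_iff_real_distribution by (auto simp: entropy_fun_def split: if_splits)
  obtain p where p[measurable]: "p \<in> borel_measurable lborel" and p0: "\<And>x. 0 \<le> p x"
    and dens: "\<mu> = density lborel (\<lambda>x. ennreal (p x))"
    and neg: "(\<integral>\<^sup>+x. ennreal (- (p x * ln (p x))) \<partial>lborel) < \<infinity>"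
    and ent: "entropy_fun \<mu> = enn2ereal (\<integral>\<^sup>+x. ennreal (p x * ln (p x)) \<partial>lborel)
             - enn2ereal (\<integral>\<^sup>+x. ennreal (- (p x * ln (p x))) \<partial>lborel)"
    using entropy_fun_density[OF \<mu>] by blast
  let ?P = "\<integral>\<^sup>+x. ennreal (p x * ln (p x)) \<partial>lborel" and ?N = "\<integral>\<^sup>+x. ennreal (- (p x * ln (p x)))
      \<partial>lborel"
  have pos: "?P < \<infinity>"
    using fin neg ent by (cases ?P; cases ?N) (auto simp: less_top)
  have "(\<integral>\<^sup>+x. ennreal (norm (p x * ln (p x))) \<partial>lborel) = (\<integral>\<^sup>+x. ennreal (p x * ln (p x))
      + ennreal (- (p x * ln (p x))) \<partial>lborel)"
    by (intro nn_integral_cong) (auto simp: abs_if ennreal_neg)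
  also have "\<dots> = ?P + ?N" by (rule nn_integral_add) measurable
  also have "\<dots> < \<infinity>" using pos neg by simp
  finally have int: "integrable lborel (\<lambda>x. p x * ln (p x))" by (intro integrableI_bounded) auto
  have "entropy_fun \<mu> = ereal (enn2real ?P - enn2real ?N)"
    unfolding ent using pos neg by (cases ?P; cases ?N) (auto simp: less_top)
  also have "\<dots> = ereal (\<integral>x. p x * ln (p x) \<partial>lborel)"
    using real_lebesgue_integral_def[OF int] by simp
  finally show ?thesis using that[OF p p0 dens \<mu>(2) int] by blast
qed

text \<open>Gibbs variational inequality with reference weight exp (- \<theta> |x|), which replaces
  the infinite Lebesgue measure by a finite one at the price of the moment term.\<close>

lemma entropy_fun_ge:
  fixes h :: "real \<Rightarrow> real"
  assumes \<mu>: "real_distribution \<mu>" and \<theta>: "0 < \<theta>" and h[measurable]: "h \<in> borel_measurable borel"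
      and k: "\<And>x. \<bar>h x\<bar> \<le> k"
  shows "ereal ((\<integral>x. h x \<partial>\<mu>) - \<theta> * (\<integral>x. \<bar>x\<bar> \<partial>\<mu>) - ln (\<integral>x. exp (h x - \<theta> * \<bar>x\<bar>) \<partial>lborel))
      \<le> entropy_fun \<mu>"
proof (cases "entropy_fun \<mu> = \<infinity>")
  case False
  then obtain p where p[measurable]: "p \<in> borel_measurable lborel" and p0: "\<And>x. 0 \<le> p x"
    and dens: "\<mu> = density lborel (\<lambda>x. ennreal (p x))"
    and ix: "integrable \<mu> (\<lambda>x. x)" and ip: "integrable lborel (\<lambda>x. p x * ln (p x))"
    and ent: "entropy_fun \<mu> = ereal (\<integral>x. p x * ln (p x) \<partial>lborel)"
    using entropy_fun_finiteE by blast
  interpret real_distribution \<mu> by fact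
  let ?L = "\<integral>x. exp (h x - \<theta> * \<bar>x\<bar>) \<partial>lborel"
  have L: "0 < ?L" by (rule exp_weight_pos[OF \<theta> h k])
  have iL: "integrable lborel (\<lambda>x. exp (h x - \<theta> * \<bar>x\<bar>))" by (rule integrable_exp_weight[OF \<theta> h k])
  \<comment> \<open>Subtracting \<open>ln ?L\<close> gives \<open>exp (g x)\<close> total mass 1, so
    that the terms - exp g + p of Young's inequality integrate to 0.\<close>
  define g where "g x = h x - \<theta> * \<bar>x\<bar> - ln ?L" for x
  have [measurable]: "g \<in> borel_measurable borel" unfolding g_def[abs_def] by measurable
  have ih: "integrable \<mu> h" using k by (intro integrable_const_bound[of _ k]) auto
  have ig: "integrable \<mu> g" unfolding g_def[abs_def] using ih ix by simp
  have eg: "exp (g x) = exp (h x - \<theta> * \<bar>x\<bar>) / ?L" for x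
    using L by (simp add: g_def exp_diff)
  have e1: "(\<integral>x. exp (g x) \<partial>lborel) = 1" "integrable lborel (\<lambda>x. exp (g x))"
    using L iL by (simp_all add: eg)
  have d: "integrable \<mu> f \<longleftrightarrow> integrable lborel (\<lambda>x. p x * f x)"
    "integral\<^sup>L \<mu> f = (\<integral>x. p x * f x \<partial>lborel)"
    if [measurable]: "f \<in> borel_measurable borel" for f :: "real \<Rightarrow> real"
    unfolding dens using p0 by (subst integrable_real_density integral_real_density; simp)+
  have ipg: "integrable lborel (\<lambda>x. p x * g x)" using ig d by simp
  have p1: "integrable lborel p" "(\<integral>x. p x \<partial>lborel) = 1"
    using d[of "\<lambda>_. 1"] prob_space by simp_all
  have "(\<integral>x. g x \<partial>\<mu>) = (\<integral>x. p x * g x - exp (g x) + p x \<partial>lborel)"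
    using ipg e1 p1 d(2)[of g] by (simp add: Bochner_Integration.integral_add)
  also have "\<dots> \<le> (\<integral>x. p x * ln (p x) \<partial>lborel)"
    using ipg e1 p1 ip mult_ln_ge[OF p0] by (intro integral_mono) auto
  finally have "(\<integral>x. g x \<partial>\<mu>) \<le> (\<integral>x. p x * ln (p x) \<partial>lborel)" .
  moreover have "(\<integral>x. g x \<partial>\<mu>) = (\<integral>x. h x \<partial>\<mu>) - \<theta> * (\<integral>x. \<bar>x\<bar> \<partial>\<mu>) - ln ?L"
    unfolding g_def using ih ix prob_space by simp
  ultimately show ?thesis using ent by simp
qed simp

text \<open>A large multiple of the indicator of a Lebesgue null set charged by \<mu>: its mean
  under \<mu> is as large as desired while the normalising integral does not see it.\<close>

lemma entropy_dual_singular: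
  assumes \<mu>: "real_distribution \<mu>" and \<theta>: "0 < \<theta>" and nac: "\<not> absolutely_continuous lborel \<mu>"
  shows "\<exists>h k. h \<in> borel_measurable borel \<and> (\<forall>x. \<bar>h x\<bar> \<le> k) \<and> 0 < k \<and>
    a < (\<integral>x. h x \<partial>\<mu>) - ln (\<integral>x. exp (h x - \<theta> * \<bar>x\<bar>) \<partial>lborel)"
proof -
  interpret real_distribution \<mu> by fact
  obtain A where A: "A \<in> null_sets lborel" "A \<notin> null_sets \<mu>"
    using nac by (auto simp: absolutely_continuous_def)
  have Ab[measurable]: "A \<in> sets borel" using A(1) by auto
  then have pos: "0 < measure \<mu> A"
    using A(2) by (auto simp: emeasure_eq_measure null_sets_def zero_less_measure_iff)
  let ?L = "\<integral>x. exp (0 - \<theta> * \<bar>x\<bar>) \<partial>lborel"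
  define k where "k = (\<bar>a + ln ?L\<bar> + 1) / measure \<mu> A"
  have k: "0 < k" "a + ln ?L < k * measure \<mu> A" using pos by (auto simp: k_def add_nonneg_pos)
  define h where "h x = k * indicator A x" for x
  have "AE x in lborel. exp (h x - \<theta> * \<bar>x\<bar>) = exp (0 - \<theta> * \<bar>x\<bar>)"
    using A(1) by (rule AE_I') (auto simp: h_def indicator_def)
  then have "(\<integral>x. exp (h x - \<theta> * \<bar>x\<bar>) \<partial>lborel) = ?L"
    unfolding h_def by (intro integral_cong_AE) auto
  moreover have "(\<integral>x. h x \<partial>\<mu>) = k * measure \<mu> A" by (simp add: h_def)
  moreover have "h \<in> borel_measurable borel" unfolding h_def[abs_def] by measurable
  moreover have "\<bar>h x\<bar> \<le> k" for x using k(1) by (simp add: h_def indicator_def)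
  ultimately show ?thesis using k by (intro exI[of _ h] exI[of _ k]) simp
qed

text \<open>Monotone convergence of the truncated positive part. Stated for all large k, because the
  later choice of k must also satisfy other constraints.\<close>

lemma nn_integral_truncated_gt:
  fixes p :: "real \<Rightarrow> real"
  assumes [measurable]: "p \<in> borel_measurable lborel" and p0: "\<And>x. 0 \<le> p x"
    and b: "ereal b < enn2ereal (\<integral>\<^sup>+x. ennreal (p x * ln (p x)) \<partial>lborel)"
  shows "\<exists>k0::nat. \<forall>k\<ge>k0. ereal b < enn2ereal (\<integral>\<^sup>+x. ennreal (p x * max 0 (min (real k) (ln (p x))))
      \<partial>lborel)"
proof (cases "b < 0")
  case True
  then show ?thesis by (auto intro!: less_le_trans[OF _ enn2ereal_nonneg])
next
  case False
  let ?f = "\<lambda>k x. ennreal (p x * max 0 (min (real k) (ln (p x))))"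
  have inc: "?f j x \<le> ?f k x" if "j \<le> k" for j k x
    using that p0 by (intro ennreal_leI mult_left_mono max.mono min.mono) auto
  have sup: "(SUP k. ?f k x) = ennreal (p x * ln (p x))" for x
  proof (rule antisym)
    show "(SUP k. ?f k x) \<le> ennreal (p x * ln (p x))"
    proof (rule SUP_least)
      fix k
      show "?f k x \<le> ennreal (p x * ln (p x))"
      proof (cases "1 \<le> p x")
        case True
        then show ?thesis by (intro ennreal_leI mult_left_mono) (auto simp: p0)
      next
        case False
        then have "ln (p x) \<le> 0" using p0[of x] by (cases "p x = 0") auto
        then show ?thesis by simp
      qed
    qed
    obtain k :: nat where k: "ln (p x) \<le> k" using real_arch_simple by blast
    have "ennreal (p x * ln (p x)) \<le> ?f k x"
      using k p0 by (intro ennreal_leI mult_left_mono) auto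
    then show "ennreal (p x * ln (p x)) \<le> (SUP k. ?f k x)" by (rule SUP_upper2[OF UNIV_I])
  qed
  have "(\<integral>\<^sup>+x. ennreal (p x * ln (p x)) \<partial>lborel) = (SUP k. \<integral>\<^sup>+x. ?f k x \<partial>lborel)"
    unfolding sup[symmetric]
    by (rule nn_integral_monotone_convergence_SUP) (auto simp: incseq_def le_fun_def inc)
  moreover have "ennreal b < (\<integral>\<^sup>+x. ennreal (p x * ln (p x)) \<partial>lborel)"
    using b False by (simp add: less_ennreal.rep_eq enn2ereal_ennreal)
  ultimately obtain k0 where k0: "ennreal b < (\<integral>\<^sup>+x. ?f k0 x \<partial>lborel)"
    by (auto simp: less_SUP_iff)
  have "ereal b < enn2ereal (\<integral>\<^sup>+x. ?f k x \<partial>lborel)" if "k0 \<le> k" for k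
  proof -
    have "(\<integral>\<^sup>+x. ?f k0 x \<partial>lborel) \<le> (\<integral>\<^sup>+x. ?f k x \<partial>lborel)"
      using inc[OF that] by (intro nn_integral_mono)
    with k0 have "ennreal b < (\<integral>\<^sup>+x. ?f k x \<partial>lborel)" by (rule less_le_trans)
    then show ?thesis using False by (simp add: less_ennreal.rep_eq enn2ereal_ennreal)
  qed
  then show ?thesis by blast
qed

text \<open>The ideal test function ln p + \<theta> |x| is unbounded, so it is cut at the levels - k
  and k. The lower cut raises the normalising integral from 1 by at most a multiple of exp (- k).
  Dropping the nonnegative \<theta> |x| in the mean of h explains why no moment term appears in the
  conclusion.\<close>

lemma entropy_dual_density:
  assumes \<mu>: "real_distribution \<mu>" and \<theta>: "0 < \<theta>" and ac: "absolutely_continuous lborel \<mu>"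
    and ix: "integrable \<mu> (\<lambda>x. x)" and a: "ereal a < entropy_fun \<mu>"
  shows "\<exists>h k. h \<in> borel_measurable borel \<and> (\<forall>x. \<bar>h x\<bar> \<le> k) \<and> 0 < k \<and>
    a < (\<integral>x. h x \<partial>\<mu>) - ln (\<integral>x. exp (h x - \<theta> * \<bar>x\<bar>) \<partial>lborel)"
proof -
  interpret real_distribution \<mu> by fact
  obtain p where p[measurable]: "p \<in> borel_measurable lborel" and p0: "\<And>x. 0 \<le> p x"
    and dens: "\<mu> = density lborel (\<lambda>x. ennreal (p x))"
    and neg: "(\<integral>\<^sup>+x. ennreal (- (p x * ln (p x))) \<partial>lborel) < \<infinity>"
    and ent: "entropy_fun \<mu> = enn2ereal (\<integral>\<^sup>+x. ennreal (p x * ln (p x)) \<partial>lborel)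
             - enn2ereal (\<integral>\<^sup>+x. ennreal (- (p x * ln (p x))) \<partial>lborel)"
    using entropy_fun_density[OF \<mu> ix ac] by blast
  have d: "integrable \<mu> f \<longleftrightarrow> integrable lborel (\<lambda>x. p x * f x)"
    "integral\<^sup>L \<mu> f = (\<integral>x. p x * f x \<partial>lborel)"
    if [measurable]: "f \<in> borel_measurable borel" for f :: "real \<Rightarrow> real"
    unfolding dens using p0 by (subst integrable_real_density integral_real_density; simp)+
  have p1: "integrable lborel p" "(\<integral>x. p x \<partial>lborel) = 1"
    using d[of "\<lambda>_. 1"] prob_space by simp_all
  \<comment> \<open>The negative part is a real \<open>c\<close>; moved to the other side, it leaves
    only the possibly infinite positive part to be approximated.\<close>
  obtain c where c: "0 \<le> c" "(\<integral>\<^sup>+x. ennreal (- (p x * ln (p x))) \<partial>lborel) = ennreal c"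
    using neg by (cases "\<integral>\<^sup>+x. ennreal (- (p x * ln (p x))) \<partial>lborel") auto
  have "ereal (a + c) < enn2ereal (\<integral>\<^sup>+x. ennreal (p x * ln (p x)) \<partial>lborel)"
    using a unfolding ent c(2) using c(1)
    by (cases "enn2ereal (\<integral>\<^sup>+x. ennreal (p x * ln (p x)) \<partial>lborel)") (auto simp: enn2ereal_ennreal)
  then obtain b where b: "a + c < b" "ereal b < enn2ereal (\<integral>\<^sup>+x. ennreal (p x * ln (p x)) \<partial>lborel)"
    using ereal_dense2 by (metis ereal_less_eq(3) less_ereal.simps(1))
  obtain k0 :: nat where k0: "\<And>k. k \<ge> k0 \<Longrightarrow> ereal b < enn2ereal (\<integral>\<^sup>+x. ennreal (p x
      * max 0 (min (real k) (ln (p x)))) \<partial>lborel)"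
    using nn_integral_truncated_gt[OF p p0 b(2)] by blast
  have "(\<lambda>k. 2 / \<theta> * exp (- real k)) \<longlonglongrightarrow> 2 / \<theta> * 0"
    by (intro tendsto_mult_left filterlim_compose[OF exp_at_bot] filterlim_compose[OF
        filterlim_uminus_at_bot_at_top] filterlim_real_sequentially)
  then have "\<forall>\<^sub>F k in sequentially. 2 / \<theta> * exp (- real k) < b - (a + c)"
    using b(1) by (intro order_tendstoD) auto
  then have "\<forall>\<^sub>F k in sequentially. 2 / \<theta> * exp (- real k) < b - (a + c) \<and> k0 \<le> k \<and> 1 \<le> k"
    using eventually_ge_at_top[of k0] eventually_ge_at_top[of 1] by eventually_elim simp
  then obtain k where k: "2 / \<theta> * exp (- real k) < b - (a + c)" "k0 \<le> k" "1 \<le> k"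
    by (auto dest: eventually_happens)
  \<comment> \<open>Where p vanishes the logarithm should be minus infinity, but
    \<open>ln 0 = 0\<close>; hence the separate value - k.\<close>
  define h where "h x = (if p x = 0 then - real k else max (- real k) (min (real k) (ln (p x) + \<theta>
      * \<bar>x\<bar>)))" for x
  have hm[measurable]: "h \<in> borel_measurable borel"
  proof -
    have "(\<lambda>x. if p x = 0 then - real k else max (- real k) (min (real k) (ln (p x) + \<theta> * \<bar>x\<bar>)))
        \<in> borel_measurable lborel"
      by measurable
    then show ?thesis by (simp add: h_def[abs_def])
  qed
  have hk: "\<bar>h x\<bar> \<le> real k" for x by (auto simp: h_def)
  let ?L = "\<integral>x. exp (h x - \<theta> * \<bar>x\<bar>) \<partial>lborel"
  have iL: "integrable lborel (\<lambda>x. exp (h x - \<theta> * \<bar>x\<bar>))" by (rule integrable_exp_weight[OF \<theta> hm hk])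
  have ie: "integrable lborel (\<lambda>x. exp (0 - \<theta> * \<bar>x\<bar>))"
      by (rule integrable_exp_weight[OF \<theta>, of _ 0]) auto
  have e2: "(\<integral>x. exp (0 - \<theta> * \<bar>x\<bar>) \<partial>lborel) \<le> 2 / \<theta>"
  proof -
    have "ennreal (\<integral>x. exp (0 - \<theta> * \<bar>x\<bar>) \<partial>lborel) = (\<integral>\<^sup>+x. ennreal (exp (- \<theta> * \<bar>x\<bar>)) \<partial>lborel)"
      using nn_integral_eq_integral[OF ie] by simp
    also note nn_integral_exp_abs_le[OF \<theta>]
    finally show ?thesis using \<theta> by (simp add: ennreal_le_iff)
  qed
  \<comment> \<open>The maximum of the two exponentials is below their sum: the uncut part
    integrates to the mass 1 of p, the cut part to a multiple of exp (- k).\<close>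
  have "?L \<le> (\<integral>x. p x + exp (- real k) * exp (0 - \<theta> * \<bar>x\<bar>) \<partial>lborel)"
  proof (rule integral_mono[OF iL])
    show "integrable lborel (\<lambda>x. p x + exp (- real k) * exp (0 - \<theta> * \<bar>x\<bar>))" using p1 ie by simp
    fix x
    show "exp (h x - \<theta> * \<bar>x\<bar>) \<le> p x + exp (- real k) * exp (0 - \<theta> * \<bar>x\<bar>)"
    proof (cases "p x = 0")
      case True
      then show ?thesis by (simp add: h_def exp_add[symmetric])
    next
      case False
      then have px: "0 < p x" using p0[of x] by simp
      have "exp (h x) \<le> exp (max (- real k) (ln (p x) + \<theta> * \<bar>x\<bar>))" using False by (auto simp: h_def)
      also have "\<dots> \<le> exp (- real k) + exp (ln (p x) + \<theta> * \<bar>x\<bar>)"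
          by (auto simp: max_def add_increasing add_increasing2)
      finally have "exp (h x) * exp (- \<theta> * \<bar>x\<bar>) \<le> (exp (- real k) + exp (ln (p x) + \<theta> * \<bar>x\<bar>))
          * exp (- \<theta> * \<bar>x\<bar>)"
        by (rule mult_right_mono) simp
      also have "\<dots> = p x + exp (- real k) * exp (0 - \<theta> * \<bar>x\<bar>)"
        using px by (simp add: distrib_right exp_add[symmetric] mult.assoc)
      finally show ?thesis by (simp add: exp_add[symmetric])
    qed
  qed
  also have "\<dots> = 1 + exp (- real k) * (\<integral>x. exp (0 - \<theta> * \<bar>x\<bar>) \<partial>lborel)"
    using p1 ie by (subst Bochner_Integration.integral_add) auto
  also have "\<dots> \<le> 1 + exp (- real k) * (2 / \<theta>)"
    using e2 by (intro add_left_mono mult_left_mono) auto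
  finally have L: "?L \<le> 1 + exp (- real k) * (2 / \<theta>)" .
  have "ln ?L \<le> ?L - 1" by (rule ln_le_minus_one[OF exp_weight_pos[OF \<theta> hm hk]])
  then have lnL: "ln ?L < b - (a + c)" using L k(1) by (simp add: mult.commute)
  have i1: "integrable lborel (\<lambda>x. p x * max 0 (min (real k) (ln (p x))))"
  proof (rule Bochner_Integration.integrable_bound[of lborel "\<lambda>x. p x * real k"])
    show "integrable lborel (\<lambda>x. p x * real k)" using p1 by simp
    show "AE x in lborel. norm (p x * max 0 (min (real k) (ln (p x)))) \<le> norm (p x * real k)"
      using p0 by (intro always_eventually allI) (auto simp: abs_mult intro!: mult_left_mono)
  qed measurable
  have max0: "ennreal (max 0 y) = ennreal y" for y :: real
    by (cases "0 \<le> y") (simp_all add: ennreal_neg)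
  have i2: "integrable lborel (\<lambda>x. max 0 (- (p x * ln (p x))))"
  proof (rule integrableI_nonneg)
    show "(\<integral>\<^sup>+x. ennreal (max 0 (- (p x * ln (p x)))) \<partial>lborel) < \<infinity>"
      unfolding max0 c(2) by simp
  qed auto
  have "ennreal (\<integral>x. max 0 (- (p x * ln (p x))) \<partial>lborel) = ennreal c"
    using nn_integral_eq_integral[OF i2] unfolding max0 c(2) by simp
  then have I2: "(\<integral>x. max 0 (- (p x * ln (p x))) \<partial>lborel) = c"
    using c(1) by (subst (asm) ennreal_inj) (auto intro!: integral_nonneg_AE)
  have "ereal b < enn2ereal (\<integral>\<^sup>+x. ennreal (p x * max 0 (min (real k) (ln (p x)))) \<partial>lborel)"
      by (rule k0[OF k(2)])
  also have "\<dots> = ereal (\<integral>x. p x * max 0 (min (real k) (ln (p x))) \<partial>lborel)"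
    using nn_integral_eq_integral[OF i1] p0 by (simp add: enn2ereal_ennreal)
  finally have I1: "b < (\<integral>x. p x * max 0 (min (real k) (ln (p x))) \<partial>lborel)" by simp
  have ih: "integrable \<mu> h" using hk by (intro integrable_const_bound[of _ "real k"]) auto
  \<comment> \<open>The negative part of p ln p is kept whole, as cutting it at - k could only
    enlarge \<open>h\<close>.\<close>
  have "(\<integral>x. p x * max 0 (min (real k) (ln (p x))) - max 0 (- (p x * ln (p x))) \<partial>lborel) \<le> (\<integral>x. p x
      * h x \<partial>lborel)"
  proof (rule integral_mono)
    show "integrable lborel (\<lambda>x. p x * max 0 (min (real k) (ln (p x))) - max 0 (- (p x
        * ln (p x))))" using i1 i2 by simp
    show "integrable lborel (\<lambda>x. p x * h x)" using ih d(1)[OF hm] by simp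
    fix x
    show "p x * max 0 (min (real k) (ln (p x))) - max 0 (- (p x * ln (p x))) \<le> p x * h x"
    proof (cases "p x = 0")
      case False
      then have px: "0 < p x" using p0[of x] by simp
      have "max 0 (min (real k) (ln (p x))) - max 0 (- ln (p x)) \<le> h x"
      proof -
        have "0 \<le> \<theta> * \<bar>x\<bar>" using \<theta> by simp
        moreover have "h x = max (- real k) (min (real k) (ln (p x) + \<theta> * \<bar>x\<bar>))" using False
            by (simp add: h_def)
        ultimately show ?thesis by linarith
      qed
      then have "p x * (max 0 (min (real k) (ln (p x))) - max 0 (- ln (p x))) \<le> p x * h x"
        using px by (intro mult_left_mono) auto
      moreover have "max 0 (- (p x * ln (p x))) = p x * max 0 (- ln (p x))"
        using px by (auto simp: max_def mult_le_0_iff zero_le_mult_iff)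
      ultimately show ?thesis by (simp add: right_diff_distrib)
    qed simp
  qed
  then have "b - c < (\<integral>x. h x \<partial>\<mu>)" using i1 i2 I1 I2 d(2)[OF hm] by simp
  then have "a < (\<integral>x. h x \<partial>\<mu>) - ln ?L" using lnL by linarith
  then show ?thesis using hm hk k(3) by (intro exI[of _ h] exI[of _ "real k"]) auto
qed

text \<open>Continuity of h is needed to obtain weakly open sets. Both terms of the functional are
  continuous under approximation in mean by functions with the same bound k, because exp is
  Lipschitz on [- k, k]; the approximation is carried out for \<mu> and the weighted Lebesgue
  measure simultaneously.\<close>

lemma entropy_dual:
  assumes \<mu>: "real_distribution \<mu>" and \<theta>: "0 < \<theta>"
    and ix: "integrable \<mu> (\<lambda>x. x)" and a: "ereal a < entropy_fun \<mu>"
  shows "\<exists>h k. (\<forall>x. isCont h x) \<and> (\<forall>x. \<bar>h x\<bar> \<le> k) \<and>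
    a < (\<integral>x. h x \<partial>\<mu>) - ln (\<integral>x. exp (h x - \<theta> * \<bar>x\<bar>) \<partial>lborel)"
proof -
  interpret real_distribution \<mu> by fact
  obtain h k where h[measurable]: "h \<in> borel_measurable borel" and k: "\<And>x. \<bar>h x\<bar> \<le> k" "0 < k"
    and ha: "a < (\<integral>x. h x \<partial>\<mu>) - ln (\<integral>x. exp (h x - \<theta> * \<bar>x\<bar>) \<partial>lborel)"
    using entropy_dual_singular[OF \<mu> \<theta>, of a] entropy_dual_density[OF \<mu> \<theta> _ ix a] by blast
  define \<nu> where "\<nu> = density lborel (\<lambda>x. ennreal (exp (- \<theta> * \<bar>x\<bar>)))"
  have "emeasure \<nu> (space \<nu>) \<noteq> \<infinity>"
    using nn_integral_exp_abs_le[OF \<theta>] by (auto simp: \<nu>_def emeasure_density top_unique)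
  then have fin: "finite_measure \<nu>" by (rule finite_measureI)
  have sets\<nu>[measurable_cong]: "sets \<nu> = sets borel" by (simp add: \<nu>_def)
  have weight: "(\<integral>x. exp (f x - \<theta> * \<bar>x\<bar>) \<partial>lborel) = (\<integral>x. exp (f x) \<partial>\<nu>)"
    if [measurable]: "f \<in> borel_measurable borel" for f
    unfolding \<nu>_def by (subst integral_real_density) (auto simp: exp_diff exp_minus field_simps)
  have "\<exists>g::real\<Rightarrow>real. continuous_on UNIV g \<and> (\<forall>x. \<bar>g x\<bar> \<le> k) \<and>
    (\<forall>M\<in>{\<mu>, \<nu>}. (\<integral>x. \<bar>h x - g x\<bar> \<partial>M) < inverse (Suc n))" for n
    by (rule approx_bounded_continuous[OF _ _ _ h k]) (use fin finite_measure_axioms in \<open>auto simp: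
        sets\<nu>\<close>)
  then obtain g where g: "\<And>n. continuous_on UNIV (g n :: real \<Rightarrow> real)" "\<And>n x. \<bar>g n x\<bar> \<le> k"
    "\<And>n. (\<integral>x. \<bar>h x - g n x\<bar> \<partial>\<mu>) < inverse (Suc n)" "\<And>n. (\<integral>x. \<bar>h x - g n x\<bar> \<partial>\<nu>) < inverse (Suc n)"
    by (metis insertCI)
  have gm[measurable]: "g n \<in> borel_measurable borel" for n
      by (rule borel_measurable_continuous_onI[OF g(1)])
  have bnd: "norm (h x) \<le> k" "norm (g n x) \<le> k" "norm \<bar>h x - g n x\<bar> \<le> 2 * k" for n x
    using k(1)[of x] g(2)[of n x] by auto
  interpret \<nu>: finite_measure \<nu> by fact
  have "(\<lambda>n. \<integral>x. g n x \<partial>\<mu>) \<longlonglongrightarrow> (\<integral>x. h x \<partial>\<mu>)"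
  proof (rule metric_tendsto_imp_tendsto[OF LIMSEQ_inverse_real_of_nat], intro always_eventually
      allI)
    fix n
    have i: "integrable \<mu> h" "integrable \<mu> (g n)"
      using bnd by (auto intro!: integrable_const_bound[of _ k] always_eventually)
    have "\<bar>(\<integral>x. h x \<partial>\<mu>) - (\<integral>x. g n x \<partial>\<mu>)\<bar> = \<bar>\<integral>x. h x - g n x \<partial>\<mu>\<bar>" using i by simp
    also have "\<dots> \<le> (\<integral>x. \<bar>h x - g n x\<bar> \<partial>\<mu>)" by (rule integral_abs_bound)
    finally show "dist (\<integral>x. g n x \<partial>\<mu>) (\<integral>x. h x \<partial>\<mu>) \<le> dist (inverse (real (Suc n))) 0"
      using g(3)[of n] by (simp add: dist_real_def abs_minus_commute)
  qed
  moreover have "(\<lambda>n. \<integral>x. exp (g n x) \<partial>\<nu>) \<longlonglongrightarrow> (\<integral>x. exp (h x) \<partial>\<nu>)"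
  proof (rule metric_tendsto_imp_tendsto)
    show "(\<lambda>n. exp k * inverse (real (Suc n))) \<longlonglongrightarrow> 0"
      using tendsto_mult_left[OF LIMSEQ_inverse_real_of_nat, of "exp k"] by simp
    show "\<forall>\<^sub>F n in sequentially. dist (\<integral>x. exp (g n x) \<partial>\<nu>) (\<integral>x. exp (h x) \<partial>\<nu>) \<le> dist (exp k
        * inverse (real (Suc n))) 0"
    proof (intro always_eventually allI)
      fix n
      have i: "integrable \<nu> (\<lambda>x. exp (h x))" "integrable \<nu> (\<lambda>x. exp (g n x))"
        using k(1) g(2) by (auto intro!: \<nu>.integrable_const_bound[of _ "exp k"] always_eventually
            simp: abs_le_iff)
      have i': "integrable \<nu> (\<lambda>x. \<bar>h x - g n x\<bar>)"
        using bnd by (intro \<nu>.integrable_const_bound[of _ "2 * k"] always_eventually) auto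
      have "\<bar>(\<integral>x. exp (h x) \<partial>\<nu>) - (\<integral>x. exp (g n x) \<partial>\<nu>)\<bar> = \<bar>\<integral>x. exp (h x) - exp (g n x) \<partial>\<nu>\<bar>" using i
          by simp
      also have "\<dots> \<le> (\<integral>x. \<bar>exp (h x) - exp (g n x)\<bar> \<partial>\<nu>)" by (rule integral_abs_bound)
      also have "\<dots> \<le> (\<integral>x. exp k * \<bar>h x - g n x\<bar> \<partial>\<nu>)"
        using i i' by (intro integral_mono abs_exp_diff_le k g) auto
      also have "\<dots> \<le> exp k * inverse (Suc n)" using g(4)[of n] by simp
      finally show "dist (\<integral>x. exp (g n x) \<partial>\<nu>) (\<integral>x. exp (h x) \<partial>\<nu>) \<le> dist (exp k
          * inverse (real (Suc n))) 0"
        by (simp add: dist_real_def abs_minus_commute abs_mult)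
    qed
  qed
  moreover have "(\<integral>x. exp (h x) \<partial>\<nu>) \<noteq> 0"
    using exp_weight_pos[OF \<theta> h k(1)] unfolding weight[OF h] by simp
  ultimately have "(\<lambda>n. (\<integral>x. g n x \<partial>\<mu>) - ln (\<integral>x. exp (g n x) \<partial>\<nu>)) \<longlonglongrightarrow> (\<integral>x. h x \<partial>\<mu>) - ln (\<integral>x. exp (h x)
      \<partial>\<nu>)"
    by (intro tendsto_intros)
  then have "\<forall>\<^sub>F n in sequentially. a < (\<integral>x. g n x \<partial>\<mu>) - ln (\<integral>x. exp (g n x) \<partial>\<nu>)"
    using ha unfolding weight[OF h] by (rule order_tendstoD)
  then obtain n where "a < (\<integral>x. g n x \<partial>\<mu>) - ln (\<integral>x. exp (g n x) \<partial>\<nu>)"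
    by (auto dest: eventually_happens)
  then show ?thesis
    using g(1)[of n] g(2)[of n] unfolding weight[OF gm, symmetric]
    by (intro exI[of _ "g n"] exI[of _ k]) (auto simp: continuous_on_eq_continuous_at)
qed

section \<open>The upper bound\<close>

text \<open>\<open>L\<close> comes from the bounded derivative, \<open>\<kappa>\<close> from the
  boundary slopes and the positivity inside, and \<open>c\<close> stands for
  \<open>2 / \<sigma>\<^sup>2\<close>.\<close>

locale rank_energy =
  fixes B :: "real \<Rightarrow> real" and L \<kappa> c :: real
  assumes lipschitz: "\<And>u v. u \<in> {0..1} \<Longrightarrow> v \<in> {0..1} \<Longrightarrow> \<bar>B u - B v\<bar> \<le> L * \<bar>u - v\<bar>"
    and tent_le: "\<And>u. u \<in> {0..1} \<Longrightarrow> \<kappa> * tent u \<le> B u"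
    and \<kappa>_pos: "0 < \<kappa>" and c_pos: "0 < c" and B_0: "B 0 = 0" and B_1: "B 1 = 0"
begin

lemma continuous_on_B: "continuous_on {0..1} B"
proof (rule continuous_onI)
  fix x e :: real assume x: "x \<in> {0..1}" and e: "0 < e"
  have "dist (B y) (B x) \<le> e" if y: "y \<in> {0..1}" "dist y x < e / (\<bar>L\<bar> + 1)" for y
  proof -
    have "\<bar>B y - B x\<bar> \<le> L * \<bar>y - x\<bar>" using lipschitz[OF y(1) x] .
    also have "\<dots> \<le> (\<bar>L\<bar> + 1) * \<bar>y - x\<bar>" by (intro mult_right_mono) auto
    also have "\<dots> \<le> (\<bar>L\<bar> + 1) * (e / (\<bar>L\<bar> + 1))"
      using y(2) by (intro mult_left_mono) (auto simp: dist_real_def)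
    finally show ?thesis by (simp add: dist_real_def)
  qed
  then show "\<exists>d>0. \<forall>x'\<in>{0..1}. dist x' x < d \<longrightarrow> dist (B x') (B x) \<le> e"
    using e by (intro exI[of _ "e / (\<bar>L\<bar> + 1)"]) auto
qed

lemma le_L_tent:
  assumes "u \<in> {0..1}"
  shows "B u \<le> L * tent u"
proof -
  have "B u \<le> L * u" using lipschitz[OF assms, of 0] B_0 assms by (simp add: abs_le_iff)
  moreover have "B u \<le> L * (1 - u)" using lipschitz[OF assms, of 1] B_1 assms
      by (simp add: abs_le_iff)
  ultimately show ?thesis by (cases "u \<le> 1 - u") (simp_all add: tent_def)
qed

lemma L_nonneg: "0 \<le> L"
  using lipschitz[of 1 0] B_0 B_1 by simp

lemma tent_nonneg: "u \<in> {0..1} \<Longrightarrow> 0 \<le> tent u"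
  by (auto simp: tent_def)

lemma B_nonneg:
  assumes "u \<in> {0..1}"
  shows "0 \<le> B u"
proof -
  have "0 \<le> \<kappa> * tent u" using tent_nonneg[OF assms] \<kappa>_pos by simp
  with tent_le[OF assms] show ?thesis by linarith
qed

definition reduced :: "real \<Rightarrow> real \<Rightarrow> real"
  where "reduced \<epsilon> u = B u - \<epsilon> * tent u"

lemma continuous_on_reduced: "continuous_on {0..1} (reduced \<epsilon>)"
  unfolding reduced_def[abs_def] by (intro continuous_intros continuous_on_B continuous_on_tent)

lemma reduced_nonneg:
  assumes "u \<in> {0..1}" "\<epsilon> \<le> \<kappa>"
  shows "0 \<le> reduced \<epsilon> u"
  using tent_le[OF assms(1)] mult_right_mono[OF assms(2) tent_nonneg[OF assms(1)]]
  unfolding reduced_def by linarith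

lemma energy_eq_reduced_add:
  assumes "real_distribution M" "0 \<le> \<epsilon>" "\<epsilon> \<le> \<kappa>"
  shows "energy B M = energy (reduced \<epsilon>) M + ennreal \<epsilon> * energy tent M"
proof -
  have "energy B M = energy (\<lambda>u. reduced \<epsilon> u + \<epsilon> * tent u) M"
    by (simp add: reduced_def energy_def)
  also have "\<dots> = energy (reduced \<epsilon>) M + energy (\<lambda>u. \<epsilon> * tent u) M"
    using assms reduced_nonneg tent_nonneg
    by (intro energy_add continuous_on_reduced continuous_intros continuous_on_tent) auto
  also have "energy (\<lambda>u. \<epsilon> * tent u) M = ennreal \<epsilon> * energy tent M"
    using assms by (intro energy_cmult continuous_on_tent)
  finally show ?thesis .
qed

lemma energy_finite_if_moment:
  assumes "real_distribution M" "(\<integral>\<^sup>+x. ennreal \<bar>x\<bar> \<partial>M) < \<infinity>"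
  shows "energy B M < \<infinity>"
proof -
  have "energy B M \<le> energy (\<lambda>u. L * tent u) M" by (intro energy_mono assms le_L_tent)
  also have "\<dots> = ennreal L * energy tent M"
    using L_nonneg assms by (intro energy_cmult continuous_on_tent)
  also have "\<dots> \<le> ennreal L * (\<integral>\<^sup>+x. ennreal \<bar>x\<bar> \<partial>M)"
    by (intro mult_left_mono energy_tent_le_abs_moment assms) simp
  also have "\<dots> < \<infinity>" using assms(2) by (simp add: ennreal_mult_less_top)
  finally show ?thesis .
qed

lemma energy_empirical_finite:
  assumes n: "n \<ge> 1"
  shows "energy B (empirical n x) < \<infinity>"
proof (rule energy_finite_if_moment[OF real_distribution_empirical[OF n]])
  have "(\<integral>\<^sup>+t. ennreal \<bar>t\<bar> \<partial>empirical n x) = ennreal ((\<Sum>i=1..n. \<bar>x i\<bar>) / n)"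
    by (rule nn_integral_empirical[OF _ _ n]) auto
  then show "(\<integral>\<^sup>+t. ennreal \<bar>t\<bar> \<partial>empirical n x) < \<infinity>" by simp
qed

lemma energy_tent_finite:
  assumes M: "real_distribution M" and fin: "energy B M < \<infinity>"
  shows "energy tent M < \<infinity>"
proof -
  have "ennreal \<kappa> * energy tent M \<le> energy B M"
    using energy_eq_reduced_add[OF M, of \<kappa>] \<kappa>_pos by (simp add: add_increasing)
  then have "ennreal \<kappa> * energy tent M < \<infinity>" using fin by (rule le_less_trans)
  then show ?thesis using \<kappa>_pos by (auto simp: ennreal_mult_less_top)
qed

lemma exists_located:
  assumes M: "real_distribution M" and \<alpha>: "0 < \<alpha>" "\<alpha> < 1"
  shows "\<exists>l r. l \<le> 0 \<and> 0 \<le> r \<and> located \<alpha> l r M"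
proof -
  interpret real_distribution M by fact
  have "\<forall>\<^sub>F x in at_bot. cdf M x < \<alpha> \<and> x \<le> 0"
    using order_tendstoD(2)[OF cdf_lim_at_bot \<alpha>(1)] eventually_le_at_bot[of 0]
        by eventually_elim simp
  then obtain l where l: "cdf M l < \<alpha>" "l \<le> 0" by (auto dest: eventually_happens)
  have "\<forall>\<^sub>F x in at_top. \<alpha> < cdf M x \<and> 0 \<le> x"
    using order_tendstoD(1)[OF cdf_lim_at_top_prob \<alpha>(2)] eventually_ge_at_top[of 0]
        by eventually_elim simp
  then obtain r where r: "\<alpha> < cdf M r" "0 \<le> r" by (auto dest: eventually_happens)
  have "measure M {..<l} \<le> cdf M l" unfolding cdf_def by (intro finite_measure_mono) auto
  then show ?thesis using l r unfolding located_def by (intro exI[of _ l] exI[of _ r]) simp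
qed

lemma tent_pos: "0 < \<alpha> \<Longrightarrow> \<alpha> < 1 \<Longrightarrow> 0 < tent \<alpha>"
  by (simp add: tent_def)

lemma integrable_if_energy_finite:
  assumes M: "real_distribution M" and fin: "energy B M < \<infinity>"
  shows "integrable M (\<lambda>x. x)"
proof -
  interpret real_distribution M by fact
  obtain l r where lr: "l \<le> 0" "0 \<le> r" "located (1/2) l r M" using exists_located[OF M, of "1/2"]
      by auto
  have "ennreal (tent (1/2)) * (\<integral>\<^sup>+x. ennreal \<bar>x\<bar> \<partial>M) \<le> ennreal (tent (1/2) * (r - l))
      + energy tent M"
    by (rule abs_moment_le_energy_tent[OF M _ _ lr]) auto
  also have "\<dots> < \<infinity>" using energy_tent_finite[OF M fin] by simp
  finally have "(\<integral>\<^sup>+x. ennreal \<bar>x\<bar> \<partial>M) < \<infinity>" using tent_pos[of "1/2"]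
      by (auto simp: ennreal_mult_less_top)
  then show ?thesis by (intro integrableI_bounded) auto
qed

text \<open>The energy splits into the \<open>reduced\<close> part, which exceeds w, and \<epsilon>
  times the energy for \<open>tent\<close>. With m the first absolute moment, the latter is at least
  \<open>tent \<alpha> * (m - 1)\<close> because the window [0, 1] has length 1.\<close>

lemma energy_ge_abs_moment:
  assumes M: "real_distribution M" and fin: "energy B M < \<infinity>" and \<epsilon>: "0 \<le> \<epsilon>" "\<epsilon> \<le> \<kappa>"
    and \<alpha>: "0 < \<alpha>" "\<alpha> < 1" and loc: "located \<alpha> 0 1 M" and w: "ereal w
        < enn2ereal (energy (reduced \<epsilon>) M)"
  shows "w + \<epsilon> * tent \<alpha> * ((\<integral>x. \<bar>x\<bar> \<partial>M) - 1) \<le> enn2real (energy B M)"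
proof -
  interpret real_distribution M by fact
  have ix: "integrable M (\<lambda>x. x)" by (rule integrable_if_energy_finite[OF M fin])
  then have ia: "(\<integral>\<^sup>+x. ennreal \<bar>x\<bar> \<partial>M) = ennreal (\<integral>x. \<bar>x\<bar> \<partial>M)"
    by (intro nn_integral_eq_integral) auto
  obtain T where T: "0 \<le> T" "energy tent M = ennreal T"
    using energy_tent_finite[OF M fin] by (cases "energy tent M") auto
  obtain W where W: "0 \<le> W" "energy B M = ennreal W" using fin by (cases "energy B M") auto
  have eq: "ennreal W = energy (reduced \<epsilon>) M + ennreal (\<epsilon> * T)"
    using energy_eq_reduced_add[OF M \<epsilon>] T W \<epsilon> by (simp add: ennreal_mult)
  then obtain R where R: "0 \<le> R" "energy (reduced \<epsilon>) M = ennreal R"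
    by (cases "energy (reduced \<epsilon>) M") auto
  have WR: "W = R + \<epsilon> * T" using eq R W T \<epsilon> by (simp add: ennreal_plus[symmetric] del: ennreal_plus)
  have "w < R" using w R by (simp add: enn2ereal_ennreal)
  moreover have "tent \<alpha> * (\<integral>x. \<bar>x\<bar> \<partial>M) \<le> tent \<alpha> + T"
    using abs_moment_le_energy_tent[OF M \<alpha>, of 0 1] loc T tent_pos[OF \<alpha>]
    unfolding ia by (simp add: ennreal_mult[symmetric] ennreal_plus[symmetric] integral_nonneg_AE
        del: ennreal_plus)
  then have "\<epsilon> * (tent \<alpha> * (\<integral>x. \<bar>x\<bar> \<partial>M)) \<le> \<epsilon> * (tent \<alpha> + T)" using \<epsilon> by (intro mult_left_mono)
  ultimately show ?thesis using WR W by (simp add: algebra_simps)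
qed

definition free :: "real measure \<Rightarrow> ereal"
  where "free \<mu> = entropy_fun \<mu> + ereal c * enn2ereal (energy B \<mu>)"

text \<open>The value of the dual functional; by \<open>free_ge_dual\<close> and \<open>free_dual\<close> the supremum over
  the parameters is the free energy on located measures.\<close>

definition dual :: "real \<Rightarrow> real \<Rightarrow> (real \<Rightarrow> real) \<Rightarrow> real \<Rightarrow> real \<Rightarrow> real"
  where "dual \<alpha> \<epsilon> h w s = c * w + s - c * \<epsilon> * tent \<alpha>
    - ln (\<integral>x. exp (h x - c * \<epsilon> * tent \<alpha> * \<bar>x\<bar>) \<partial>lborel)"

text \<open>The moment bound for the energy and the Gibbs inequality for the entropy are used with
  the same rate \<open>c * \<epsilon> * tent \<alpha>\<close>, so that the first absolute moments
  cancel.\<close>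

lemma free_ge_dual:
  assumes M: "real_distribution M" and \<epsilon>: "0 < \<epsilon>" "\<epsilon> \<le> \<kappa>"
    and \<alpha>: "0 < \<alpha>" "\<alpha> < 1" and loc: "located \<alpha> 0 1 M"
    and h: "h \<in> borel_measurable borel" "\<And>x. \<bar>h x\<bar> \<le> k"
    and w: "ereal w < enn2ereal (energy (reduced \<epsilon>) M)" and s: "s < (\<integral>x. h x \<partial>M)"
  shows "ereal (dual \<alpha> \<epsilon> h w s) \<le> free M"
proof (cases "entropy_fun M = \<infinity>")
  case True
  have "ereal c * enn2ereal (energy B M) \<noteq> - \<infinity>" using c_pos by (cases "energy B M") auto
  then show ?thesis using True by (simp add: free_def)
next
  case False
  obtain p :: "real \<Rightarrow> real" where ent: "entropy_fun M = ereal (\<integral>x. p x * ln (p x) \<partial>lborel)"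
    using entropy_fun_finiteE[OF False] by metis
  show ?thesis
  proof (cases "energy B M < \<infinity>")
    case True
    have \<theta>: "0 < c * \<epsilon> * tent \<alpha>" using c_pos \<epsilon> tent_pos[OF \<alpha>] by simp
    obtain W where W: "0 \<le> W" "energy B M = ennreal W" using True by (cases "energy B M") auto
    have "w + \<epsilon> * tent \<alpha> * ((\<integral>x. \<bar>x\<bar> \<partial>M) - 1) \<le> W"
      using energy_ge_abs_moment[OF M True _ _ \<alpha> loc w] \<epsilon> W by simp
    then have "c * (w + \<epsilon> * tent \<alpha> * ((\<integral>x. \<bar>x\<bar> \<partial>M) - 1)) \<le> c * W" using c_pos by simp
    moreover have "ereal ((\<integral>x. h x \<partial>M) - c * \<epsilon> * tent \<alpha> * (\<integral>x. \<bar>x\<bar> \<partial>M)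
        - ln (\<integral>x. exp (h x - c * \<epsilon> * tent \<alpha> * \<bar>x\<bar>) \<partial>lborel)) \<le> entropy_fun M"
      by (rule entropy_fun_ge[OF M \<theta> h])
    ultimately show ?thesis
      using s W unfolding free_def dual_def ent by (simp add: enn2ereal_ennreal algebra_simps)
  next
    case False
    then have "energy B M = \<infinity>" by (cases "energy B M") auto
    then show ?thesis using c_pos ent by (simp add: free_def)
  qed
qed

text \<open>Letting \<epsilon> be small recovers the whole energy and a nearly optimal h the
  entropy; the strict thresholds w and s are set slightly below the actual values.\<close>

lemma free_dual:
  assumes M: "real_distribution M" and a: "ereal a < free M" and \<alpha>: "0 < \<alpha>" "\<alpha> < 1"
  shows "\<exists>\<epsilon> h k w s. 0 < \<epsilon> \<and> \<epsilon> \<le> \<kappa> \<and> (\<forall>x. isCont h x) \<and> (\<forall>x. \<bar>h x\<bar> \<le> k) \<and>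
    ereal w < enn2ereal (energy (reduced \<epsilon>) M) \<and> s < (\<integral>x. h x \<partial>M) \<and> a < dual \<alpha> \<epsilon> h w s"
proof (cases "energy B M < \<infinity>")
  case False
  then have inf: "energy B M = \<infinity>" by (cases "energy B M") auto
  \<comment> \<open>As \<open>\<kappa> * tent\<close> is below \<open>B\<close>,
    \<open>reduced (\<kappa>/2)\<close> is at least half of \<open>B\<close>; its energy is infinite
    too and every real w is admissible.\<close>
  have "energy (\<lambda>u. (1/2) * B u) M \<le> energy (reduced (\<kappa>/2)) M"
    using tent_le by (intro energy_mono M) (auto simp: reduced_def field_simps)
  moreover have "energy (\<lambda>u. (1/2) * B u) M = \<infinity>"
    using inf by (subst energy_cmult[OF M continuous_on_B]) (auto simp: ennreal_mult_top)
  ultimately have "energy (reduced (\<kappa>/2)) M = \<infinity>" by (simp add: top_unique)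
  then have "ereal w < enn2ereal (energy (reduced (\<kappa>/2)) M)" for w by simp
  \<comment> \<open>\<open>dual\<close> is affine in w with slope c, so w is solved for from the
    target value a + 1. The threshold -1 is strictly below the mean of the zero function.\<close>
  moreover define w where "w = (a - dual \<alpha> (\<kappa>/2) (\<lambda>_. 0) 0 (-1) + 1) / c"
  have "dual \<alpha> (\<kappa>/2) (\<lambda>_. 0) w (-1) = a + 1"
    using c_pos by (simp add: dual_def w_def)
  ultimately show ?thesis using \<kappa>_pos
    by (intro exI[of _ "\<kappa>/2"] exI[of _ "\<lambda>_. 0"] exI[of _ 0] exI[of _ w] exI[of _ "-1"]) auto
next
  case True
  obtain W where W: "0 \<le> W" "energy B M = ennreal W" using True by (cases "energy B M") auto
  obtain T where T: "0 \<le> T" "energy tent M = ennreal T"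
    using energy_tent_finite[OF M True] by (cases "energy tent M") auto
  have "ereal (a - c * W) < entropy_fun M"
    using a W by (cases "entropy_fun M") (auto simp: free_def enn2ereal_ennreal)
  then obtain b where b: "a - c * W < b" "ereal b < entropy_fun M"
    using ereal_dense2 by (metis less_ereal.simps(1))
  define \<delta> where "\<delta> = b - (a - c * W)"
  have \<delta>: "0 < \<delta>" using b by (simp add: \<delta>_def)
  \<comment> \<open>With \<open>T\<close> the energy for \<open>tent\<close>, the losses
    \<open>c * \<epsilon> * T\<close> and \<open>c * \<epsilon> * tent \<alpha>\<close> together are
    at most \<delta> / 4. The offsets of w and s cost another quarter each, so a quarter of \<delta>
    is left.\<close>
  define \<epsilon> where "\<epsilon> = min \<kappa> (\<delta> / (4 * c * (T + 1)))"
  have \<epsilon>: "0 < \<epsilon>" "\<epsilon> \<le> \<kappa>" using \<kappa>_pos \<delta> c_pos T by (auto simp: \<epsilon>_def)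
  have "\<epsilon> * (4 * c * (T + 1)) \<le> \<delta> / (4 * c * (T + 1)) * (4 * c * (T + 1))"
    using c_pos T by (intro mult_right_mono) (auto simp: \<epsilon>_def)
  then have \<epsilon>T: "c * \<epsilon> * (T + 1) \<le> \<delta> / 4" using c_pos T by (simp add: mult_ac)
  have "c * \<epsilon> * tent \<alpha> \<le> c * \<epsilon> * 1"
    using c_pos \<epsilon> \<alpha> by (intro mult_left_mono) (auto simp: tent_def)
  with \<epsilon>T have small: "c * \<epsilon> * T + c * \<epsilon> * tent \<alpha> \<le> \<delta> / 4" by (simp add: distrib_left)
  have "ennreal W = energy (reduced \<epsilon>) M + ennreal (\<epsilon> * T)"
    using energy_eq_reduced_add[OF M, of \<epsilon>] T W \<epsilon> by (simp add: ennreal_mult)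
  then obtain R where R: "0 \<le> R" "energy (reduced \<epsilon>) M = ennreal R" "ennreal W = ennreal R
      + ennreal (\<epsilon> * T)"
    by (cases "energy (reduced \<epsilon>) M") auto
  have WR: "W = R + \<epsilon> * T" using R W T \<epsilon> by (simp add: ennreal_plus[symmetric] del: ennreal_plus)
  have \<theta>: "0 < c * \<epsilon> * tent \<alpha>" using c_pos \<epsilon> tent_pos[OF \<alpha>] by simp
  obtain h k where h: "\<And>x. isCont h x" "\<And>x. \<bar>h x\<bar> \<le> k"
    "b < (\<integral>x. h x \<partial>M) - ln (\<integral>x. exp (h x - c * \<epsilon> * tent \<alpha> * \<bar>x\<bar>) \<partial>lborel)"
    using entropy_dual[OF M \<theta> integrable_if_energy_finite[OF M True] b(2)] by blast
  define w where "w = R - \<delta> / (4 * c)"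
  define s where "s = (\<integral>x. h x \<partial>M) - \<delta> / 4"
  have cw: "c * w = c * W - c * \<epsilon> * T - \<delta> / 4" using c_pos by (simp add: w_def WR field_simps)
  have "a < dual \<alpha> \<epsilon> h w s"
  proof -
    define X where "X = ln (\<integral>x. exp (h x - c * \<epsilon> * tent \<alpha> * \<bar>x\<bar>) \<partial>lborel)"
    define Y where "Y = c * \<epsilon> * T"
    define Z where "Z = c * \<epsilon> * tent \<alpha>"
    have "b < (\<integral>x. h x \<partial>M) - X" "Y + Z \<le> \<delta> / 4" "b = a - c * W + \<delta>"
      using h(3) small by (simp_all only: X_def Y_def Z_def \<delta>_def)
    moreover have "dual \<alpha> \<epsilon> h w s = c * W - Y - \<delta> / 4 + s - Z - X"
      unfolding dual_def cw X_def Y_def Z_def ..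
    ultimately show ?thesis using \<delta> unfolding s_def by linarith
  qed
  moreover have "ereal w < enn2ereal (energy (reduced \<epsilon>) M)"
    using R \<delta> c_pos by (simp add: w_def enn2ereal_ennreal)
  moreover have "s < (\<integral>x. h x \<partial>M)" using \<delta> by (simp add: s_def)
  ultimately show ?thesis using \<epsilon> h(1,2) by blast
qed

lemma openin_reduced_gt: "openin weak_topology {\<nu> \<in> prob_measures. ereal w
    < enn2ereal (energy (reduced \<epsilon>) \<nu>)}"
proof (cases "w < 0")
  case True
  then have "{\<nu> \<in> prob_measures. ereal w < enn2ereal (energy (reduced \<epsilon>) \<nu>)} = prob_measures"
    by (auto intro!: less_le_trans[OF _ enn2ereal_nonneg])
  then show ?thesis using openin_topspace[of weak_topology] by (simp add: topspace_weak_topology)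
next
  case False
  then have "ereal w < enn2ereal y \<longleftrightarrow> ennreal w < y" for y
    by (simp add: less_ennreal.rep_eq enn2ereal_ennreal)
  then show ?thesis using openin_energy_gt[OF continuous_on_reduced, of "ennreal w"] by simp
qed

end

lemma sets_PiM_lborel: "sets (\<Pi>\<^sub>M i\<in>I. (lborel :: real measure)) = sets (\<Pi>\<^sub>M i\<in>I. borel)"
  by (rule sets_PiM_cong) auto

lemma openin_in_sets_borel_of: "openin X U \<Longrightarrow> U \<in> sets (borel_of X)"
  unfolding borel_of_def using openin_subset
  by (subst sets_measure_of) (auto intro!: sigma_sets.Basic)

lemma closedin_in_sets_borel_of:
  assumes "closedin X C"
  shows "C \<in> sets (borel_of X)"
proof -
  have sp: "space (borel_of X) = topspace X" unfolding borel_of_def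
      by (simp add: space_measure_of_conv)
  have "topspace X - C \<in> sets (borel_of X)"
    using assms by (intro openin_in_sets_borel_of) (simp add: closedin_def)
  then have "space (borel_of X) - (topspace X - C) \<in> sets (borel_of X)" by (rule sets.compl_sets)
  moreover have "space (borel_of X) - (topspace X - C) = C"
    using assms by (auto simp: sp closedin_def)
  ultimately show ?thesis by simp
qed

section \<open>Tilting and covering bounds for the unnormalised Gibbs mass\<close>

context rank_energy
begin

text \<open>Half-open version of \<open>located \<alpha> 0 1\<close>: it implies the closed
  condition, and it meets each translation orbit in shifts of total length exactly one.\<close>

definition loc_set :: "real \<Rightarrow> nat \<Rightarrow> (nat \<Rightarrow> real) set"
  where "loc_set \<alpha> n = {x. cdf (empirical n x) 0 < \<alpha> \<and> \<alpha> \<le> cdf (empirical n x) 1}"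

definition weight :: "nat \<Rightarrow> (nat \<Rightarrow> real) \<Rightarrow> ennreal"
  where "weight n x = ennreal (exp (- (c * n) * enn2real (energy B (empirical n x))))"

definition mass :: "real \<Rightarrow> nat \<Rightarrow> real measure set \<Rightarrow> ennreal"
  where "mass \<alpha> n U = (\<integral>\<^sup>+x. weight n x * indicator {x. empirical n x \<in> U} x
      * indicator (loc_set \<alpha> n) x
    \<partial>(\<Pi>\<^sub>M i\<in>{1..n}. lborel))"

lemma measurable_weight: "n \<ge> 1 \<Longrightarrow> weight n \<in> borel_measurable (\<Pi>\<^sub>M i\<in>{1..n}. borel)"
  unfolding weight_def[abs_def] using measurable_energy_empirical[OF continuous_on_B] by measurable

lemma measurable_indicator_loc_set:
  "(\<lambda>x. indicator (loc_set \<alpha> n) x :: ennreal) \<in> borel_measurable (\<Pi>\<^sub>M i\<in>{1..n}. borel)"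
proof -
  have "(\<lambda>x. if cdf (empirical n x) 0 < \<alpha> \<and> \<alpha> \<le> cdf (empirical n x) 1 then 1 else 0 :: ennreal)
      \<in> borel_measurable (\<Pi>\<^sub>M i\<in>{1..n}. borel)" by measurable
  then show ?thesis by (simp add: loc_set_def indicator_def of_bool_def cong: if_cong)
qed

lemma measurable_indicator_empirical:
  assumes n: "n \<ge> 1" and U: "U \<in> sets (borel_of weak_topology)"
  shows "(\<lambda>x. indicator {x. empirical n x \<in> U} x :: ennreal)
      \<in> borel_measurable (\<Pi>\<^sub>M i\<in>{1..n}. borel)"
  using measurable_compose[OF measurable_empirical[OF n] borel_measurable_indicator[OF U]]
  by (simp add: indicator_def)

lemma measurable_mass_integrand:
  assumes n: "n \<ge> 1" and U: "U \<in> sets (borel_of weak_topology)"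
  shows "(\<lambda>x. weight n x * indicator {x. empirical n x \<in> U} x * indicator (loc_set \<alpha> n) x)
    \<in> borel_measurable (\<Pi>\<^sub>M i\<in>{1..n}. lborel)"
  unfolding measurable_cong_sets[OF sets_PiM_lborel refl]
  by (intro borel_measurable_times_ennreal measurable_weight n measurable_indicator_loc_set
      measurable_indicator_empirical U)

lemma mass_Un_le:
  assumes n: "n \<ge> 1" and fin: "finite F" and U: "U \<in> sets (borel_of weak_topology)"
    "\<And>\<mu>. \<mu> \<in> F \<Longrightarrow> G \<mu> \<in> sets (borel_of weak_topology)"
    and sub: "\<And>x. x \<in> loc_set \<alpha> n \<Longrightarrow> empirical n x \<in> V \<Longrightarrow> empirical n x \<in> U \<union> (\<Union>\<mu>\<in>F. G \<mu>)"
  shows "mass \<alpha> n V \<le> mass \<alpha> n U + (\<Sum>\<mu>\<in>F. mass \<alpha> n (G \<mu>))"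
proof -
  have "mass \<alpha> n V \<le> (\<integral>\<^sup>+x. weight n x * indicator {x. empirical n x \<in> U} x
      * indicator (loc_set \<alpha> n) x
      + (\<Sum>\<mu>\<in>F. weight n x * indicator {x. empirical n x \<in> G \<mu>} x * indicator (loc_set \<alpha> n) x)
          \<partial>(\<Pi>\<^sub>M i\<in>{1..n}. lborel))"
    unfolding mass_def
  proof (rule nn_integral_mono)
    fix x
    show "weight n x * indicator {x. empirical n x \<in> V} x * indicator (loc_set \<alpha> n) x
      \<le> weight n x * indicator {x. empirical n x \<in> U} x * indicator (loc_set \<alpha> n) x
      + (\<Sum>\<mu>\<in>F. weight n x * indicator {x. empirical n x \<in> G \<mu>} x * indicator (loc_set \<alpha> n) x)"
    proof (cases "x \<in> loc_set \<alpha> n \<and> empirical n x \<in> V")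
      case True
      with sub consider "empirical n x \<in> U" | \<mu> where "\<mu> \<in> F" "empirical n x \<in> G \<mu>" by blast
      then show ?thesis
      proof cases
        case 1
        then show ?thesis using True by (simp add: add_increasing2)
      next
        case 2
        have "weight n x * indicator {x. empirical n x \<in> G \<mu>} x * indicator (loc_set \<alpha> n) x
          \<le> (\<Sum>\<mu>\<in>F. weight n x * indicator {x. empirical n x \<in> G \<mu>} x * indicator (loc_set \<alpha> n) x)"
          using 2 fin by (intro member_le_sum) auto
        then show ?thesis using True 2 by (simp add: add_increasing)
      qed
    qed (auto simp: indicator_def)
  qed
  also have "\<dots> = mass \<alpha> n U + (\<Sum>\<mu>\<in>F. mass \<alpha> n (G \<mu>))"
  proof -
    define f where "f V x = weight n x * indicator {x. empirical n x \<in> V} x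
        * indicator (loc_set \<alpha> n) x" for V x
    have f: "f U \<in> borel_measurable (\<Pi>\<^sub>M i\<in>{1..n}. lborel)"
      "\<And>\<mu>. \<mu> \<in> F \<Longrightarrow> f (G \<mu>) \<in> borel_measurable (\<Pi>\<^sub>M i\<in>{1..n}. lborel)"
      unfolding f_def using measurable_mass_integrand[OF n] U by blast+
    show ?thesis
      unfolding mass_def f_def[symmetric] using f
      by (subst nn_integral_add) (auto intro!: borel_measurable_sum nn_integral_sum simp del:
          One_nat_def)
  qed
  finally show ?thesis .
qed

text \<open>Strict lower bounds for a lower semicontinuous and for a continuous functional, hence
  weakly open when h is bounded and continuous. On such a set the weight can be tilted by h at a
  cost known in advance.\<close>

definition nbhd :: "real \<Rightarrow> (real \<Rightarrow> real) \<Rightarrow> real \<Rightarrow> real \<Rightarrow> real measure set"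
  where "nbhd \<epsilon> h w s = {\<nu> \<in> prob_measures. ereal w < enn2ereal (energy (reduced \<epsilon>) \<nu>) \<and> s
      < integral\<^sup>L \<nu> h}"

lemma openin_nbhd:
  assumes "\<And>x. isCont h x" "\<And>x. \<bar>h x\<bar> \<le> k"
  shows "openin weak_topology (nbhd \<epsilon> h w s)"
proof -
  have "nbhd \<epsilon> h w s = {\<nu> \<in> prob_measures. ereal w < enn2ereal (energy (reduced \<epsilon>) \<nu>)} \<inter> {\<nu>
      \<in> prob_measures. s < integral\<^sup>L \<nu> h}"
    by (auto simp: nbhd_def)
  then show ?thesis using openin_reduced_gt openin_integral_gt[OF assms] by (simp add: openin_Int)
qed

text \<open>Exponential Chebyshev bound: on the neighbourhood the weight is at most
  \<open>?C\<close> times a product over the particles, and this product integrates to the n-th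
  power of a single integral.\<close>

lemma mass_nbhd_le:
  assumes n: "n \<ge> 1" and \<epsilon>: "0 < \<epsilon>" "\<epsilon> \<le> \<kappa>" and \<alpha>: "0 < \<alpha>" "\<alpha> < 1"
    and h[measurable]: "h \<in> borel_measurable borel" and k: "\<And>x. \<bar>h x\<bar> \<le> k"
  shows "mass \<alpha> n (nbhd \<epsilon> h w s) \<le> ennreal (exp (- real n * dual \<alpha> \<epsilon> h w s))"
proof -
  interpret product_sigma_finite "\<lambda>_. lborel :: real measure" ..
  define \<theta> where "\<theta> = c * \<epsilon> * tent \<alpha>"
  have \<theta>: "0 < \<theta>" using c_pos \<epsilon> tent_pos[OF \<alpha>] by (simp add: \<theta>_def)
  define \<Lambda> where "\<Lambda> = (\<integral>x. exp (h x - \<theta> * \<bar>x\<bar>) \<partial>lborel)"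
  have \<Lambda>: "0 < \<Lambda>" unfolding \<Lambda>_def by (rule exp_weight_pos[OF \<theta> h k])
  have \<Lambda>': "(\<integral>\<^sup>+x. ennreal (exp (h x - \<theta> * \<bar>x\<bar>)) \<partial>lborel) = ennreal \<Lambda>"
    unfolding \<Lambda>_def by (rule nn_integral_eq_integral[OF integrable_exp_weight[OF \<theta> h k]]) simp
  let ?C = "exp (- real n * (c * w + s - \<theta>))"
  have "mass \<alpha> n (nbhd \<epsilon> h w s) \<le> (\<integral>\<^sup>+x. ennreal ?C * (\<Prod>i=1..n. ennreal (exp (h (x i) - \<theta> * \<bar>x i\<bar>)))
      \<partial>(\<Pi>\<^sub>M i\<in>{1..n}. lborel))"
    unfolding mass_def
  proof (rule nn_integral_mono)
    fix x
    show "weight n x * indicator {x. empirical n x \<in> nbhd \<epsilon> h w s} x * indicator (loc_set \<alpha> n) x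
      \<le> ennreal ?C * (\<Prod>i=1..n. ennreal (exp (h (x i) - \<theta> * \<bar>x i\<bar>)))"
    proof (cases "empirical n x \<in> nbhd \<epsilon> h w s \<and> x \<in> loc_set \<alpha> n")
      case True
      let ?M = "empirical n x"
      have M: "real_distribution ?M" by (rule real_distribution_empirical[OF n])
      interpret M: real_distribution ?M by (rule M)
      have "measure ?M {..<0} \<le> cdf ?M 0" unfolding cdf_def by (intro M.finite_measure_mono) auto
      with True have loc: "located \<alpha> 0 1 ?M" by (simp add: loc_set_def located_def)
      let ?A = "(\<Sum>i=1..n. \<bar>x i\<bar>)" and ?H = "(\<Sum>i=1..n. h (x i))"
      define E where "E = enn2real (energy B ?M)"
      have "w + \<epsilon> * tent \<alpha> * ((\<integral>t. \<bar>t\<bar> \<partial>?M) - 1) \<le> E"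
        unfolding E_def using True \<epsilon>
        by (intro energy_ge_abs_moment[OF M energy_empirical_finite[OF n] _ _ \<alpha> loc]) (auto simp:
            nbhd_def)
      then have "w + \<epsilon> * tent \<alpha> * (?A / n - 1) \<le> E"
        by (simp add: integral_empirical)
      then have "(c * n) * (w + \<epsilon> * tent \<alpha> * (?A / n - 1)) \<le> (c * n) * E"
        using c_pos by (intro mult_left_mono) auto
      moreover have "(c * n) * (w + \<epsilon> * tent \<alpha> * (?A / n - 1)) = n * (c * w) + \<theta> * ?A - n * \<theta>"
        using n by (simp add: \<theta>_def field_simps)
      \<comment> \<open>The tilt: the sum of h over the particles is at least n s, so it may be
        added to the exponent if n s is subtracted.\<close>
      moreover have "n * s \<le> ?H"
        using True n by (simp add: nbhd_def integral_empirical field_simps)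
      ultimately have "- (c * n) * E \<le> - real n * (c * w + s - \<theta>) + (?H - \<theta> * ?A)"
        by (simp add: algebra_simps)
      then have "exp (- (c * n) * E) \<le> ?C * exp (?H - \<theta> * ?A)"
        unfolding exp_add[symmetric] by simp
      also have "exp (?H - \<theta> * ?A) = (\<Prod>i=1..n. exp (h (x i) - \<theta> * \<bar>x i\<bar>))"
        by (simp add: exp_sum[symmetric] sum_subtractf sum_distrib_left)
      finally have "ennreal (exp (- (c * n) * E)) \<le> ennreal (?C * (\<Prod>i=1..n. exp (h (x i) - \<theta>
          * \<bar>x i\<bar>)))"
        by (rule ennreal_leI)
      also have "\<dots> = ennreal ?C * (\<Prod>i=1..n. ennreal (exp (h (x i) - \<theta> * \<bar>x i\<bar>)))"
        by (simp add: ennreal_mult prod_ennreal prod_nonneg)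
      finally show ?thesis using True by (simp add: weight_def E_def)
    qed (auto simp: indicator_def)
  qed
  also have "\<dots> = ennreal ?C * (\<integral>\<^sup>+x. (\<Prod>i=1..n. ennreal (exp (h (x i) - \<theta> * \<bar>x i\<bar>)))
      \<partial>(\<Pi>\<^sub>M i\<in>{1..n}. lborel))"
    by (rule nn_integral_cmult) measurable
  also have "(\<integral>\<^sup>+x. (\<Prod>i=1..n. ennreal (exp (h (x i) - \<theta> * \<bar>x i\<bar>))) \<partial>(\<Pi>\<^sub>M i\<in>{1..n}. lborel))
      = (\<Prod>i=1..n. \<integral>\<^sup>+x. ennreal (exp (h x - \<theta> * \<bar>x\<bar>)) \<partial>lborel)"
    by (rule product_nn_integral_prod) auto
  also have "\<dots> = ennreal (\<Lambda> ^ n)" using \<Lambda> by (simp add: \<Lambda>' ennreal_power)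
  also have "ennreal ?C * \<dots> = ennreal (?C * \<Lambda> ^ n)" by (simp add: ennreal_mult')
  also have "\<Lambda> ^ n = exp (n * ln \<Lambda>)" using \<Lambda> by (simp add: exp_of_nat_mult)
  also have "?C * \<dots> = exp (- real n * dual \<alpha> \<epsilon> h w s)"
    unfolding exp_add[symmetric] by (simp add: dual_def \<Lambda>_def \<theta>_def algebra_simps)
  finally show ?thesis .
qed

text \<open>Substitute for exponential tightness. A large w raises the dual value above a, while
  outside the set the reduced energy is at most w and, \<open>reduced (\<kappa>/2)\<close> being at
  least half of \<open>B\<close>, the energy at most 2 w.\<close>

lemma exists_tail_nbhd:
  shows "\<exists>\<epsilon> w. 0 < \<epsilon> \<and> \<epsilon> \<le> \<kappa> \<and> a < dual \<alpha> \<epsilon> (\<lambda>_. 0) w (-1) \<and>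
    (\<forall>\<nu>\<in>prob_measures. \<nu> \<notin> nbhd \<epsilon> (\<lambda>_. 0) w (-1) \<longrightarrow> energy B \<nu> \<le> ennreal (2 * w))"
proof -
  define w where "w = (\<bar>a - dual \<alpha> (\<kappa>/2) (\<lambda>_. 0) 0 (-1)\<bar> + 1) / c"
  have w: "0 < w" "a < dual \<alpha> (\<kappa>/2) (\<lambda>_. 0) w (-1)"
    using c_pos by (auto simp: dual_def w_def add_nonneg_pos)
  have "energy B \<nu> \<le> ennreal (2 * w)" if \<nu>: "\<nu> \<in> prob_measures" "\<nu> \<notin> nbhd (\<kappa>/2) (\<lambda>_. 0) w (-1)"
      for \<nu>
  proof -
    have d: "real_distribution \<nu>" using \<nu> prob_measures_iff_real_distribution by blast
    have "ennreal (1/2) * energy B \<nu> = energy (\<lambda>u. (1/2) * B u) \<nu>"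
      by (rule energy_cmult[OF d continuous_on_B, symmetric]) simp
    also have "\<dots> \<le> energy (reduced (\<kappa>/2)) \<nu>"
      using tent_le by (intro energy_mono d) (auto simp: reduced_def field_simps)
    also have "\<dots> \<le> ennreal w"
      using \<nu> w by (simp add: nbhd_def less_eq_ennreal.rep_eq enn2ereal_ennreal not_less)
    finally have le: "ennreal (1/2) * energy B \<nu> \<le> ennreal w" .
    show ?thesis
    proof (cases "energy B \<nu>")
      case (real r)
      have "ennreal (1/2 * r) = ennreal (1/2) * ennreal r" by (rule ennreal_mult) (use real in auto)
      then have "ennreal (1/2 * r) \<le> ennreal w" using le real by simp
      then have "1/2 * r \<le> w" using w by (subst (asm) ennreal_le_iff) auto
      then show ?thesis using real by (simp add: ennreal_leI)
    next
      case top
      then show ?thesis using le by (simp add: ennreal_mult_top top_unique)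
    qed
  qed
  then show ?thesis using w \<kappa>_pos by (intro exI[of _ "\<kappa>/2"] exI[of _ w]) auto
qed

text \<open>\<open>V\<close> is only closed. The tail neighbourhood absorbs the configurations of
  large energy; the remaining located measures form a compact set, which is covered by finitely many
  neighbourhoods from \<open>free_dual\<close>. The constant counts the sets used.\<close>

lemma mass_closed_le:
  assumes V: "closedin weak_topology V" and \<alpha>: "0 < \<alpha>" "\<alpha> < 1"
    and a: "\<And>\<mu>. \<mu> \<in> V \<Longrightarrow> ereal a < free \<mu>"
  shows "\<exists>C\<ge>0. \<forall>n\<ge>1. mass \<alpha> n V \<le> ennreal (C * exp (- real n * a))"
proof -
  obtain \<epsilon>0 w0 where t: "0 < \<epsilon>0" "\<epsilon>0 \<le> \<kappa>" "a < dual \<alpha> \<epsilon>0 (\<lambda>_. 0) w0 (-1)"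
    "\<And>\<nu>. \<nu> \<in> prob_measures \<Longrightarrow> \<nu> \<notin> nbhd \<epsilon>0 (\<lambda>_. 0) w0 (-1) \<Longrightarrow> energy B \<nu> \<le> ennreal (2 * w0)"
    using exists_tail_nbhd[of a \<alpha>] by blast
  define U0 where "U0 = nbhd \<epsilon>0 (\<lambda>_. 0) w0 (-1)"
  have U0: "openin weak_topology U0" unfolding U0_def by (rule openin_nbhd[of _ 0]) auto
  have m: "mass \<alpha> n (nbhd \<epsilon> h w s) \<le> ennreal (exp (- real n * a))"
    if n: "n \<ge> 1" and "0 < \<epsilon>" "\<epsilon> \<le> \<kappa>" "\<And>x. isCont h x" "\<And>x. \<bar>h x\<bar> \<le> k" "a < dual \<alpha> \<epsilon> h w s"
        for n \<epsilon> h k w s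
  proof -
    have "h \<in> borel_measurable borel"
      using that by (intro borel_measurable_continuous_onI continuous_at_imp_continuous_on) auto
    then have "mass \<alpha> n (nbhd \<epsilon> h w s) \<le> ennreal (exp (- real n * dual \<alpha> \<epsilon> h w s))"
      using that by (intro mass_nbhd_le \<alpha>)
    also have "\<dots> \<le> ennreal (exp (- real n * a))" using that by (intro ennreal_leI) auto
    finally show ?thesis .
  qed
  let ?K = "{\<nu> \<in> prob_measures. energy B \<nu> \<le> ennreal (2 * w0) \<and> located \<alpha> 0 1 \<nu>}"
  have "compactin weak_topology ?K"
    by (rule compactin_energy_sublevel[OF \<alpha> continuous_on_B \<kappa>_pos tent_le])
  then have K: "compactin weak_topology (V \<inter> ?K)" by (rule closed_Int_compactin[OF V])
  have "\<exists>U. openin weak_topology U \<and> \<mu> \<in> U \<and> (\<forall>n\<ge>1. mass \<alpha> n U \<le> ennreal (exp (- real n * a)))"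
      if \<mu>: "\<mu> \<in> V \<inter> ?K" for \<mu>
  proof -
    have d: "real_distribution \<mu>" using \<mu> prob_measures_iff_real_distribution by blast
    obtain \<epsilon> h k w s where p: "0 < \<epsilon>" "\<epsilon> \<le> \<kappa>" "\<And>x. isCont h x" "\<And>x. \<bar>h x\<bar> \<le> k"
      "ereal w < enn2ereal (energy (reduced \<epsilon>) \<mu>)" "s < (\<integral>x. h x \<partial>\<mu>)" "a < dual \<alpha> \<epsilon> h w s"
      using free_dual[OF d a \<alpha>] \<mu> by blast
    have "\<mu> \<in> nbhd \<epsilon> h w s" using p \<mu> by (simp add: nbhd_def)
    then show ?thesis using openin_nbhd[OF p(3,4)] m[OF _ p(1-4,7)] by blast
  qed
  then have "\<forall>\<mu>\<in>V \<inter> ?K. \<exists>U. openin weak_topology U \<and> \<mu> \<in> U \<and> (\<forall>n\<ge>1. mass \<alpha> n U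
      \<le> ennreal (exp (- real n * a)))"
    by (intro ballI)
  from bchoice[OF this] obtain U where
    "\<forall>\<mu>\<in>V \<inter> ?K. openin weak_topology (U \<mu>) \<and> \<mu> \<in> U \<mu> \<and> (\<forall>n\<ge>1. mass \<alpha> n (U \<mu>)
        \<le> ennreal (exp (- real n * a)))" ..
  then have U: "\<And>\<mu>. \<mu> \<in> V \<inter> ?K \<Longrightarrow> openin weak_topology (U \<mu>)" "\<And>\<mu>. \<mu> \<in> V \<inter> ?K \<Longrightarrow> \<mu> \<in> U \<mu>"
    "\<And>\<mu> n. \<mu> \<in> V \<inter> ?K \<Longrightarrow> n \<ge> 1 \<Longrightarrow> mass \<alpha> n (U \<mu>) \<le> ennreal (exp (- real n * a))"
    by blast+
  have "\<exists>\<F>. finite \<F> \<and> \<F> \<subseteq> U ` (V \<inter> ?K) \<and> V \<inter> ?K \<subseteq> \<Union>\<F>"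
    using U by (intro compactinD[OF K]) auto
  then obtain \<F> where \<F>: "finite \<F>" "\<F> \<subseteq> U ` (V \<inter> ?K)" "V \<inter> ?K \<subseteq> \<Union>\<F>" by blast
  from finite_subset_image[OF \<F>(1,2)] obtain F where F: "finite F" "F \<subseteq> V \<inter> ?K" "\<F> = U ` F" by blast
  with \<F>(3) have cover: "V \<inter> ?K \<subseteq> (\<Union>\<mu>\<in>F. U \<mu>)" by simp
  have "mass \<alpha> n V \<le> ennreal ((1 + real (card F)) * exp (- real n * a))" if n: "n \<ge> 1" for n
  proof -
    have "mass \<alpha> n V \<le> mass \<alpha> n U0 + (\<Sum>\<mu>\<in>F. mass \<alpha> n (U \<mu>))"
    proof (rule mass_Un_le[OF n F(1) openin_in_sets_borel_of[OF U0]])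
      show "U \<mu> \<in> sets (borel_of weak_topology)" if "\<mu> \<in> F" for \<mu>
        by (rule openin_in_sets_borel_of[OF U(1)[OF subsetD[OF F(2) that]]])
      fix x assume x: "x \<in> loc_set \<alpha> n" "empirical n x \<in> V"
      have d: "real_distribution (empirical n x)" by (rule real_distribution_empirical[OF n])
      interpret real_distribution "empirical n x" by (rule d)
      have "measure (empirical n x) {..<0} \<le> cdf (empirical n x) 0"
        unfolding cdf_def by (intro finite_measure_mono) auto
      with x have "located \<alpha> 0 1 (empirical n x)" by (simp add: loc_set_def located_def)
      then show "empirical n x \<in> U0 \<union> (\<Union>\<mu>\<in>F. U \<mu>)"
        using t(4)[of "empirical n x"] d x cover
            unfolding U0_def prob_measures_iff_real_distribution[symmetric] by blast
    qed
    also have "\<dots> \<le> ennreal (exp (- real n * a)) + (\<Sum>\<mu>\<in>F. ennreal (exp (- real n * a)))"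
      unfolding U0_def using t by (intro add_mono sum_mono U(3)[OF subsetD[OF F(2)] n] m[of n _ _ 0]
          n) auto
    also have "\<dots> = ennreal ((1 + real (card F)) * exp (- real n * a))"
      by (simp add: ennreal_mult[symmetric] ennreal_plus[symmetric] ennreal_of_nat_eq_real_of_nat
          algebra_simps del: ennreal_plus)
    finally show ?thesis .
  qed
  then show ?thesis by (intro exI[of _ "1 + real (card F)"]) auto
qed

text \<open>By the two duality inequalities, weakly open neighbourhoods cover the measures with free
  energy above a and contain no located measure below that level. The sublevel is what they leave of
  a compact energy sublevel.\<close>

lemma compactin_free_sublevel:
  assumes \<alpha>: "0 < \<alpha>" "\<alpha> < 1"
  shows "compactin weak_topology {\<nu> \<in> prob_measures. free \<nu> \<le> ereal a \<and> located \<alpha> 0 1 \<nu>}"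
    (is "compactin _ ?S")
proof -
  obtain \<epsilon>0 w0 where t: "0 < \<epsilon>0" "\<epsilon>0 \<le> \<kappa>" "a < dual \<alpha> \<epsilon>0 (\<lambda>_. 0) w0 (-1)"
    "\<And>\<nu>. \<nu> \<in> prob_measures \<Longrightarrow> \<nu> \<notin> nbhd \<epsilon>0 (\<lambda>_. 0) w0 (-1) \<Longrightarrow> energy B \<nu> \<le> ennreal (2 * w0)"
    using exists_tail_nbhd[of a \<alpha>] by blast
  let ?K = "{\<nu> \<in> prob_measures. energy B \<nu> \<le> ennreal (2 * w0) \<and> located \<alpha> 0 1 \<nu>}"
  have K: "compactin weak_topology ?K"
    by (rule compactin_energy_sublevel[OF \<alpha> continuous_on_B \<kappa>_pos tent_le])
  have big: "ereal a < free \<nu>" if \<nu>: "\<nu> \<in> nbhd \<epsilon> h w s" "located \<alpha> 0 1 \<nu>" and "0 < \<epsilon>" "\<epsilon> \<le> \<kappa>"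
    "\<And>x. isCont h x" "\<And>x. \<bar>h x\<bar> \<le> k" "a < dual \<alpha> \<epsilon> h w s" for \<nu> \<epsilon> h k w s
  proof -
    have "h \<in> borel_measurable borel"
      using that by (intro borel_measurable_continuous_onI continuous_at_imp_continuous_on) auto
    then have "ereal (dual \<alpha> \<epsilon> h w s) \<le> free \<nu>"
      using that by (intro free_ge_dual[OF _ _ _ \<alpha>]) (auto simp: nbhd_def
          prob_measures_iff_real_distribution[symmetric])
    moreover have "ereal a < ereal (dual \<alpha> \<epsilon> h w s)" using that by simp
    ultimately show ?thesis by (rule less_le_trans[rotated])
  qed
  define \<O> where "\<O> = {U. openin weak_topology U \<and> (\<forall>\<nu>\<in>U. located \<alpha> 0 1 \<nu> \<longrightarrow> ereal a < free \<nu>)}"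
  have "\<exists>U\<in>\<O>. \<mu> \<in> U" if \<mu>: "\<mu> \<in> prob_measures" "ereal a < free \<mu>" for \<mu>
  proof -
    have d: "real_distribution \<mu>" using \<mu> prob_measures_iff_real_distribution by blast
    obtain \<epsilon> h k w s where p: "0 < \<epsilon>" "\<epsilon> \<le> \<kappa>" "\<And>x. isCont h x" "\<And>x. \<bar>h x\<bar> \<le> k"
      "ereal w < enn2ereal (energy (reduced \<epsilon>) \<mu>)" "s < (\<integral>x. h x \<partial>\<mu>)" "a < dual \<alpha> \<epsilon> h w s"
      using free_dual[OF d \<mu>(2) \<alpha>] by blast
    have "\<mu> \<in> nbhd \<epsilon> h w s" using p \<mu> by (simp add: nbhd_def)
    then show ?thesis unfolding \<O>_def using openin_nbhd[OF p(3,4)] big[OF _ _ p(1-4,7)] by blast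
  qed
  \<comment> \<open>Located measures outside \<open>?K\<close> lie in the tail neighbourhood, so
    their free energy exceeds a as well.\<close>
  then have "?S = ?K \<inter> (topspace weak_topology - \<Union>\<O>)"
    using t(4) big[OF _ _ t(1,2) _ _ t(3), of _ 0]
    unfolding topspace_weak_topology \<O>_def by (auto simp: not_less[symmetric])
  moreover have "closedin weak_topology (topspace weak_topology - \<Union>\<O>)"
    by (intro closedin_diff closedin_topspace openin_Union) (simp add: \<O>_def)
  ultimately show ?thesis using closed_Int_compactin[OF _ K] by (simp only: inf_commute)
qed

end

section \<open>Laws of large numbers\<close>

lemma prob_space_sample:
  assumes "real_distribution \<mu>"
  shows "prob_space (\<Pi>\<^sub>M i\<in>{1..n::nat}. \<mu>)"
proof (rule prob_space_PiM)
  interpret real_distribution \<mu> by fact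
  show "prob_space \<mu>" by (rule prob_space_axioms)
qed

context
  fixes \<mu> :: "real measure"
  assumes \<mu>: "real_distribution \<mu>"
begin

interpretation \<mu>: real_distribution \<mu> by (rule \<mu>)

interpretation PP: product_prob_space "\<lambda>_::nat. \<mu>" UNIV ..

lemma
  fixes f :: "real \<Rightarrow> real"
  assumes i: "i \<in> {1..n}" and f[measurable]: "f \<in> borel_measurable borel" "integrable \<mu> f"
  shows integrable_PiM_component: "integrable (\<Pi>\<^sub>M i\<in>{1..n}. \<mu>) (\<lambda>x. f (x i))"
    and integral_PiM_component: "(\<integral>x. f (x i) \<partial>(\<Pi>\<^sub>M i\<in>{1..n}. \<mu>)) = (\<integral>t. f t \<partial>\<mu>)"
proof -
  have d: "distr (\<Pi>\<^sub>M i\<in>{1..n}. \<mu>) \<mu> (\<lambda>x. x i) = \<mu>"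
    using i by (intro distr_PiM_component) (auto intro: \<mu>.prob_space_axioms)
  have m: "(\<lambda>x. x i) \<in> (\<Pi>\<^sub>M i\<in>{1..n}. \<mu>) \<rightarrow>\<^sub>M \<mu>" using i by (rule measurable_component_singleton)
  have f': "f \<in> borel_measurable \<mu>" by simp
  show "integrable (\<Pi>\<^sub>M i\<in>{1..n}. \<mu>) (\<lambda>x. f (x i))"
    using f(2) integrable_distr_eq[OF m f'] unfolding d by simp
  show "(\<integral>x. f (x i) \<partial>(\<Pi>\<^sub>M i\<in>{1..n}. \<mu>)) = (\<integral>t. f t \<partial>\<mu>)"
    using integral_distr[OF m f'] unfolding d by simp
qed

lemma sets_sample: "sets (\<Pi>\<^sub>M i\<in>{1..n::nat}. \<mu>) = sets (\<Pi>\<^sub>M i\<in>{1..n}. borel)"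
  by (rule sets_PiM_cong) auto

text \<open>Independent centred variables have vanishing cross terms, so the second moment of the
  sum is at most n times the square of k.\<close>

lemma abs_average_bounded_le:
  fixes g :: "real \<Rightarrow> real" and n :: nat
  assumes n: "n \<ge> 1" and g[measurable]: "g \<in> borel_measurable borel" and k: "\<And>t. \<bar>g t\<bar> \<le> k"
    and zero: "(\<integral>t. g t \<partial>\<mu>) = 0"
  shows "(\<integral>x. \<bar>(\<Sum>i=1..n. g (x i)) / n\<bar> \<partial>(\<Pi>\<^sub>M i\<in>{1..n}. \<mu>)) \<le> k / sqrt n"
proof -
  note One_nat_def [simp del]
  let ?P = "\<Pi>\<^sub>M i\<in>{1..n}. \<mu>"
  interpret P: prob_space ?P by (rule prob_space_sample[OF \<mu>])
  have k0: "0 \<le> k" using k[of 0] by linarith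
  have gi[measurable]: "(\<lambda>x. g (x i)) \<in> borel_measurable ?P" if "i \<in> {1..n}" for i
    using that by (intro measurable_compose[OF measurable_component_singleton]) auto
  have ig: "integrable \<mu> g" using k by (intro \<mu>.integrable_const_bound[of _ k]) auto
  have igg: "integrable ?P (\<lambda>x. g (x i) * g (x j))" if "i \<in> {1..n}" "j \<in> {1..n}" for i j
  proof (rule P.integrable_const_bound[of _ "k * k"])
    show "AE x in ?P. norm (g (x i) * g (x j)) \<le> k * k"
      using k k0 by (intro always_eventually allI) (auto simp: abs_mult intro!: mult_mono)
    show "(\<lambda>x. g (x i) * g (x j)) \<in> borel_measurable ?P"
      using gi[OF that(1)] gi[OF that(2)] by (rule borel_measurable_times)
  qed
  have cross: "(\<integral>x. g (x i) * g (x j) \<partial>?P) \<le> (if i = j then k\<^sup>2 else 0)" if ij: "i \<in> {1..n}" "j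
      \<in> {1..n}" for i j
  proof (cases "i = j")
    case True
    have "(\<integral>x. g (x i) * g (x j) \<partial>?P) \<le> (\<integral>x. k\<^sup>2 \<partial>?P)"
    proof (rule integral_mono[OF igg[OF ij]])
      fix x
      have "\<bar>g (x i)\<bar>\<^sup>2 \<le> k\<^sup>2" using k by (intro power_mono) auto
      then show "g (x i) * g (x j) \<le> k\<^sup>2" using True by (simp add: power2_eq_square)
    qed simp
    then show ?thesis using True P.prob_space by simp
  next
    case False
    \<comment> \<open>Factor g at the two positions i and j and 1 elsewhere, so that the cross term
      becomes an integral of a product over all coordinates.\<close>
    define f where "f l t = (if l = i \<or> l = j then g t else 1)" for l :: nat and t
    have fi: "integrable \<mu> (f l)" for l unfolding f_def using ig by (cases "l = i \<or> l = j") auto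
    have "(\<Prod>l\<in>{1..n}. f l (x l)) = g (x i) * g (x j)" for x
    proof -
      have "(\<Prod>l\<in>{1..n}. f l (x l)) = (\<Prod>l\<in>{i, j}. g (x l))"
        using ij by (intro prod.mono_neutral_cong_right) (auto simp: f_def)
      then show ?thesis using False by simp
    qed
    then have "(\<integral>x. g (x i) * g (x j) \<partial>?P) = (\<integral>x. (\<Prod>l\<in>{1..n}. f l (x l)) \<partial>?P)" by simp
    also have "\<dots> = (\<Prod>l\<in>{1..n}. \<integral>t. f l t \<partial>\<mu>)"
      by (rule PP.product_integral_prod) (use fi in auto)
    also have "\<dots> = 0"
      using ij(1) zero by (intro prod_zero) (auto simp: f_def intro!: bexI[of _ i])
    finally show ?thesis using False by simp
  qed
  let ?S = "\<lambda>x. \<Sum>i=1..n. g (x i)"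
  have sq: "(?S x)\<^sup>2 = (\<Sum>i=1..n. \<Sum>j=1..n. g (x i) * g (x j))" for x
    by (simp add: power2_eq_square sum_product)
  have iS2: "integrable ?P (\<lambda>x. (?S x)\<^sup>2)" unfolding sq using igg
      by (intro Bochner_Integration.integrable_sum)
  have iS: "integrable ?P ?S" using ig g by (intro Bochner_Integration.integrable_sum
      integrable_PiM_component)
  have "(\<integral>x. (?S x)\<^sup>2 \<partial>?P) = (\<Sum>i=1..n. \<Sum>j=1..n. \<integral>x. g (x i) * g (x j) \<partial>?P)"
  proof -
    have "(\<integral>x. (?S x)\<^sup>2 \<partial>?P) = (\<Sum>i=1..n. \<integral>x. (\<Sum>j=1..n. g (x i) * g (x j)) \<partial>?P)"
      unfolding sq by (intro Bochner_Integration.integral_sum Bochner_Integration.integrable_sum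
          igg)
    also have "\<dots> = (\<Sum>i=1..n. \<Sum>j=1..n. \<integral>x. g (x i) * g (x j) \<partial>?P)"
      by (intro sum.cong refl Bochner_Integration.integral_sum igg)
    finally show ?thesis .
  qed
  also have "\<dots> \<le> (\<Sum>i=1..n. \<Sum>j=1..n. if i = j then k\<^sup>2 else 0)" by (intro sum_mono cross)
  also have "\<dots> = n * k\<^sup>2" by simp
  finally have S2: "(\<integral>x. (?S x)\<^sup>2 \<partial>?P) \<le> n * k\<^sup>2" .
  define m where "m = (\<integral>x. \<bar>?S x\<bar> \<partial>?P)"
  have m0: "0 \<le> m" unfolding m_def by (intro integral_nonneg_AE) auto
  \<comment> \<open>The variance of the absolute sum is nonnegative, which bounds the square of its
    mean by the second moment.\<close>
  have "0 \<le> (\<integral>x. (\<bar>?S x\<bar> - m)\<^sup>2 \<partial>?P)" by (intro integral_nonneg_AE) auto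
  also have "\<dots> = (\<integral>x. (?S x)\<^sup>2 - 2 * m * \<bar>?S x\<bar> + m\<^sup>2 \<partial>?P)"
    by (intro Bochner_Integration.integral_cong refl) (simp add: power2_diff)
  also have "\<dots> = (\<integral>x. (?S x)\<^sup>2 \<partial>?P) - m\<^sup>2"
    using iS iS2 P.prob_space by (simp add: m_def[symmetric] power2_eq_square)
  finally have "m\<^sup>2 \<le> n * k\<^sup>2" using S2 by simp
  then have "m \<le> sqrt (n * k\<^sup>2)" by (rule real_le_rsqrt)
  then have "m \<le> sqrt n * k" using k0 by (simp add: real_sqrt_mult)
  then have "m / n \<le> sqrt n * k / n" using n by (intro divide_right_mono) auto
  also have "\<dots> = k / sqrt n" using n by (simp add: field_simps)
  finally show ?thesis by (simp add: m_def)
qed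

text \<open>Integrability has to suffice, because \<open>ln p\<close> need not be square integrable.
  Truncation reduces the claim to bounded variables, with an error in mean that is uniform in n
  since all coordinates have law \<mu>.\<close>

lemma weak_law_of_large_numbers:
  fixes h :: "real \<Rightarrow> real"
  assumes h[measurable]: "h \<in> borel_measurable borel" and ih: "integrable \<mu> h"
  shows "(\<lambda>n::nat. \<integral>x. \<bar>(\<Sum>i=1..n. h (x (i::nat))) / n - (\<integral>t. h t \<partial>\<mu>)\<bar> \<partial>(\<Pi>\<^sub>M i\<in>{1..n}. \<mu>)) \<longlonglongrightarrow> 0"
proof (rule LIMSEQ_I)
  note One_nat_def [simp del]
  fix e :: real assume e: "0 < e"
  define T where "T k t = max (- real k) (min (real k) (h t))" for k t
  have [measurable]: "T k \<in> borel_measurable borel" for k unfolding T_def[abs_def] by measurable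
  have Tk: "\<bar>T k t\<bar> \<le> real k" for k t by (auto simp: T_def)
  have iT: "integrable \<mu> (T k)" for k using Tk
      by (intro \<mu>.integrable_const_bound[of _ "real k"]) auto
  have "(\<lambda>k. \<integral>t. \<bar>h t - T k t\<bar> \<partial>\<mu>) \<longlonglongrightarrow> (\<integral>t. 0 \<partial>\<mu>)"
  proof (rule integral_dominated_convergence[where w = "\<lambda>t. \<bar>h t\<bar>"])
    show "integrable \<mu> (\<lambda>t. \<bar>h t\<bar>)" using ih by simp
    show "AE t in \<mu>. (\<lambda>k. \<bar>h t - T k t\<bar>) \<longlonglongrightarrow> 0"
    proof (intro always_eventually allI)
      fix t
      obtain k0 :: nat where "\<bar>h t\<bar> \<le> k0" using real_arch_simple by blast
      then have "\<bar>h t - T k t\<bar> = 0" if "k0 \<le> k" for k using that by (auto simp: T_def)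
      then show "(\<lambda>k. \<bar>h t - T k t\<bar>) \<longlonglongrightarrow> 0"
        by (intro tendsto_eventually eventually_sequentiallyI[of k0])
    qed
    show "AE t in \<mu>. norm \<bar>h t - T k t\<bar> \<le> \<bar>h t\<bar>" for k
      by (intro always_eventually allI) (auto simp: T_def)
  qed measurable
  then have "\<forall>\<^sub>F k in sequentially. (\<integral>t. \<bar>h t - T k t\<bar> \<partial>\<mu>) < e / 4"
    using e by (intro order_tendstoD) auto
  then obtain k where k: "(\<integral>t. \<bar>h t - T k t\<bar> \<partial>\<mu>) < e / 4" by (auto dest: eventually_happens)
  define c where "c = (\<integral>t. T k t \<partial>\<mu>)"
  have ck: "\<bar>c\<bar> \<le> real k"
  proof -
    have "\<bar>c\<bar> \<le> (\<integral>t. \<bar>T k t\<bar> \<partial>\<mu>)" unfolding c_def by (rule integral_abs_bound)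
    also have "\<dots> \<le> (\<integral>t. real k \<partial>\<mu>)" using iT Tk by (intro integral_mono) auto
    finally show ?thesis using \<mu>.prob_space by simp
  qed
  have "(\<lambda>n. 2 * real k / sqrt (real n)) \<longlonglongrightarrow> 0"
    by (intro tendsto_divide_0[OF tendsto_const] filterlim_at_top_imp_at_infinity
        filterlim_compose[OF sqrt_at_top] filterlim_real_sequentially)
  then have "\<forall>\<^sub>F n in sequentially. 2 * real k / sqrt (real n) < e / 4"
    using e by (intro order_tendstoD) auto
  then obtain N where N: "\<And>n. n \<ge> N \<Longrightarrow> 2 * real k / sqrt (real n) < e / 4"
    by (auto simp: eventually_sequentially)
  have "(\<integral>x. \<bar>(\<Sum>i=1..n. h (x i)) / n - (\<integral>t. h t \<partial>\<mu>)\<bar> \<partial>(\<Pi>\<^sub>M i\<in>{1..n}. \<mu>)) < e" if n: "n \<ge> max 1 N"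
      for n :: nat
  proof -
    let ?P = "\<Pi>\<^sub>M i\<in>{1..n}. \<mu>"
    interpret P: prob_space ?P by (rule prob_space_sample[OF \<mu>])
    have n1: "n \<ge> 1" using n by simp
    let ?g = "\<lambda>t. T k t - c" and ?d = "\<lambda>t. \<bar>h t - T k t\<bar>"
    have id: "integrable \<mu> ?d" using ih iT by simp
    have c1: "integrable ?P (\<lambda>x. (\<Sum>i=1..n. ?d (x i)) / n)"
      using id by (intro integrable_divide_zero Bochner_Integration.integrable_sum
          integrable_PiM_component) auto
    have c2: "integrable ?P (\<lambda>x. \<bar>(\<Sum>i=1..n. ?g (x i)) / n\<bar>)"
      using iT by (intro integrable_abs integrable_divide_zero Bochner_Integration.integrable_sum
          integrable_PiM_component) auto
    have c0: "integrable ?P (\<lambda>x. \<bar>(\<Sum>i=1..n. h (x i)) / n - (\<integral>t. h t \<partial>\<mu>)\<bar>)"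
      using ih h n1 by (intro integrable_abs Bochner_Integration.integrable_diff
          integrable_divide_zero
          Bochner_Integration.integrable_sum integrable_PiM_component) auto
    have ch: "\<bar>c - (\<integral>t. h t \<partial>\<mu>)\<bar> \<le> e / 4"
    proof -
      have "\<bar>c - (\<integral>t. h t \<partial>\<mu>)\<bar> = \<bar>\<integral>t. h t - T k t \<partial>\<mu>\<bar>" using ih iT
          by (simp add: c_def abs_minus_commute)
      also have "\<dots> \<le> (\<integral>t. ?d t \<partial>\<mu>)" by (rule integral_abs_bound)
      finally show ?thesis using k by simp
    qed
    \<comment> \<open>Three errors of at most e / 4 each: truncating the summands, the fluctuation
      of the truncated average, and the shift of its mean.\<close>
    have "(\<integral>x. \<bar>(\<Sum>i=1..n. h (x i)) / n - (\<integral>t. h t \<partial>\<mu>)\<bar> \<partial>?P)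
        \<le> (\<integral>x. (\<Sum>i=1..n. ?d (x i)) / n + \<bar>(\<Sum>i=1..n. ?g (x i)) / n\<bar> + e / 4 \<partial>?P)"
    proof (rule integral_mono[OF c0])
      show "integrable ?P (\<lambda>x. (\<Sum>i=1..n. ?d (x i)) / n + \<bar>(\<Sum>i=1..n. ?g (x i)) / n\<bar> + e / 4)"
        by (intro Bochner_Integration.integrable_add c1 c2 P.integrable_const)
      fix x
      have "(\<Sum>i=1..n. h (x i)) / n = (\<Sum>i=1..n. h (x i) - T k (x i)) / n + (\<Sum>i=1..n. ?g (x i)) / n
          + c"
        using n1 by (simp add: sum_subtractf sum.distrib field_simps)
      moreover have "\<bar>(\<Sum>i=1..n. h (x i) - T k (x i)) / n\<bar> \<le> (\<Sum>i=1..n. ?d (x i)) / n"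
        by (simp add: divide_right_mono sum_abs)
      ultimately show "\<bar>(\<Sum>i=1..n. h (x i)) / n - (\<integral>t. h t \<partial>\<mu>)\<bar>
          \<le> (\<Sum>i=1..n. ?d (x i)) / n + \<bar>(\<Sum>i=1..n. ?g (x i)) / n\<bar> + e / 4"
        using ch by linarith
    qed
    also have "\<dots> = (\<integral>x. (\<Sum>i=1..n. ?d (x i)) / n \<partial>?P) + (\<integral>x. \<bar>(\<Sum>i=1..n. ?g (x i)) / n\<bar> \<partial>?P) + e / 4"
      using c1 c2 P.prob_space by (simp add: Bochner_Integration.integral_add)
    also have "(\<integral>x. (\<Sum>i=1..n. ?d (x i)) / n \<partial>?P) = (\<integral>t. ?d t \<partial>\<mu>)"
    proof -
      have "(\<integral>x. (\<Sum>i=1..n. ?d (x i)) / n \<partial>?P) = (\<Sum>i=1..n. \<integral>x. ?d (x i) \<partial>?P) / n"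
        using id by (subst integral_divide_zero, subst Bochner_Integration.integral_sum)
          (auto intro!: integrable_PiM_component simp del: One_nat_def)
      also have "\<dots> = (\<Sum>i=1..n. \<integral>t. ?d t \<partial>\<mu>) / n"
        using id by (intro arg_cong2[where f = "(/)"] sum.cong refl integral_PiM_component) auto
      finally show ?thesis using n1 by simp
    qed
    also have "(\<integral>x. \<bar>(\<Sum>i=1..n. ?g (x i)) / n\<bar> \<partial>?P) \<le> 2 * real k / sqrt n"
    proof (rule abs_average_bounded_le[OF n1])
      show "\<bar>?g t\<bar> \<le> 2 * real k" for t using Tk[of k t] ck by linarith
      show "(\<integral>t. ?g t \<partial>\<mu>) = 0" using iT \<mu>.prob_space by (simp add: c_def)
    qed measurable
    finally show ?thesis using k N[of n] n e by simp
  qed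
  then show "\<exists>no. \<forall>n::nat\<ge>no. norm ((\<integral>x. \<bar>(\<Sum>i=1..n. h (x (i::nat))) / n - (\<integral>t. h t \<partial>\<mu>)\<bar>
      \<partial>(\<Pi>\<^sub>M i\<in>{1..n}. \<mu>)) - 0) < e"
    by (intro exI[of _ "max 1 N"]) (auto simp: integral_nonneg_AE)
qed

end

section \<open>The area between distribution functions, that is, the Wasserstein distance of order
  one\<close>

definition cdf_dist :: "real measure \<Rightarrow> real measure \<Rightarrow> ennreal"
  where "cdf_dist M N = (\<integral>\<^sup>+t. ennreal \<bar>cdf M t - cdf N t\<bar> \<partial>lborel)"

lemma measurable_cdf_dist_empirical:
  assumes "real_distribution \<mu>"
  shows "(\<lambda>z :: (nat \<Rightarrow> real) \<times> real. ennreal \<bar>cdf (empirical n (fst z)) (snd z) - cdf \<mu> (snd z)\<bar>)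
    \<in> borel_measurable ((\<Pi>\<^sub>M i\<in>{1..n}. borel) \<Otimes>\<^sub>M lborel)"
proof -
  interpret real_distribution \<mu> by fact
  note measurable_sum_of_bool_le [measurable]
  have "(\<lambda>z :: (nat \<Rightarrow> real) \<times> real. ennreal \<bar>(\<Sum>i=1..n. of_bool (fst z i \<le> snd z)) / n
      - cdf \<mu> (snd z)\<bar>)
    \<in> borel_measurable ((\<Pi>\<^sub>M i\<in>{1..n}. borel) \<Otimes>\<^sub>M (lborel :: real measure))"
    by measurable
  then show ?thesis by (simp add: cdf_empirical indicator_def)
qed

text \<open>The law of large numbers holds at each level t, and the expected deviations are
  dominated by twice the layer cake integrand of the first moment, so the limit passes through the
  integral over t.\<close>

lemma cdf_dist_empirical_tendsto:
  assumes \<mu>: "real_distribution \<mu>" and ix: "integrable \<mu> (\<lambda>x. x)"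
  shows "(\<lambda>n. \<integral>\<^sup>+x. cdf_dist (empirical (Suc n) x) \<mu> \<partial>(\<Pi>\<^sub>M i\<in>{1..Suc n}. \<mu>)) \<longlonglongrightarrow> 0"
proof -
  note One_nat_def [simp del] sum.cl_ivl_Suc [simp del]
  interpret \<mu>: real_distribution \<mu> by fact
  define a where "a n t = (\<integral>x. \<bar>(\<Sum>i=1..Suc n. indicator {..t} (x i)) / Suc n
      - (\<integral>s. indicator {..t} s \<partial>\<mu>)\<bar> \<partial>(\<Pi>\<^sub>M i\<in>{1..Suc n}. \<mu>))" for n and t :: real
  have F: "(\<integral>s. indicator {..t} s \<partial>\<mu>) = cdf \<mu> t" for t by (simp add: cdf_def)
  have eq: "(\<integral>\<^sup>+x. ennreal \<bar>cdf (empirical (Suc n) x) t - cdf \<mu> t\<bar> \<partial>(\<Pi>\<^sub>M i\<in>{1..Suc n}. \<mu>))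
      = ennreal (a n t)"
    and le: "a n t \<le> 2 * (if 0 \<le> t then 1 - cdf \<mu> t else cdf \<mu> t)" for n t
  proof -
    let ?P = "\<Pi>\<^sub>M i\<in>{1..Suc n}. \<mu>"
    interpret P: prob_space ?P by (rule prob_space_sample[OF \<mu>])
    have iI: "integrable \<mu> (indicator {..t} :: real \<Rightarrow> real)"
      by (intro \<mu>.integrable_const_bound[of _ 1]) (auto simp: indicator_def)
    have Fn: "integrable ?P (\<lambda>x. (\<Sum>i=1..Suc n. indicator {..t} (x i)) / Suc n :: real)"
      using iI by (intro integrable_divide_zero Bochner_Integration.integrable_sum
          integrable_PiM_component[OF \<mu>]) auto
    have EFn: "(\<integral>x. (\<Sum>i=1..Suc n. indicator {..t} (x i)) / Suc n \<partial>?P) = cdf \<mu> t"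
    proof -
      have "(\<integral>x. (\<Sum>i=1..Suc n. indicator {..t} (x i)) / Suc n \<partial>?P)
          = (\<Sum>i=1..Suc n. \<integral>x. indicator {..t} (x i) \<partial>?P) / Suc n"
        by (subst integral_divide_zero, subst Bochner_Integration.integral_sum)
          (use iI in \<open>auto intro!: integrable_PiM_component[OF \<mu>] simp del: One_nat_def\<close>)
      also have "\<dots> = (\<Sum>i=1..Suc n. \<integral>s. indicator {..t} s \<partial>\<mu>) / Suc n"
        using iI by (intro arg_cong2[where f = "(/)"] sum.cong refl integral_PiM_component[OF \<mu>])
            auto
      finally show ?thesis unfolding F by simp
    qed
    have ia: "integrable ?P (\<lambda>x. \<bar>(\<Sum>i=1..Suc n. indicator {..t} (x i)) / Suc n - cdf \<mu> t\<bar>)"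
      by (intro integrable_abs Bochner_Integration.integrable_diff Fn P.integrable_const)
    show "(\<integral>\<^sup>+x. ennreal \<bar>cdf (empirical (Suc n) x) t - cdf \<mu> t\<bar> \<partial>?P) = ennreal (a n t)"
      unfolding a_def F cdf_empirical by (rule nn_integral_eq_integral[OF ia]) simp
    have F01: "0 \<le> cdf \<mu> t" "cdf \<mu> t \<le> 1" using \<mu>.cdf_nonneg \<mu>.cdf_bounded_prob by auto
    \<comment> \<open>The deviation is at most the sum of the two tails on the side away from 0;
      both tails have the same expectation.\<close>
    show "a n t \<le> 2 * (if 0 \<le> t then 1 - cdf \<mu> t else cdf \<mu> t)"
    proof (cases "0 \<le> t")
      case True
      have "a n t \<le> (\<integral>x. 2 - cdf \<mu> t - (\<Sum>i=1..Suc n. indicator {..t} (x i)) / Suc n \<partial>?P)"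
        unfolding a_def F
      proof (rule integral_mono[OF ia])
        fix x :: "nat \<Rightarrow> real"
        have "(\<Sum>i=1..Suc n. indicator {..t} (x i) :: real) \<le> (\<Sum>i=1..Suc n. 1)"
            by (intro sum_mono) (auto simp: indicator_def)
        then have "(\<Sum>i=1..Suc n. indicator {..t} (x i) :: real) / Suc n \<le> 1" by simp
        then show "\<bar>(\<Sum>i=1..Suc n. indicator {..t} (x i)) / Suc n - cdf \<mu> t\<bar> \<le> 2 - cdf \<mu> t
            - (\<Sum>i=1..Suc n. indicator {..t} (x i)) / Suc n"
          using F01 by linarith
      qed (use Fn in simp)
      also have "\<dots> = 2 - cdf \<mu> t - cdf \<mu> t"
        unfolding EFn[symmetric] using Fn P.prob_space
            by (subst Bochner_Integration.integral_diff) auto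
      finally show ?thesis using True by simp
    next
      case False
      have "a n t \<le> (\<integral>x. (\<Sum>i=1..Suc n. indicator {..t} (x i)) / Suc n + cdf \<mu> t \<partial>?P)"
        unfolding a_def F
      proof (rule integral_mono[OF ia])
        fix x :: "nat \<Rightarrow> real"
        have "0 \<le> (\<Sum>i=1..Suc n. indicator {..t} (x i) :: real) / Suc n"
            by (intro divide_nonneg_nonneg sum_nonneg) auto
        then show "\<bar>(\<Sum>i=1..Suc n. indicator {..t} (x i)) / Suc n - cdf \<mu> t\<bar>
            \<le> (\<Sum>i=1..Suc n. indicator {..t} (x i)) / Suc n + cdf \<mu> t"
          using F01 by linarith
      qed (use Fn in simp)
      also have "\<dots> = cdf \<mu> t + cdf \<mu> t"
        using Fn P.prob_space EFn by (subst Bochner_Integration.integral_add) auto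
      finally show ?thesis using False by simp
    qed
  qed
  have lim: "(\<lambda>n. a n t) \<longlonglongrightarrow> 0" for t
  proof -
    have "integrable \<mu> (indicator {..t} :: real \<Rightarrow> real)"
      by (intro \<mu>.integrable_const_bound[of _ 1]) (auto simp: indicator_def)
    from LIMSEQ_Suc[OF weak_law_of_large_numbers[OF \<mu> _ this]] show ?thesis unfolding a_def by simp
  qed
  have swap: "(\<integral>\<^sup>+x. cdf_dist (empirical (Suc n) x) \<mu> \<partial>(\<Pi>\<^sub>M i\<in>{1..Suc n}. \<mu>))
      = (\<integral>\<^sup>+t. ennreal (a n t) \<partial>lborel)"
    and am: "(\<lambda>t. ennreal (a n t)) \<in> borel_measurable lborel" for n
  proof -
    let ?P = "\<Pi>\<^sub>M i\<in>{1..Suc n}. \<mu>"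
    interpret P: prob_space ?P by (rule prob_space_sample[OF \<mu>])
    interpret Q: pair_sigma_finite ?P "lborel :: real measure" ..
    have s: "sets (?P \<Otimes>\<^sub>M (lborel :: real measure)) = sets ((\<Pi>\<^sub>M i\<in>{1..Suc n}. borel) \<Otimes>\<^sub>M lborel)"
      by (intro sets_pair_measure_cong sets_sample[OF \<mu>]) simp
    have m: "(\<lambda>z :: (nat \<Rightarrow> real) \<times> real. ennreal \<bar>cdf (empirical (Suc n) (fst z)) (snd z)
        - cdf \<mu> (snd z)\<bar>) \<in> borel_measurable (?P \<Otimes>\<^sub>M lborel)"
      using measurable_cdf_dist_empirical[OF \<mu>, of "Suc n"]
          unfolding measurable_cong_sets[OF s refl] .
    show "(\<integral>\<^sup>+x. cdf_dist (empirical (Suc n) x) \<mu> \<partial>?P) = (\<integral>\<^sup>+t. ennreal (a n t) \<partial>lborel)"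
      unfolding cdf_dist_def eq[symmetric] by (rule Q.Fubini'[symmetric]) (use m in \<open>simp only:
          split_beta'\<close>)
    have m': "(\<lambda>z :: real \<times> (nat \<Rightarrow> real). ennreal \<bar>cdf (empirical (Suc n) (snd z)) (fst z)
        - cdf \<mu> (fst z)\<bar>) \<in> borel_measurable (lborel \<Otimes>\<^sub>M ?P)"
      using measurable_compose[OF measurable_pair_swap' m] by (simp add: split_beta')
    show "(\<lambda>t. ennreal (a n t)) \<in> borel_measurable lborel"
      unfolding eq[symmetric] by (rule P.borel_measurable_nn_integral) (use m' in \<open>simp only:
          split_beta'\<close>)
  qed
  have "(\<lambda>n. \<integral>\<^sup>+t. ennreal (a n t) \<partial>lborel) \<longlonglongrightarrow> (\<integral>\<^sup>+t. 0 \<partial>(lborel :: real measure))"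
  proof (rule nn_integral_dominated_convergence[where w = "\<lambda>t. 2 * ennreal (if 0 \<le> t then 1
      - cdf \<mu> t else cdf \<mu> t)"])
    show "(\<lambda>t. 2 * ennreal (if 0 \<le> t then 1 - cdf \<mu> t else cdf \<mu> t)) \<in> borel_measurable lborel"
        by measurable
    show "(\<lambda>t. ennreal (a n t)) \<in> borel_measurable lborel" for n by (rule am)
    show "AE t in lborel. ennreal (a n t) \<le> 2 * ennreal (if 0 \<le> t then 1 - cdf \<mu> t else cdf \<mu> t)"
        for n
    proof (intro always_eventually allI)
      fix t
      have "ennreal (a n t) \<le> ennreal (2 * (if 0 \<le> t then 1 - cdf \<mu> t else cdf \<mu> t))"
          by (rule ennreal_leI[OF le])
      also have "\<dots> = 2 * ennreal (if 0 \<le> t then 1 - cdf \<mu> t else cdf \<mu> t)"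
        by (subst ennreal_mult) (auto simp: \<mu>.cdf_bounded_prob \<mu>.cdf_nonneg)
      finally show "ennreal (a n t) \<le> 2 * ennreal (if 0 \<le> t then 1 - cdf \<mu> t else cdf \<mu> t)" .
    qed
    have "(\<integral>\<^sup>+t. 2 * ennreal (if 0 \<le> t then 1 - cdf \<mu> t else cdf \<mu> t) \<partial>lborel) = 2
        * (\<integral>\<^sup>+x. ennreal \<bar>x\<bar> \<partial>\<mu>)"
      unfolding \<mu>.nn_integral_abs_eq_cdf by (rule nn_integral_cmult) measurable
    also have "\<dots> < \<infinity>" using ix by (auto simp: integrable_iff_bounded ennreal_mult_less_top)
    finally show "(\<integral>\<^sup>+t. 2 * ennreal (if 0 \<le> t then 1 - cdf \<mu> t else cdf \<mu> t) \<partial>lborel) < \<infinity>" .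
    show "AE t in lborel. (\<lambda>n. ennreal (a n t)) \<longlonglongrightarrow> 0"
      using tendsto_ennrealI[OF lim] by simp
  qed simp
  then show ?thesis unfolding swap by simp
qed

text \<open>A deviation of at least e at a continuity point x persists, by monotonicity, as a
  deviation of e / 2 over an interval of length d / 2 on one side of x, and this forces an area of
  at least e d / 4.\<close>

lemma weak_conv_if_cdf_dist_tendsto:
  assumes \<nu>: "\<And>n. real_distribution (\<nu> n)" and \<mu>: "real_distribution \<mu>"
    and lim: "(\<lambda>n. cdf_dist (\<nu> n) \<mu>) \<longlonglongrightarrow> 0"
  shows "weak_conv_m \<nu> \<mu>"
  unfolding weak_conv_m_def weak_conv_def
proof (intro allI impI)
  fix x assume x: "isCont (cdf \<mu>) x"
  interpret \<mu>: real_distribution \<mu> by fact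
  interpret \<nu>: real_distribution "\<nu> n" for n by fact
  have bound: "ennreal (e * (v - u)) \<le> cdf_dist (\<nu> n) \<mu>"
    if "u \<le> v" "0 < e" "\<And>t. t \<in> {u..v} \<Longrightarrow> e \<le> \<bar>cdf (\<nu> n) t - cdf \<mu> t\<bar>" for u v e n
  proof -
    have "ennreal (e * (v - u)) = (\<integral>\<^sup>+t. ennreal e * indicator {u..v} t \<partial>lborel)"
      using that by (simp add: nn_integral_cmult ennreal_mult)
    also have "\<dots> \<le> cdf_dist (\<nu> n) \<mu>"
      unfolding cdf_dist_def using that by (intro nn_integral_mono) (auto simp: indicator_def
          ennreal_leI)
    finally show ?thesis .
  qed
  have ev: "\<forall>\<^sub>F n in sequentially. cdf_dist (\<nu> n) \<mu> < ennreal d" if "0 < d" for d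
    using that by (intro order_tendstoD(2)[OF lim]) simp
  show "(\<lambda>n. cdf (\<nu> n) x) \<longlonglongrightarrow> cdf \<mu> x"
  proof (rule tendstoI)
    fix e :: real assume e: "0 < e"
    obtain d where d: "0 < d" "\<And>t. dist t x < d \<Longrightarrow> dist (cdf \<mu> t) (cdf \<mu> x) < e / 2"
      using x e unfolding continuous_at_eps_delta dist_real_def by (metis half_gt_zero)
    have "0 < e / 2 * (d / 2)" using e d by simp
    from ev[OF this] show "\<forall>\<^sub>F n in sequentially. dist (cdf (\<nu> n) x) (cdf \<mu> x) < e"
    proof eventually_elim
      case (elim n)
      show ?case
      proof (rule ccontr)
        assume "\<not> ?thesis"
        then consider "cdf \<mu> x + e \<le> cdf (\<nu> n) x" | "cdf (\<nu> n) x \<le> cdf \<mu> x - e"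
          by (auto simp: dist_real_def abs_if split: if_splits)
        then have "ennreal (e / 2 * (d / 2)) \<le> cdf_dist (\<nu> n) \<mu>"
        proof cases
          case 1
          have "e / 2 \<le> \<bar>cdf (\<nu> n) t - cdf \<mu> t\<bar>" if t: "t \<in> {x..x + d / 2}" for t
          proof -
            have "\<bar>cdf \<mu> t - cdf \<mu> x\<bar> < e / 2" using d(2)[of t] t d(1) by (simp add: dist_real_def)
            moreover have "cdf (\<nu> n) x \<le> cdf (\<nu> n) t" using t by (intro \<nu>.cdf_nondecreasing) simp
            ultimately show ?thesis using 1 by linarith
          qed
          from bound[of x "x + d / 2" "e / 2" n, OF _ _ this] show ?thesis using d(1) e by simp
        next
          case 2
          have "e / 2 \<le> \<bar>cdf (\<nu> n) t - cdf \<mu> t\<bar>" if t: "t \<in> {x - d / 2..x}" for t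
          proof -
            have "\<bar>cdf \<mu> t - cdf \<mu> x\<bar> < e / 2" using d(2)[of t] t d(1) by (simp add: dist_real_def)
            moreover have "cdf (\<nu> n) t \<le> cdf (\<nu> n) x" using t by (intro \<nu>.cdf_nondecreasing) simp
            ultimately show ?thesis using 2 by linarith
          qed
          from bound[of "x - d / 2" x "e / 2" n, OF _ _ this] show ?thesis using d(1) e by simp
        qed
        with elim show False by (simp add: not_less[symmetric])
      qed
    qed
  qed
qed

lemma openin_weak_topology_cdf_dist:
  assumes U: "openin weak_topology U" "\<mu> \<in> U"
  shows "\<exists>\<delta>>0. \<forall>\<nu>\<in>prob_measures. cdf_dist \<nu> \<mu> < ennreal \<delta> \<longrightarrow> \<nu> \<in> U"
proof (rule ccontr)
  assume *: "\<not> ?thesis"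
  have "\<exists>\<nu>. \<nu> \<in> prob_measures \<and> cdf_dist \<nu> \<mu> < ennreal (inverse (Suc n)) \<and> \<nu> \<notin> U" for n
  proof -
    have "0 < inverse (real (Suc n))" by simp
    with * show ?thesis by blast
  qed
  then have "\<forall>n. \<exists>\<nu>. \<nu> \<in> prob_measures \<and> cdf_dist \<nu> \<mu> < ennreal (inverse (Suc n)) \<and> \<nu> \<notin> U" ..
  from choice[OF this] obtain \<nu> where \<nu>: "\<And>n. \<nu> n \<in> prob_measures"
    "\<And>n. cdf_dist (\<nu> n) \<mu> < ennreal (inverse (Suc n))" "\<And>n. \<nu> n \<notin> U" by blast
  have \<mu>: "\<mu> \<in> prob_measures" using U openin_subset topspace_weak_topology by blast
  have "(\<lambda>n. ennreal (inverse (real (Suc n)))) \<longlonglongrightarrow> ennreal 0"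
    by (rule tendsto_ennrealI[OF LIMSEQ_inverse_real_of_nat])
  then have "(\<lambda>n. cdf_dist (\<nu> n) \<mu>) \<longlonglongrightarrow> 0"
    by (intro tendsto_sandwich[of "\<lambda>_. 0" "\<lambda>n. cdf_dist (\<nu> n) \<mu>" sequentially "\<lambda>n. ennreal (inverse
        (real (Suc n)))" 0])
       (auto intro!: always_eventually less_imp_le[OF \<nu>(2)] simp del: of_nat_Suc)
  then have "weak_conv_m \<nu> \<mu>"
    using \<nu>(1) \<mu> prob_measures_iff_real_distribution by (intro weak_conv_if_cdf_dist_tendsto) blast+
  from openin_weak_topology_eventually[OF U \<nu>(1) this] \<nu>(3) show False
    by (auto dest: eventually_happens)
qed

section \<open>The lower bound\<close>

lemma PiM_density_lborel:
  fixes p :: "real \<Rightarrow> real" and n :: nat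
  assumes [measurable]: "p \<in> borel_measurable borel" and p: "\<And>x. 0 \<le> p x"
    and \<mu>: "real_distribution \<mu>" and dens: "\<mu> = density lborel (\<lambda>x. ennreal (p x))"
  shows "(\<Pi>\<^sub>M i\<in>{1..n}. \<mu>) = density (\<Pi>\<^sub>M i\<in>{1..n}. lborel) (\<lambda>x. \<Prod>i=1..n. ennreal (p (x i)))"
proof -
  interpret \<mu>: real_distribution \<mu> by fact
  interpret PP: product_prob_space "\<lambda>_::nat. \<mu>" UNIV ..
  interpret PL: product_sigma_finite "\<lambda>_::nat. lborel :: real measure" ..
  have pm[measurable]: "(\<lambda>x. \<Prod>i=1..n. ennreal (p (x i))) \<in> borel_measurable (\<Pi>\<^sub>M i\<in>{1..n}. lborel)"
  proof (rule borel_measurable_prod_ennreal)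
    fix i assume "i \<in> {1..n}"
    then show "(\<lambda>x. ennreal (p (x i))) \<in> borel_measurable (\<Pi>\<^sub>M i\<in>{1..n}. lborel)"
      by (intro measurable_compose[OF measurable_component_singleton]) auto
  qed
  show ?thesis
  proof (rule PP.PiM_eqI[symmetric])
    show "sets (density (\<Pi>\<^sub>M i\<in>{1..n}. lborel) (\<lambda>x. \<Prod>i=1..n. ennreal (p (x i))))
        = sets (\<Pi>\<^sub>M i\<in>{1..n}. \<mu>)"
      unfolding sets_density by (rule sets_PiM_cong) auto
    fix A assume A: "\<And>i. i \<in> {1..n} \<Longrightarrow> A i \<in> sets \<mu>"
    then have Ab: "A i \<in> sets borel" if "i \<in> {1..n}" for i using that by simp
    have PA: "Pi\<^sub>E {1..n} A \<in> sets (\<Pi>\<^sub>M i\<in>{1..n}. lborel)"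
      using Ab by (intro sets_PiM_I_finite) auto
    have "emeasure (density (\<Pi>\<^sub>M i\<in>{1..n}. lborel) (\<lambda>x. \<Prod>i=1..n. ennreal (p (x i)))) (Pi\<^sub>E {1..n} A)
        = (\<integral>\<^sup>+x. (\<Prod>i=1..n. ennreal (p (x i))) * indicator (Pi\<^sub>E {1..n} A) x
            \<partial>(\<Pi>\<^sub>M i\<in>{1..n}. lborel))"
      by (rule emeasure_density[OF pm PA])
    also have "\<dots> = (\<integral>\<^sup>+x. (\<Prod>i=1..n. ennreal (p (x i)) * indicator (A i) (x i))
        \<partial>(\<Pi>\<^sub>M i\<in>{1..n}. lborel))"
    proof (rule nn_integral_cong)
      fix x assume "x \<in> space (\<Pi>\<^sub>M i\<in>{1..n}. (lborel :: real measure))"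
      then have "indicator (Pi\<^sub>E {1..n} A) x = (\<Prod>i=1..n. indicator (A i) (x i) :: ennreal)"
        by (auto simp: indicator_def space_PiM PiE_iff prod.If_cases prod_zero_iff)
      then show "(\<Prod>i=1..n. ennreal (p (x i))) * indicator (Pi\<^sub>E {1..n} A) x
          = (\<Prod>i=1..n. ennreal (p (x i)) * indicator (A i) (x i))"
        by (simp add: prod.distrib)
    qed
    also have "\<dots> = (\<Prod>i=1..n. \<integral>\<^sup>+t. ennreal (p t) * indicator (A i) t \<partial>lborel)"
      using Ab by (intro PL.product_nn_integral_prod) auto
    also have "\<dots> = (\<Prod>i=1..n. emeasure \<mu> (A i))"
      using Ab by (intro prod.cong refl) (simp add: dens emeasure_density)
    finally show "emeasure (density (\<Pi>\<^sub>M i\<in>{1..n}. lborel) (\<lambda>x. \<Prod>i=1..n. ennreal (p (x i)))) (Pi\<^sub>E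
        {1..n} A)
        = (\<Prod>i=1..n. emeasure \<mu> (A i))" .
  qed simp
qed

context rank_energy
begin

lemma energy_le_add_cdf_dist:
  assumes M: "real_distribution M" and N: "real_distribution N"
  shows "energy B M \<le> energy B N + ennreal L * cdf_dist M N"
proof -
  interpret M: real_distribution M by fact
  interpret N: real_distribution N by fact
  have [measurable]: "(\<lambda>t. B (cdf N t)) \<in> borel_measurable borel"
    by (rule N.measurable_comp_cdf[OF continuous_on_B])
  have "energy B M \<le> (\<integral>\<^sup>+t. ennreal (B (cdf N t)) + ennreal L * ennreal \<bar>cdf M t - cdf N t\<bar>
      \<partial>lborel)"
    unfolding energy_def
  proof (rule nn_integral_mono)
    fix t
    have u: "cdf M t \<in> {0..1}" "cdf N t \<in> {0..1}"
      using M.cdf_nonneg M.cdf_bounded_prob N.cdf_nonneg N.cdf_bounded_prob by auto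
    have "B (cdf M t) \<le> B (cdf N t) + L * \<bar>cdf M t - cdf N t\<bar>"
      using lipschitz[OF u] by (simp add: abs_le_iff)
    then have "ennreal (B (cdf M t)) \<le> ennreal (B (cdf N t) + L * \<bar>cdf M t - cdf N t\<bar>)"
        by (rule ennreal_leI)
    also have "\<dots> = ennreal (B (cdf N t)) + ennreal L * ennreal \<bar>cdf M t - cdf N t\<bar>"
      using B_nonneg[OF u(2)] L_nonneg by (simp add: ennreal_plus ennreal_mult)
    finally show "ennreal (B (cdf M t)) \<le> \<dots>" .
  qed
  also have "\<dots> = energy B N + ennreal L * cdf_dist M N"
    unfolding energy_def cdf_dist_def by (subst nn_integral_add) (auto simp: nn_integral_cmult)
  finally show ?thesis .
qed

text \<open>Change of measure: integrating against Lebesgue measure is at least integrating against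
  the product law times the reciprocal density. On a set of probability at least 1/2 the samples lie
  in \<open>U\<close>, are located, and have nearly the energy and entropy of \<mu>.\<close>

lemma mass_ge:
  assumes \<mu>: "real_distribution \<mu>" and U: "openin weak_topology U" "\<mu> \<in> U"
    and \<alpha>: "cdf \<mu> 0 < \<alpha>" "\<alpha> < cdf \<mu> 1" and a: "free \<mu> < ereal a"
  shows "\<forall>\<^sub>F n in sequentially. ennreal (exp (- real n * a)) \<le> mass \<alpha> n U"
proof -
  note One_nat_def [simp del]
  interpret \<mu>: real_distribution \<mu> by fact
  have "entropy_fun \<mu> \<noteq> \<infinity>"
  proof
    assume "entropy_fun \<mu> = \<infinity>"
    moreover have "ereal c * enn2ereal (energy B \<mu>) \<noteq> - \<infinity>" using c_pos by (cases "energy B \<mu>") auto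
    ultimately show False using a by (simp add: free_def)
  qed
  then obtain p where p': "p \<in> borel_measurable lborel" and p0: "\<And>x. 0 \<le> p x"
    and dens: "\<mu> = density lborel (\<lambda>x. ennreal (p x))"
    and ix: "integrable \<mu> (\<lambda>x. x)" and ip: "integrable lborel (\<lambda>x. p x * ln (p x))"
    and ent: "entropy_fun \<mu> = ereal (\<integral>x. p x * ln (p x) \<partial>lborel)"
    using entropy_fun_finiteE by blast
  have p[measurable]: "p \<in> borel_measurable borel" using p' by simp
  define S where "S = (\<integral>x. p x * ln (p x) \<partial>lborel)"
  have il: "integrable \<mu> (\<lambda>x. ln (p x))" and Sl: "(\<integral>x. ln (p x) \<partial>\<mu>) = S"
    unfolding dens S_def using p0 ip by (subst integrable_real_density integral_real_density; simp)+
  have "(\<integral>\<^sup>+x. ennreal \<bar>x\<bar> \<partial>\<mu>) < \<infinity>" using ix by (simp add: integrable_iff_bounded)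
  from energy_finite_if_moment[OF \<mu> this] obtain W where W: "0 \<le> W" "energy B \<mu> = ennreal W"
    by (cases "energy B \<mu>") auto
  have SW: "S + c * W < a" using a W by (simp add: free_def ent S_def[symmetric] enn2ereal_ennreal)
  \<comment> \<open>The slack between a and the free energy: a quarter each goes to the fluctuations
    of energy and entropy, and the remaining half absorbs the probability 1/2.\<close>
  define \<eta> where "\<eta> = a - (S + c * W)"
  have \<eta>: "0 < \<eta>" using SW by (simp add: \<eta>_def)
  obtain \<delta>1 where \<delta>1: "0 < \<delta>1" "\<And>\<nu>. \<nu> \<in> prob_measures \<Longrightarrow> cdf_dist \<nu> \<mu> < ennreal \<delta>1 \<Longrightarrow> \<nu> \<in> U"
    using openin_weak_topology_cdf_dist[OF U] by blast
  \<comment> \<open>Within area \<delta> the energy grows by at most \<open>L * \<delta>\<close>,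
    which costs at most \<eta> / 4 after multiplication by c; L + 1 keeps the denominator
    positive.\<close>
  define \<delta> where "\<delta> = min \<delta>1 (\<eta> / (4 * c * (L + 1)))"
  have \<delta>: "0 < \<delta>" "\<delta> \<le> \<delta>1" using \<delta>1 \<eta> c_pos L_nonneg by (auto simp: \<delta>_def)
  have cL: "c * (L * \<delta>) \<le> \<eta> / 4"
  proof -
    have "c * (L * \<delta>) \<le> c * ((L + 1) * \<delta>)" using c_pos \<delta>
        by (intro mult_left_mono mult_right_mono) auto
    also have "\<dots> \<le> c * ((L + 1) * (\<eta> / (4 * c * (L + 1))))"
      using c_pos L_nonneg by (intro mult_left_mono) (auto simp: \<delta>_def)
    also have "\<dots> = \<eta> / 4"
    proof -
      have nz: "c \<noteq> 0" "L + 1 \<noteq> 0" using c_pos L_nonneg by auto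
      have "c * ((L + 1) * (\<eta> / (4 * c * (L + 1)))) = (c * (L + 1)) * \<eta> / (4 * (c * (L + 1)))"
          by (simp add: mult_ac)
      then show ?thesis using nz by simp
    qed
    finally show ?thesis .
  qed
  define d0 where "d0 = \<alpha> - cdf \<mu> 0"
  define d1 where "d1 = cdf \<mu> 1 - \<alpha>"
  have d: "0 < d0" "0 < d1" using \<alpha> by (auto simp: d0_def d1_def)
  \<comment> \<open>Four deviations, each divided by its tolerance, so that \<open>R n x < 1\<close>
    controls all of them and a single Markov inequality suffices. The tolerances \<open>d0\<close>
    and \<open>d1\<close> are positive by the strict location of \<mu>.\<close>
  define R where "R n x = ennreal (\<bar>(\<Sum>i=1..n. ln (p (x i))) / n - S\<bar> / (\<eta> / 4))
    + ennreal (1 / \<delta>) * cdf_dist (empirical n x) \<mu>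
    + ennreal (\<bar>cdf (empirical n x) 0 - cdf \<mu> 0\<bar> / d0) + ennreal (\<bar>cdf (empirical n x) 1
        - cdf \<mu> 1\<bar> / d1)" for n and x :: "nat \<Rightarrow> real"
  let ?P = "\<lambda>n::nat. \<Pi>\<^sub>M i\<in>{1..n}. \<mu>"
  have setsP: "sets (?P n) = sets (\<Pi>\<^sub>M i\<in>{1..n}. borel)" for n by (rule sets_sample[OF \<mu>])
  note mP = measurable_cong_sets[OF setsP refl]
  have m1[measurable]: "(\<lambda>x. \<Sum>i=1..n. ln (p (x i))) \<in> borel_measurable (?P n)" for n
    unfolding mP by measurable
  have m2[measurable]: "(\<lambda>x. cdf_dist (empirical n x) \<mu>) \<in> borel_measurable (?P n)" for n
    unfolding mP cdf_dist_def using measurable_cdf_dist_empirical[OF \<mu>, of n]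
    by (intro lborel.borel_measurable_nn_integral) (simp only: split_beta')
  have m3[measurable]: "(\<lambda>x. cdf (empirical n x) t) \<in> borel_measurable (?P n)" for n t
    unfolding mP by measurable
  have Rm[measurable]: "R n \<in> borel_measurable (?P n)" for n unfolding R_def[abs_def] by measurable
  have wl: "(\<lambda>n. \<integral>\<^sup>+x. ennreal (\<bar>(\<Sum>i=1..Suc n. h (x i)) / Suc n - m\<bar> / e) \<partial>?P (Suc n)) \<longlonglongrightarrow> 0"
    if h[measurable]: "h \<in> borel_measurable borel" and ih: "integrable \<mu> h" and m: "(\<integral>t. h t \<partial>\<mu>)
        = m" and e: "0 < e"
    for h :: "real \<Rightarrow> real" and m e
  proof -
    have "(\<integral>\<^sup>+x. ennreal (\<bar>(\<Sum>i=1..Suc n. h (x i)) / Suc n - m\<bar> / e) \<partial>?P (Suc n))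
        = ennreal ((\<integral>x. \<bar>(\<Sum>i=1..Suc n. h (x i)) / Suc n - m\<bar> \<partial>?P (Suc n)) / e)" for n
    proof -
      interpret P: prob_space "?P (Suc n)" by (rule prob_space_sample[OF \<mu>])
      have "integrable (?P (Suc n)) (\<lambda>x. \<bar>(\<Sum>i=1..Suc n. h (x i)) / Suc n - m\<bar>)"
        by (intro integrable_abs Bochner_Integration.integrable_diff integrable_divide_zero
            Bochner_Integration.integrable_sum integrable_PiM_component[OF \<mu> _ h ih]
                P.integrable_const)
      then have "integrable (?P (Suc n)) (\<lambda>x. \<bar>(\<Sum>i=1..Suc n. h (x i)) / Suc n - m\<bar> / e)"
        by (rule integrable_divide_zero)
      from nn_integral_eq_integral[OF this] e show ?thesis by (simp del: sum.cl_ivl_Suc One_nat_def)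
    qed
    moreover have "(\<lambda>n. (\<integral>x. \<bar>(\<Sum>i=1..Suc n. h (x i)) / Suc n - m\<bar> \<partial>?P (Suc n)) / e) \<longlonglongrightarrow> 0 / e"
      using LIMSEQ_Suc[OF weak_law_of_large_numbers[OF \<mu> h ih]] unfolding m
      by (intro tendsto_divide tendsto_const) (use e in auto)
    ultimately show ?thesis using tendsto_ennrealI by fastforce
  qed
  have iI: "integrable \<mu> (indicator {..t} :: real \<Rightarrow> real)" for t
    by (intro \<mu>.integrable_const_bound[of _ 1]) (auto simp: indicator_def)
  have F: "(\<integral>s. indicator {..t} s \<partial>\<mu>) = cdf \<mu> t" for t by (simp add: cdf_def)
  have "(\<lambda>n. \<integral>\<^sup>+x. R (Suc n) x \<partial>?P (Suc n)) \<longlonglongrightarrow> 0 + ennreal (1 / \<delta>) * 0 + 0 + 0"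
  proof -
    have "(\<integral>\<^sup>+x. R n x \<partial>?P n) = (\<integral>\<^sup>+x. ennreal (\<bar>(\<Sum>i=1..n. ln (p (x i))) / n - S\<bar> / (\<eta> / 4)) \<partial>?P n)
        + ennreal (1 / \<delta>) * (\<integral>\<^sup>+x. cdf_dist (empirical n x) \<mu> \<partial>?P n)
        + (\<integral>\<^sup>+x. ennreal (\<bar>cdf (empirical n x) 0 - cdf \<mu> 0\<bar> / d0) \<partial>?P n)
        + (\<integral>\<^sup>+x. ennreal (\<bar>cdf (empirical n x) 1 - cdf \<mu> 1\<bar> / d1) \<partial>?P n)" for n
      unfolding R_def by (simp add: nn_integral_add nn_integral_cmult del: One_nat_def)
    moreover have "(\<lambda>n. \<integral>\<^sup>+x. ennreal (\<bar>(\<Sum>i=1..Suc n. ln (p (x i))) / Suc n - S\<bar> / (\<eta> / 4))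
        \<partial>?P (Suc n)) \<longlonglongrightarrow> 0"
      by (rule wl[OF _ il Sl]) (use \<eta> in auto)
    moreover have "(\<lambda>n. ennreal (1 / \<delta>) * (\<integral>\<^sup>+x. cdf_dist (empirical (Suc n) x) \<mu> \<partial>?P (Suc n)))
        \<longlonglongrightarrow> ennreal (1 / \<delta>) * 0"
      by (rule ennreal_tendsto_cmult[OF _ cdf_dist_empirical_tendsto[OF \<mu> ix]]) simp
    moreover have "(\<lambda>n. \<integral>\<^sup>+x. ennreal (\<bar>cdf (empirical (Suc n) x) 0 - cdf \<mu> 0\<bar> / d0) \<partial>?P (Suc n))
        \<longlonglongrightarrow> 0"
      unfolding cdf_empirical by (rule wl[OF _ iI F d(1)]) simp
    moreover have "(\<lambda>n. \<integral>\<^sup>+x. ennreal (\<bar>cdf (empirical (Suc n) x) 1 - cdf \<mu> 1\<bar> / d1) \<partial>?P (Suc n))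
        \<longlonglongrightarrow> 0"
      unfolding cdf_empirical by (rule wl[OF _ iI F d(2)]) simp
    ultimately show ?thesis by (simp only: tendsto_add)
  qed
  then have "\<forall>\<^sub>F n in sequentially. (\<integral>\<^sup>+x. R (Suc n) x \<partial>?P (Suc n)) < ennreal (1/2)"
  proof (rule order_tendstoD(2))
    have "0 < ennreal (1/2)" by (subst ennreal_less_zero_iff) simp
    then show "0 + ennreal (1 / \<delta>) * 0 + 0 + 0 < ennreal (1/2)"
        by (simp only: mult_zero_right add_0_right)
  qed
  then have evR: "\<forall>\<^sub>F n in sequentially. (\<integral>\<^sup>+x. R n x \<partial>?P n) < ennreal (1/2)"
    by (subst (asm) eventually_sequentially_Suc)
  have "filterlim (\<lambda>n. real n * (\<eta> / 2)) at_top sequentially"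
    using \<eta> by (intro filterlim_at_top_mult_tendsto_pos[OF tendsto_const _
        filterlim_real_sequentially]) auto
  then have evn: "\<forall>\<^sub>F n in sequentially. ln 2 \<le> real n * (\<eta> / 2)" by (simp add: filterlim_at_top)
  show ?thesis
    using evR evn eventually_ge_at_top[of "1::nat"]
  proof eventually_elim
    case (elim n)
    then have n: "n \<ge> 1" by simp
    interpret P: prob_space "?P n" by (rule prob_space_sample[OF \<mu>])
    let ?A = "{x \<in> space (?P n). R n x < 1}"
    have A[measurable]: "?A \<in> sets (?P n)" by measurable
    have half: "ennreal (1/2) \<le> emeasure (?P n) ?A"
    proof -
      have "emeasure (?P n) (space (?P n)) = emeasure (?P n) (?A \<union> {x \<in> space (?P n). 1 \<le> R n x})"
        by (intro arg_cong2[where f = emeasure]) auto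
      also have "\<dots> \<le> emeasure (?P n) ?A + emeasure (?P n) {x \<in> space (?P n). 1 \<le> R n x}"
        by (intro emeasure_subadditive) measurable
      also have "emeasure (?P n) {x \<in> space (?P n). 1 \<le> R n x} \<le> (\<integral>\<^sup>+x. R n x \<partial>?P n)"
      proof -
        have "emeasure (?P n) {x \<in> space (?P n). 1 \<le> R n x} = (\<integral>\<^sup>+x. indicator {x \<in> space (?P n). 1
            \<le> R n x} x \<partial>?P n)"
          by (rule nn_integral_indicator[symmetric]) measurable
        also have "\<dots> \<le> (\<integral>\<^sup>+x. R n x \<partial>?P n)" by (intro nn_integral_mono) (auto simp: indicator_def)
        finally show ?thesis .
      qed
      finally have "1 \<le> emeasure (?P n) ?A + (\<integral>\<^sup>+x. R n x \<partial>?P n)"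
        by (simp add: P.emeasure_space_1 add_left_mono)
      also have "\<dots> \<le> emeasure (?P n) ?A + ennreal (1/2)" using elim by (intro add_left_mono) simp
      finally have "1 \<le> ennreal (P.prob ?A + 1/2)" by (simp add: P.emeasure_eq_measure ennreal_plus)
      then have "ennreal 1 \<le> ennreal (P.prob ?A + 1/2)" by (simp only: ennreal_1)
      then have "1/2 \<le> P.prob ?A" by (subst (asm) ennreal_le_iff) auto
      then show ?thesis unfolding P.emeasure_eq_measure by (rule ennreal_leI)
    qed
    define e0 where "e0 = exp (- real n * (a - \<eta> / 2))"
    let ?g = "\<lambda>x. weight n x * indicator {x. empirical n x \<in> U} x * indicator (loc_set \<alpha> n) x"
    \<comment> \<open>Reciprocal of the density of the sample. Where some \<open>p (x i)\<close>
      vanishes, \<open>ln 0 = 0\<close> makes it finite, and multiplied by the density it gives 0,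
      so the product is always at most 1.\<close>
    let ?l = "\<lambda>x. ennreal (exp (- (\<Sum>i=1..n. ln (p (x i)))))"
    have on_A: "ennreal e0 \<le> ?g x * ?l x" if x: "x \<in> ?A" for x
    proof -
      have R: "R n x < 1" using x by simp
      have part: "u < 1" if "ennreal u \<le> R n x" "0 \<le> u" for u
        using le_less_trans[OF that(1) R] that(2) by (simp add: ennreal_less_one_iff)
      have "\<bar>(\<Sum>i=1..n. ln (p (x i))) / n - S\<bar> / (\<eta> / 4) < 1"
        using \<eta> by (intro part) (auto simp: R_def add.assoc intro: add_increasing2)
      then have "\<bar>(\<Sum>i=1..n. ln (p (x i))) / n - S\<bar> < 1 * (\<eta> / 4)"
        using \<eta> by (subst (asm) pos_divide_less_eq) auto
      then have l1: "(\<Sum>i=1..n. ln (p (x i))) / n < S + \<eta> / 4" by linarith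
      have "\<bar>cdf (empirical n x) 0 - cdf \<mu> 0\<bar> / d0 < 1"
        using d by (intro part) (auto simp: R_def intro: add_increasing add_increasing2)
      then have l2: "cdf (empirical n x) 0 < \<alpha>" using d by (simp add: d0_def abs_less_iff)
      have "\<bar>cdf (empirical n x) 1 - cdf \<mu> 1\<bar> / d1 < 1"
        using d by (intro part) (auto simp: R_def intro: add_increasing)
      then have l3: "\<alpha> \<le> cdf (empirical n x) 1" using d by (simp add: d1_def abs_less_iff)
      have "ennreal (1 / \<delta>) * cdf_dist (empirical n x) \<mu> \<le> R n x"
        unfolding R_def by (auto intro: add_increasing add_increasing2)
      then have "ennreal (1 / \<delta>) * cdf_dist (empirical n x) \<mu> < 1" using R by (rule le_less_trans)
      then obtain D where D: "0 \<le> D" "cdf_dist (empirical n x) \<mu> = ennreal D" "D < \<delta>"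
        using \<delta> by (cases "cdf_dist (empirical n x) \<mu>")
          (auto simp: ennreal_mult[symmetric] ennreal_less_one_iff ennreal_mult_top)
      have dist: "real_distribution (empirical n x)" by (rule real_distribution_empirical[OF n])
      have inU: "empirical n x \<in> U"
        using \<delta>1(2)[of "empirical n x"] dist D \<delta>
            by (simp add: prob_measures_iff_real_distribution ennreal_less_iff)
      define E where "E = enn2real (energy B (empirical n x))"
      have "energy B (empirical n x) \<le> ennreal (W + L * D)"
        using energy_le_add_cdf_dist[OF dist \<mu>] W D L_nonneg
            by (simp add: ennreal_plus ennreal_mult)
      then have "E \<le> W + L * D" unfolding E_def using W D L_nonneg by (intro enn2real_leI) auto
      also have "\<dots> \<le> W + L * \<delta>" using D L_nonneg by (intro add_left_mono mult_left_mono) auto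
      finally have "c * E \<le> c * (W + L * \<delta>)" using c_pos by (intro mult_left_mono) auto
      then have cE: "c * E \<le> c * W + \<eta> / 4" using cL by (simp add: distrib_left)
      have "real n * (c * E + (\<Sum>i=1..n. ln (p (x i))) / n) \<le> real n * (a - \<eta> / 2)"
        using cE l1 by (intro mult_left_mono) (auto simp: \<eta>_def field_simps)
      then have "- real n * (a - \<eta> / 2) \<le> - (c * n) * E - (\<Sum>i=1..n. ln (p (x i)))"
        using n by (simp add: distrib_left mult_ac)
      then have "e0 \<le> exp (- (c * n) * E) * exp (- (\<Sum>i=1..n. ln (p (x i))))"
        unfolding e0_def exp_add[symmetric] by simp
      then have "ennreal e0 \<le> ennreal (exp (- (c * n) * E)) * ?l x"
        by (simp add: ennreal_mult[symmetric] ennreal_leI)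
      then show ?thesis using inU l2 l3 by (simp add: weight_def E_def loc_set_def)
    qed
    have gm: "(\<lambda>x. ?g x) \<in> borel_measurable (\<Pi>\<^sub>M i\<in>{1..n}. lborel)"
      by (rule measurable_mass_integrand[OF n openin_in_sets_borel_of[OF U(1)]])
    have gm': "(\<lambda>x. ?g x) \<in> borel_measurable (?P n)"
      using gm unfolding mP measurable_cong_sets[OF sets_PiM_lborel refl] .
    have lm: "?l \<in> borel_measurable (\<Pi>\<^sub>M i\<in>{1..n}. lborel)"
      unfolding measurable_cong_sets[OF sets_PiM_lborel refl] by measurable
    have pm: "(\<lambda>x. \<Prod>i=1..n. ennreal (p (x i))) \<in> borel_measurable (\<Pi>\<^sub>M i\<in>{1..n}. lborel)"
      unfolding measurable_cong_sets[OF sets_PiM_lborel refl] by measurable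
    have "exp (- real n * a) = exp (- real n * (a - \<eta> / 2)) * exp (- (real n * (\<eta> / 2)))"
      unfolding exp_add[symmetric] by (simp add: algebra_simps)
    also have "\<dots> \<le> e0 * exp (- ln 2)" unfolding e0_def using elim by (intro mult_left_mono) auto
    also have "\<dots> = e0 * (1/2)" by (simp add: exp_minus)
    finally have "ennreal (exp (- real n * a)) \<le> ennreal e0 * ennreal (1/2)"
      by (subst ennreal_mult[symmetric]) (auto simp: e0_def intro: ennreal_leI)
    also have "\<dots> \<le> ennreal e0 * emeasure (?P n) ?A" using half by (intro mult_left_mono) auto
    also have "\<dots> = (\<integral>\<^sup>+x. ennreal e0 * indicator ?A x \<partial>?P n)"
        by (simp add: nn_integral_cmult_indicator)
    also have "\<dots> \<le> (\<integral>\<^sup>+x. ?g x * ?l x \<partial>?P n)"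
      using on_A by (intro nn_integral_mono) (auto simp: indicator_def)
    also have "\<dots> = (\<integral>\<^sup>+x. (\<Prod>i=1..n. ennreal (p (x i))) * (?g x * ?l x) \<partial>(\<Pi>\<^sub>M i\<in>{1..n}. lborel))"
      unfolding PiM_density_lborel[OF p p0 \<mu> dens]
      by (rule nn_integral_density[OF pm]) (intro borel_measurable_times_ennreal gm lm)
    also have "\<dots> \<le> (\<integral>\<^sup>+x. ?g x \<partial>(\<Pi>\<^sub>M i\<in>{1..n}. lborel))"
    proof (rule nn_integral_mono)
      fix x
      have "(\<Prod>i=1..n. ennreal (p (x i))) * ?l x \<le> 1"
      proof (cases "\<exists>i\<in>{1..n}. p (x i) = 0")
        case True
        then obtain i where "i \<in> {1..n}" "p (x i) = 0" by blast
        then have "(\<Prod>i=1..n. ennreal (p (x i))) = 0"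
            by (intro prod_zero) (auto intro!: bexI[of _ i])
        then show ?thesis by (simp only: mult_zero_left zero_le)
      next
        case False
        then have pos: "0 < p (x i)" if "i \<in> {1..n}" for i using p0[of "x i"] that by force
        have "(\<Prod>i=1..n. ennreal (p (x i))) = ennreal (exp (\<Sum>i=1..n. ln (p (x i))))"
          using pos p0 by (simp add: prod_ennreal exp_sum)
        then show ?thesis by (simp add: ennreal_mult[symmetric] exp_add[symmetric])
      qed
      from mult_left_mono[OF this, of "?g x"]
      show "(\<Prod>i=1..n. ennreal (p (x i))) * (?g x * ?l x) \<le> ?g x" by (simp add: mult_ac)
    qed
    finally show ?case unfolding mass_def .
  qed
qed

end

section \<open>The large deviation principle\<close>

text \<open>\<open>\<kappa>\<close> is assembled from three regions: near the endpoints
  \<open>B\<close> grows at least with half its boundary slope, and on the compact middle part it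
  has a positive minimum.\<close>

lemma rank_energyI:
  fixes B B' :: "real \<Rightarrow> real"
  assumes deriv: "\<And>u. u \<in> {0..1} \<Longrightarrow> (B has_real_derivative B' u) (at u within {0..1})"
    and cont: "continuous_on {0..1} B'" and B0: "B 0 = 0" and B1: "B 1 = 0"
    and pos: "\<And>u. u \<in> {0<..<1} \<Longrightarrow> B u > 0" and d0: "B' 0 > 0" and d1: "0 > B' 1" and c: "0 < c"
  shows "\<exists>L \<kappa>. rank_energy B L \<kappa> c"
proof -
  have "compact (B' ` {0..1})" using cont by (intro compact_continuous_image) auto
  then obtain L where L: "\<And>u. u \<in> {0..1} \<Longrightarrow> norm (B' u) \<le> L"
    using compact_imp_bounded bounded_iff by (metis imageI)
  have lip: "\<bar>B u - B v\<bar> \<le> L * \<bar>u - v\<bar>" if "u \<in> {0..1}" "v \<in> {0..1}" for u v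
    using field_differentiable_bound[of "{0..1}" B B' L u v] deriv L that by auto
  have contB: "continuous_on {0..1} B"
    using deriv by (meson DERIV_continuous continuous_on_eq_continuous_within)
  have "((\<lambda>y. (B y - B 0) / (y - 0)) \<longlongrightarrow> B' 0) (at 0 within {0..1})"
    using deriv[of 0] by (simp add: has_field_derivative_iff)
  then have "\<forall>\<^sub>F y in at 0 within {0..1}. B' 0 / 2 < (B y - B 0) / (y - 0)"
    using d0 by (intro order_tendstoD) auto
  then obtain e0 where e0: "0 < e0" "\<And>y. y \<in> {0..1} \<Longrightarrow> y \<noteq> 0 \<Longrightarrow> dist y 0 < e0 \<Longrightarrow> B' 0 / 2 < (B y
      - B 0) / (y - 0)"
    unfolding eventually_at by blast
  have "((\<lambda>y. (B y - B 1) / (y - 1)) \<longlongrightarrow> B' 1) (at 1 within {0..1})"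
    using deriv[of 1] by (simp add: has_field_derivative_iff)
  then have "\<forall>\<^sub>F y in at 1 within {0..1}. (B y - B 1) / (y - 1) < B' 1 / 2"
    using d1 by (intro order_tendstoD) auto
  then obtain e1 where e1: "0 < e1" "\<And>y. y \<in> {0..1} \<Longrightarrow> y \<noteq> 1 \<Longrightarrow> dist y 1 < e1 \<Longrightarrow> (B y - B 1) / (y - 1)
      < B' 1 / 2"
    unfolding eventually_at by blast
  \<comment> \<open>Halving makes \<open>e\<close> strictly smaller than both radii and at most 1/4,
    so that the middle interval is nonempty.\<close>
  define e where "e = min (min e0 e1) (1/2) / 2"
  have e: "0 < e" "e < e0" "e < e1" "e \<le> 1/4" using e0(1) e1(1) by (auto simp: e_def)
  have "\<exists>x\<in>{e..1 - e}. \<forall>y\<in>{e..1 - e}. B x \<le> B y"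
    using e by (intro continuous_attains_inf continuous_on_subset[OF contB]) auto
  then obtain x0 where x0: "x0 \<in> {e..1 - e}" "\<And>y. y \<in> {e..1 - e} \<Longrightarrow> B x0 \<le> B y" by blast
  have m: "0 < B x0" using x0(1) e by (intro pos) auto
  define \<kappa> where "\<kappa> = min (B x0) (min (B' 0 / 2) (- B' 1 / 2))"
  have \<kappa>: "0 < \<kappa>" "\<kappa> \<le> B x0" "\<kappa> \<le> B' 0 / 2" "\<kappa> \<le> - B' 1 / 2" using m d0 d1 by (auto simp: \<kappa>_def)
  have tent: "\<kappa> * tent u \<le> B u" if u: "u \<in> {0..1}" for u
  proof -
    have t: "0 \<le> tent u" "tent u \<le> u" "tent u \<le> 1 - u" "tent u \<le> 1" using u by (auto simp: tent_def)
    consider "u = 0" | "u = 1" | "u \<in> {e..1 - e}" | "0 < u" "u < e" | "1 - e < u" "u < 1" using u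
        by fastforce
    then show ?thesis
    proof cases
      case 3
      have "\<kappa> * tent u \<le> B x0 * 1" using \<kappa> t by (intro mult_mono) auto
      then show ?thesis using x0(2)[OF 3] by simp
    next
      case 4
      have "B' 0 / 2 < B u / u" using e0(2)[of u] 4 e u B0 by (simp add: dist_real_def)
      then have "B' 0 / 2 * u < B u" using 4 by (simp add: field_simps)
      moreover have "\<kappa> * tent u \<le> B' 0 / 2 * u" using \<kappa> t by (intro mult_mono) auto
      ultimately show ?thesis by linarith
    next
      case 5
      have "B u / (u - 1) < B' 1 / 2" using e1(2)[of u] 5 e u B1 by (simp add: dist_real_def)
      then have "- B' 1 / 2 * (1 - u) < B u" using 5 by (simp add: field_simps)
      moreover have "\<kappa> * tent u \<le> - B' 1 / 2 * (1 - u)" using \<kappa> t d1 by (intro mult_mono) auto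
      ultimately show ?thesis by linarith
    qed (use B0 B1 in \<open>auto simp: tent_def\<close>)
  qed
  have "rank_energy B L \<kappa> c"
    by unfold_locales (use lip tent \<kappa> c B0 B1 in auto)
  then show ?thesis by blast
qed

text \<open>A fixed prefactor contributes \<open>ln C / n\<close>, which vanishes in the limit. Null
  sets have logarithmic probability minus infinity and satisfy the bound at once.\<close>

lemma limsup_log_prob_le:
  assumes C: "0 < C" and le: "\<forall>\<^sub>F n in sequentially. measure (P n) A \<le> C * exp (- real n * r)"
  shows "limsup (\<lambda>n. ereal (1 / real n) * log_prob (P n) A) \<le> ereal (- r)"
proof -
  have lim: "(\<lambda>n. ereal (ln C / real n - r)) \<longlonglongrightarrow> ereal (0 - r)"
    by (intro tendsto_ereal tendsto_diff tendsto_const tendsto_divide_0[OF tendsto_const]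
        filterlim_at_top_imp_at_infinity filterlim_real_sequentially)
  have "\<forall>\<^sub>F n in sequentially. ereal (1 / real n) * log_prob (P n) A \<le> ereal (ln C / real n - r)"
    using le eventually_ge_at_top[of "1::nat"]
  proof eventually_elim
    case (elim n)
    show ?case
    proof (cases "measure (P n) A = 0")
      case True
      then show ?thesis using elim by (simp add: log_prob_def)
    next
      case False
      then have "0 < measure (P n) A" by (simp add: zero_less_measure_iff)
      then have "ln (measure (P n) A) \<le> ln (C * exp (- real n * r))" using elim
          by (subst ln_le_cancel_iff) (auto intro: less_le_trans)
      also have "\<dots> = ln C - real n * r" using C by (simp add: ln_mult)
      finally have "(1 / real n) * ln (measure (P n) A) \<le> (1 / real n) * (ln C - real n * r)"
          by (intro mult_left_mono) auto
      then show ?thesis using False elim by (simp add: log_prob_def field_simps)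
    qed
  qed
  then have "limsup (\<lambda>n. ereal (1 / real n) * log_prob (P n) A) \<le> limsup (\<lambda>n. ereal (ln C / real n
      - r))"
    by (rule Limsup_mono)
  also have "\<dots> = ereal (- r)" using lim_imp_Limsup[OF _ lim] by simp
  finally show ?thesis .
qed

lemma liminf_log_prob_ge:
  assumes C: "0 < C" and le: "\<forall>\<^sub>F n in sequentially. C * exp (- real n * r) \<le> measure (P n) A"
  shows "ereal (- r) \<le> liminf (\<lambda>n. ereal (1 / real n) * log_prob (P n) A)"
proof -
  have lim: "(\<lambda>n. ereal (ln C / real n - r)) \<longlonglongrightarrow> ereal (0 - r)"
    by (intro tendsto_ereal tendsto_diff tendsto_const tendsto_divide_0[OF tendsto_const]
        filterlim_at_top_imp_at_infinity filterlim_real_sequentially)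
  have "\<forall>\<^sub>F n in sequentially. ereal (ln C / real n - r) \<le> ereal (1 / real n) * log_prob (P n) A"
    using le eventually_ge_at_top[of "1::nat"]
  proof eventually_elim
    case (elim n)
    have p: "0 < C * exp (- real n * r)" using C by simp
    then have m: "0 < measure (P n) A" using elim(1) by linarith
    have "ln C - real n * r = ln (C * exp (- real n * r))" using C by (simp add: ln_mult)
    also have "\<dots> \<le> ln (measure (P n) A)" using elim p m by (subst ln_le_cancel_iff)
    finally have "(1 / real n) * (ln C - real n * r) \<le> (1 / real n) * ln (measure (P n) A)"
        by (intro mult_left_mono) auto
    then show ?case using m elim by (simp add: log_prob_def field_simps)
  qed
  then have "liminf (\<lambda>n. ereal (ln C / real n - r)) \<le> liminf (\<lambda>n. ereal (1 / real n)
      * log_prob (P n) A)"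
    by (rule Liminf_mono)
  moreover have "liminf (\<lambda>n. ereal (ln C / real n - r)) = ereal (- r)"
      using lim_imp_Liminf[OF _ lim] by simp
  ultimately show ?thesis by simp
qed

text \<open>The admissible shifts have Lebesgue measure 1, so there is at least one.\<close>

lemma exists_translate_location:
  assumes "real_distribution \<mu>" "0 < \<alpha>" "\<alpha> < 1"
  shows "\<exists>y. located \<alpha> 0 1 (translate y \<mu>)"
proof -
  interpret real_distribution \<mu> by fact
  have "\<exists>y. cdf \<mu> (- y) < \<alpha> \<and> \<alpha> \<le> cdf \<mu> (1 - y)"
  proof (rule ccontr)
    assume "\<not> ?thesis"
    then have "{y. cdf \<mu> (- y) < \<alpha> \<and> \<alpha> \<le> cdf \<mu> (1 - y)} = {}" by auto
    then show False using nn_integral_location[OF assms] by simp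
  qed
  then obtain y where y: "cdf \<mu> (- y) < \<alpha>" "\<alpha> \<le> cdf \<mu> (1 - y)" by blast
  have "translate y \<mu> \<in> prob_measures"
    using assms(1) by (intro translate_in_prob_measures) (simp add:
        prob_measures_iff_real_distribution)
  then interpret T: real_distribution "translate y \<mu>"
      by (simp add: prob_measures_iff_real_distribution)
  have "measure (translate y \<mu>) {..<0} \<le> cdf (translate y \<mu>) 0"
    unfolding cdf_def by (intro T.finite_measure_mono) auto
  then show ?thesis using y by (intro exI[of _ y]) (simp add: located_def cdf_translate
      events_eq_borel)
qed

text \<open>A distribution function that never increases over a unit step is constant, against its
  limits 0 and 1. The level is chosen inside an increment over a unit step, and so depends on
  \<mu>.\<close>

lemma exists_translate_strict_location:
  assumes "real_distribution \<mu>"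
  shows "\<exists>y \<alpha>. 0 < \<alpha> \<and> \<alpha> < 1 \<and> cdf (translate y \<mu>) 0 < \<alpha> \<and> \<alpha> < cdf (translate y \<mu>) 1"
proof -
  interpret real_distribution \<mu> by fact
  have "\<exists>z. cdf \<mu> z < cdf \<mu> (z + 1)"
  proof (rule ccontr)
    assume "\<not> ?thesis"
    then have le: "cdf \<mu> (z + 1) \<le> cdf \<mu> z" for z by (simp add: not_less)
    have "cdf \<mu> (z + real k) \<le> cdf \<mu> z" for z k
    proof (induction k)
      case (Suc k)
      then show ?case using le[of "z + real k"] by (simp add: add_ac)
    qed simp
    from this[of 0] have "cdf \<mu> (real k) \<le> cdf \<mu> (- real j)" for k j
    proof -
      have "cdf \<mu> (real k) = cdf \<mu> (- real j + real (j + k))" by simp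
      also have "\<dots> \<le> cdf \<mu> (- real j)" by fact
      finally show ?thesis .
    qed
    then have "1 \<le> cdf \<mu> (- real j)" for j
      by (intro LIMSEQ_le_const2[OF cdf_lim_infty_prob]) auto
    then have "(1::real) \<le> 0" by (intro LIMSEQ_le_const[OF cdf_lim_neg_infty]) auto
    then show False by simp
  qed
  then obtain z where z: "cdf \<mu> z < cdf \<mu> (z + 1)" by blast
  then obtain \<alpha> where \<alpha>: "cdf \<mu> z < \<alpha>" "\<alpha> < cdf \<mu> (z + 1)" using dense by blast
  have "0 < \<alpha>" "\<alpha> < 1" using \<alpha> cdf_nonneg[of z] cdf_bounded_prob[of "z + 1"] by linarith+
  with \<alpha> show ?thesis
    by (intro exI[of _ "- z"] exI[of _ \<alpha>]) (simp add: cdf_translate events_eq_borel add.commute)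
qed

context rank_energy
begin

lemma free_translate:
  assumes "\<mu> \<in> prob_measures"
  shows "free (translate y \<mu>) = free \<mu>"
  using assms by (simp add: free_def entropy_fun_translate energy_translate continuous_on_B)

text \<open>Uniform distribution on [0, 1]: p ln p vanishes almost everywhere, outside the interval
  because \<open>ln 0 = 0\<close>, so the entropy is 0 and the energy is finite by the first
  moment.\<close>

lemma free_uniform_finite:
  shows "\<exists>\<mu>\<in>prob_measures. free \<mu> < \<infinity>"
proof -
  define \<mu> where "\<mu> = density lborel (indicator {0..1} :: real \<Rightarrow> ennreal)"
  have "prob_space \<mu>" by (rule prob_spaceI) (simp add: \<mu>_def emeasure_density)
  then have \<mu>: "\<mu> \<in> prob_measures" by (simp add: prob_measures_iff \<mu>_def)
  then have d: "real_distribution \<mu>" using prob_measures_iff_real_distribution by blast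
  have "(\<integral>\<^sup>+x. ennreal \<bar>x\<bar> \<partial>\<mu>) = (\<integral>\<^sup>+x. indicator {0..1} x * ennreal \<bar>x\<bar> \<partial>lborel)"
    unfolding \<mu>_def by (rule nn_integral_density) auto
  also have "\<dots> \<le> (\<integral>\<^sup>+x. indicator {0..1::real} x \<partial>lborel)"
    by (intro nn_integral_mono) (auto simp: indicator_def)
  also have "\<dots> < \<infinity>" by simp
  finally have mom: "(\<integral>\<^sup>+x. ennreal \<bar>x\<bar> \<partial>\<mu>) < \<infinity>" .
  then have ix: "integrable \<mu> (\<lambda>x. x)" by (intro integrableI_bounded) (auto simp: \<mu>_def)
  have ac: "absolutely_continuous lborel \<mu>"
    unfolding \<mu>_def by (rule absolutely_continuousI_density) simp
  have AE: "AE x in lborel. RN_deriv lborel \<mu> x = indicator {0..1} x"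
    using sigma_finite_measure.RN_deriv_unique[OF sigma_finite_lborel, of "indicator {0..1}" \<mu>]
        by (auto simp: \<mu>_def elim: eventually_mono)
  have "(\<integral>\<^sup>+x. ennreal (enn2real (RN_deriv lborel \<mu> x) * ln (enn2real (RN_deriv lborel \<mu> x)))
      \<partial>lborel) = (\<integral>\<^sup>+x. 0 \<partial>(lborel :: real measure))"
    by (rule nn_integral_cong_AE) (use AE in \<open>eventually_elim, auto simp: indicator_def\<close>)
  moreover have "(\<integral>\<^sup>+x. ennreal (- (enn2real (RN_deriv lborel \<mu> x)
      * ln (enn2real (RN_deriv lborel \<mu> x)))) \<partial>lborel) = (\<integral>\<^sup>+x. 0 \<partial>(lborel :: real measure))"
    by (rule nn_integral_cong_AE) (use AE in \<open>eventually_elim, auto simp: indicator_def\<close>)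
  ultimately have "entropy_fun \<mu> = 0" using \<mu> ix ac by (simp add: entropy_fun_def)
  moreover have "energy B \<mu> < \<infinity>" by (rule energy_finite_if_moment[OF d mom])
  ultimately have "free \<mu> < \<infinity>" by (cases "energy B \<mu>") (auto simp: free_def enn2ereal_ennreal)
  with \<mu> show ?thesis by blast
qed

text \<open>With h = 0, thresholds -1 lie below every possible value of both functionals, so one
  dual value bounds the free energy of all located measures; translation reaches the others.\<close>

lemma free_lower_bound: "\<exists>b::real. \<forall>\<mu>\<in>prob_measures. ereal b \<le> free \<mu>"
proof -
  have "ereal (dual (1/2) \<kappa> (\<lambda>_. 0) (-1) (-1)) \<le> free \<mu>" if \<mu>: "\<mu> \<in> prob_measures" for \<mu>
  proof -
    have "real_distribution \<mu>" using \<mu> prob_measures_iff_real_distribution by blast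
    then obtain y where y: "located (1/2) 0 1 (translate y \<mu>)"
        using exists_translate_location[of \<mu> "1/2"] by auto
    have t: "translate y \<mu> \<in> prob_measures" by (rule translate_in_prob_measures[OF \<mu>])
    have "ereal (dual (1/2) \<kappa> (\<lambda>_. 0) (-1) (-1)) \<le> free (translate y \<mu>)"
      using t y \<kappa>_pos
      by (intro free_ge_dual[where k = 0]) (auto simp: prob_measures_iff_real_distribution intro!:
          less_le_trans[OF _ enn2ereal_nonneg])
    then show ?thesis by (simp add: free_translate[OF \<mu>])
  qed
  then show ?thesis by blast
qed

end

section \<open>Passage to the orbit space and normalisation of the Gibbs mass\<close>

lemma continuous_map_orbit: "continuous_map weak_topology orbit_topology orbit"
  unfolding orbit_topology_def by (rule quotient_imp_continuous_map[OF
      quotient_map_quotient_topology])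

lemma measurable_orbit: "orbit \<in> borel_of weak_topology \<rightarrow>\<^sub>M borel_of orbit_topology"
proof -
  have sp: "space (borel_of weak_topology) = prob_measures"
    by (simp add: borel_of_def space_measure_of_conv topspace_weak_topology)
  show ?thesis
    unfolding borel_of_def[of orbit_topology]
  proof (rule measurable_measure_of)
    show "{U. openin orbit_topology U} \<subseteq> Pow (topspace orbit_topology)" using openin_subset by auto
    show "orbit \<in> space (borel_of weak_topology) \<rightarrow> topspace orbit_topology"
      by (auto simp: sp orbit_topology_def topspace_quotient_topology topspace_weak_topology)
    fix U assume "U \<in> {U. openin orbit_topology U}"
    then have "openin weak_topology {\<mu> \<in> topspace weak_topology. orbit \<mu> \<in> U}"
      using continuous_map_orbit by (auto simp: continuous_map_def)
    also have "{\<mu> \<in> topspace weak_topology. orbit \<mu> \<in> U} = orbit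
        -` U \<inter> space (borel_of weak_topology)"
      by (auto simp: sp topspace_weak_topology)
    finally show "orbit -` U \<inter> space (borel_of weak_topology) \<in> sets (borel_of weak_topology)"
      by (rule openin_in_sets_borel_of)
  qed
qed

lemma orbit_translate:
  assumes "\<mu> \<in> prob_measures"
  shows "orbit (translate y \<mu>) = orbit \<mu>"
  using orbit_eq_iff[OF assms translate_in_prob_measures[OF assms]] by blast

lemma sets_hyperplane_lebesgue [measurable_cong]: "sets (hyperplane_lebesgue n)
    = sets (\<Pi>\<^sub>M i\<in>{1..n}. borel)"
  by (simp add: hyperplane_lebesgue_def)

text \<open>If it vanished, the integration formula would assign Lebesgue measure 0 to the whole
  n-dimensional space.\<close>

lemma emeasure_hyperplane_lebesgue_space:
  assumes n: "n \<ge> 1"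
  shows "emeasure (hyperplane_lebesgue n) (space (hyperplane_lebesgue n)) \<noteq> 0"
proof
  assume 0: "emeasure (hyperplane_lebesgue n) (space (hyperplane_lebesgue n)) = 0"
  interpret product_sigma_finite "\<lambda>_::nat. lborel :: real measure" ..
  have "(\<integral>\<^sup>+x. 1 \<partial>(\<Pi>\<^sub>M i\<in>{1..n}. (lborel :: real measure)))
      = ennreal (sqrt n) * (\<integral>\<^sup>+x. (\<integral>\<^sup>+y. 1 \<partial>(lborel :: real measure)) \<partial>hyperplane_lebesgue n)"
    by (rule nn_integral_hyperplane[OF n]) simp
  also have "\<dots> = 0" using 0 by simp
  finally have "emeasure (\<Pi>\<^sub>M i\<in>{1..n}. (lborel :: real measure)) (\<Pi>\<^sub>E i\<in>{1..n}. UNIV) = 0"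
    by (simp add: space_PiM)
  moreover have "emeasure (\<Pi>\<^sub>M i\<in>{1..n}. (lborel :: real measure)) (\<Pi>\<^sub>E i\<in>{1..n}. UNIV)
      = (\<Prod>i=1..n. emeasure lborel (UNIV :: real set))"
    by (rule emeasure_PiM) auto
  ultimately show False by (simp add: prod_zero_iff)
qed

context rank_energy
begin

definition shape_mass :: "nat \<Rightarrow> real measure set \<Rightarrow> ennreal"
  where "shape_mass n V = (\<integral>\<^sup>+x. weight n x * indicator {x. empirical n x \<in> V} x
      \<partial>hyperplane_lebesgue n)"

definition preorbit :: "real measure set set \<Rightarrow> real measure set"
  where "preorbit A = {\<mu> \<in> prob_measures. orbit \<mu> \<in> A}"

lemma translate_preorbit: "\<mu> \<in> prob_measures \<Longrightarrow> translate y \<mu> \<in> preorbit A \<longleftrightarrow> \<mu> \<in> preorbit A"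
  by (simp add: preorbit_def orbit_translate translate_in_prob_measures)

lemma preorbit_sets: "A \<in> sets (borel_of orbit_topology) \<Longrightarrow> preorbit A
    \<in> sets (borel_of weak_topology)"
proof -
  assume "A \<in> sets (borel_of orbit_topology)"
  from measurable_sets[OF measurable_orbit this]
  have "orbit -` A \<inter> space (borel_of weak_topology) \<in> sets (borel_of weak_topology)" .
  moreover have "orbit -` A \<inter> space (borel_of weak_topology) = preorbit A"
    by (auto simp: preorbit_def borel_of_def space_measure_of_conv topspace_weak_topology)
  ultimately show ?thesis by simp
qed

lemma empirical_in_prob_measures: "n \<ge> 1 \<Longrightarrow> empirical n x \<in> prob_measures"
  using real_distribution_empirical prob_measures_iff_real_distribution by blast

text \<open>Weight and preorbit are translation invariant, so the integral over located
  configurations becomes one over the hyperplane. The right-hand side does not involve \<alpha>,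
  which permits a change of level.\<close>

lemma mass_preorbit:
  assumes n: "n \<ge> 1" and A: "A \<in> sets (borel_of orbit_topology)" and \<alpha>: "0 < \<alpha>" "\<alpha> < 1"
  shows "mass \<alpha> n (preorbit A) = ennreal (sqrt n) * shape_mass n (preorbit A)"
proof -
  define \<Phi> where "\<Phi> x = weight n x * indicator {x. empirical n x \<in> preorbit A} x" for x
  have m: "\<Phi> \<in> borel_measurable (\<Pi>\<^sub>M i\<in>{1..n}. borel)"
    unfolding \<Phi>_def
    by (intro borel_measurable_times_ennreal measurable_weight n measurable_indicator_empirical
        preorbit_sets A)
  have inv: "\<Phi> (\<lambda>i\<in>{1..n}. x i + y) = \<Phi> x" for x y
    unfolding \<Phi>_def weight_def indicator_def mem_Collect_eq empirical_translate
    by (simp only: energy_translate[OF empirical_in_prob_measures[OF n] continuous_on_B]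
        translate_preorbit[OF empirical_in_prob_measures[OF n]])
  from nn_integral_hyperplane_invariant[OF n m inv \<alpha>] show ?thesis
    by (simp add: mass_def shape_mass_def \<Phi>_def loc_set_def)
qed

lemma preorbit_space: "preorbit (topspace orbit_topology) = prob_measures"
  by (auto simp: preorbit_def orbit_topology_def topspace_quotient_topology topspace_weak_topology)

lemma topspace_orbit_sets: "topspace orbit_topology \<in> sets (borel_of orbit_topology)"
  by (rule openin_in_sets_borel_of[OF openin_topspace])

lemma mass_total:
  assumes n: "n \<ge> 1" and \<alpha>: "0 < \<alpha>" "\<alpha> < 1"
  shows "mass \<alpha> n prob_measures = ennreal (sqrt n) * shape_mass n prob_measures"
  using mass_preorbit[OF n topspace_orbit_sets \<alpha>] by (simp add: preorbit_space)

lemma shape_mass_total: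
  assumes n: "n \<ge> 1"
  shows "shape_mass n prob_measures = (\<integral>\<^sup>+x. weight n x \<partial>hyperplane_lebesgue n)"
  unfolding shape_mass_def using empirical_in_prob_measures[OF n] by simp

text \<open>With thresholds -1 the neighbourhood contains all probability measures, so the tilting
  bound applies to the total mass.\<close>

lemma shape_mass_total_finite:
  assumes n: "n \<ge> 1"
  shows "shape_mass n prob_measures < \<infinity>"
proof -
  have "nbhd \<kappa> (\<lambda>_. 0) (-1) (-1) = prob_measures"
    by (auto simp: nbhd_def intro!: less_le_trans[OF _ enn2ereal_nonneg])
  then have "mass (1/2) n prob_measures \<le> ennreal (exp (- real n * dual (1/2) \<kappa> (\<lambda>_. 0) (-1) (-1)))"
    using mass_nbhd_le[OF n \<kappa>_pos order_refl, of "1/2" "\<lambda>_. 0" 0 "-1" "-1"] by simp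
  then have "ennreal (sqrt n) * shape_mass n prob_measures < \<infinity>"
    using mass_total[OF n, of "1/2"] by (auto intro: le_less_trans)
  then show ?thesis using n by (auto simp: ennreal_mult_less_top)
qed

lemma shape_mass_total_pos:
  assumes n: "n \<ge> 1"
  shows "0 < shape_mass n prob_measures"
proof -
  have wm: "weight n \<in> borel_measurable (hyperplane_lebesgue n)"
    unfolding measurable_cong_sets[OF sets_hyperplane_lebesgue refl]
        by (rule measurable_weight[OF n])
  have "(\<integral>\<^sup>+x. weight n x \<partial>hyperplane_lebesgue n) \<noteq> 0"
  proof
    assume "(\<integral>\<^sup>+x. weight n x \<partial>hyperplane_lebesgue n) = 0"
    then have "AE x in hyperplane_lebesgue n. weight n x = 0" using wm
        by (simp add: nn_integral_0_iff_AE)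
    then have "AE x in hyperplane_lebesgue n. False"
        by eventually_elim (simp add: weight_def ennreal_eq_0_iff not_le)
    then obtain N where N: "space (hyperplane_lebesgue n) \<subseteq> N"
      "emeasure (hyperplane_lebesgue n) N = 0" "N \<in> sets (hyperplane_lebesgue n)"
      by (auto elim: AE_E)
    from emeasure_mono[OF N(1,3)] N(2) show False using emeasure_hyperplane_lebesgue_space[OF n]
        by simp
  qed
  then show ?thesis by (simp add: shape_mass_total[OF n] zero_less_iff_neq_zero)
qed

text \<open>The construction of \<open>orbit_law\<close> in terms of the locale's weight and total
  mass; the two agree for n \<ge> 1.\<close>

definition law :: "nat \<Rightarrow> real measure set measure"
  where "law n = distr (distr (density (hyperplane_lebesgue n) (\<lambda>x. weight n x / shape_mass n
      prob_measures))
    (borel_of weak_topology) (empirical n)) (borel_of orbit_topology) orbit"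

lemma emeasure_law:
  assumes n: "n \<ge> 1" and A: "A \<in> sets (borel_of orbit_topology)"
  shows "emeasure (law n) A = shape_mass n (preorbit A) / shape_mass n prob_measures"
proof -
  let ?H = "hyperplane_lebesgue n" and ?Z = "shape_mass n prob_measures"
  let ?D = "density ?H (\<lambda>x. weight n x / ?Z)"
  have wm: "weight n \<in> borel_measurable ?H"
    unfolding measurable_cong_sets[OF sets_hyperplane_lebesgue refl]
        by (rule measurable_weight[OF n])
  have em: "empirical n \<in> ?D \<rightarrow>\<^sub>M borel_of weak_topology"
    using measurable_empirical[OF n] by (simp add: measurable_cong_sets[OF sets_hyperplane_lebesgue
        refl])
  have V: "preorbit A \<in> sets (borel_of weak_topology)" by (rule preorbit_sets[OF A])
  have om: "orbit \<in> distr ?D (borel_of weak_topology) (empirical n) \<rightarrow>\<^sub>M borel_of orbit_topology"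
    using measurable_orbit by simp
  have "emeasure (law n) A = emeasure (distr ?D (borel_of weak_topology) (empirical n)) (orbit
      -` A \<inter> space (borel_of weak_topology))"
    unfolding law_def by (subst emeasure_distr[OF om A]) simp
  also have "orbit -` A \<inter> space (borel_of weak_topology) = preorbit A"
    by (auto simp: preorbit_def borel_of_def space_measure_of_conv topspace_weak_topology)
  also have "emeasure (distr ?D (borel_of weak_topology) (empirical n)) (preorbit A)
      = emeasure ?D (empirical n -` preorbit A \<inter> space ?H)"
    by (subst emeasure_distr[OF em V]) simp
  also have "\<dots> = (\<integral>\<^sup>+x. (weight n x / ?Z) * indicator (empirical n -` preorbit A \<inter> space ?H) x \<partial>?H)"
    using wm measurable_sets[OF em V] by (intro emeasure_density) auto
  also have "\<dots> = (\<integral>\<^sup>+x. (weight n x * indicator {x. empirical n x \<in> preorbit A} x) / ?Z \<partial>?H)"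
    by (intro nn_integral_cong) (auto simp: indicator_def)
  also have "\<dots> = shape_mass n (preorbit A) / ?Z"
    unfolding shape_mass_def
  proof (rule nn_integral_divide)
    show "(\<lambda>x. weight n x * indicator {x. empirical n x \<in> preorbit A} x) \<in> borel_measurable ?H"
      unfolding measurable_cong_sets[OF sets_hyperplane_lebesgue refl]
      by (intro borel_measurable_times_ennreal measurable_weight n measurable_indicator_empirical V)
  qed
  finally show ?thesis .
qed

lemma prob_space_law:
  assumes n: "n \<ge> 1"
  shows "prob_space (law n)"
proof
  have "space (law n) = topspace orbit_topology"
      by (simp add: law_def borel_of_def space_measure_of_conv)
  then have "emeasure (law n) (space (law n)) = shape_mass n prob_measures / shape_mass n
      prob_measures"
    using emeasure_law[OF n topspace_orbit_sets] by (simp add: preorbit_space)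
  also have "\<dots> = 1"
    using shape_mass_total_pos[OF n] shape_mass_total_finite[OF n]
        by (intro ennreal_divide_self) auto
  finally show "emeasure (law n) (space (law n)) = 1" .
qed

text \<open>The law is a quotient of unnormalised masses, the factors \<open>sqrt n\<close>
  cancelling. Numerator and denominator may use different levels because neither depends on its
  level.\<close>

lemma measure_law_mult:
  assumes n: "n \<ge> 1" and A: "A \<in> sets (borel_of orbit_topology)" and \<alpha>: "0 < \<alpha>" "\<alpha> < 1" and \<beta>: "0
      < \<beta>" "\<beta> < 1"
  shows "ennreal (measure (law n) A) * mass \<beta> n prob_measures = mass \<alpha> n (preorbit A)"
proof -
  interpret prob_space "law n" by (rule prob_space_law[OF n])
  have "ennreal (measure (law n) A) * mass \<beta> n prob_measures
      = (shape_mass n (preorbit A) / shape_mass n prob_measures) * (ennreal (sqrt n)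
          * shape_mass n prob_measures)"
    by (simp add: emeasure_eq_measure[symmetric] emeasure_law[OF n A] mass_total[OF n \<beta>])
  also have "\<dots> = ennreal (sqrt n) * (shape_mass n (preorbit A) / shape_mass n prob_measures
      * shape_mass n prob_measures)"
    by (simp add: mult_ac)
  also have "shape_mass n (preorbit A) / shape_mass n prob_measures * shape_mass n prob_measures
      = shape_mass n (preorbit A)"
    using shape_mass_total_pos[OF n] shape_mass_total_finite[OF n]
    by (simp add: ennreal_divide_times ennreal_times_divide[symmetric] ennreal_divide_self)
  finally show ?thesis by (simp add: mass_preorbit[OF n A \<alpha>])
qed

text \<open>The lower bound is obtained for a strictly located translate of \<mu> at a level of its
  own, then transferred to 1/2, since the mass of a preorbit is the same for all levels.\<close>

lemma mass_preorbit_ge: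
  assumes A: "openin orbit_topology A" and \<mu>: "\<mu> \<in> preorbit A" and a: "free \<mu> < ereal a"
  shows "\<forall>\<^sub>F n in sequentially. ennreal (exp (- real n * a)) \<le> mass (1/2) n (preorbit A)"
proof -
  have p: "\<mu> \<in> prob_measures" using \<mu> by (simp add: preorbit_def)
  have d: "real_distribution \<mu>" using p prob_measures_iff_real_distribution by blast
  obtain y \<alpha> where y: "0 < \<alpha>" "\<alpha> < 1" "cdf (translate y \<mu>) 0 < \<alpha>" "\<alpha> < cdf (translate y \<mu>) 1"
    using exists_translate_strict_location[OF d] by blast
  have t: "translate y \<mu> \<in> prob_measures" by (rule translate_in_prob_measures[OF p])
  have dt: "real_distribution (translate y \<mu>)" using t prob_measures_iff_real_distribution by blast
  have V: "openin weak_topology (preorbit A)"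
    using A continuous_map_orbit by (auto simp: continuous_map_def preorbit_def
        topspace_weak_topology)
  have "\<forall>\<^sub>F n in sequentially. ennreal (exp (- real n * a)) \<le> mass \<alpha> n (preorbit A)"
    using a \<mu> by (intro mass_ge[OF dt V _ y(3,4)]) (simp_all add: translate_preorbit[OF p]
        free_translate[OF p])
  with eventually_ge_at_top[of 1] show ?thesis
  proof eventually_elim
    case (elim n)
    have "mass \<alpha> n (preorbit A) = mass (1/2) n (preorbit A)"
      using elim(1) openin_in_sets_borel_of[OF A] y by (simp add: mass_preorbit)
    with elim show ?case by simp
  qed
qed

definition free_inf :: ereal
  where "free_inf = (INF \<mu>\<in>prob_measures. free \<mu>)"

lemma free_inf_finite: "\<bar>free_inf\<bar> \<noteq> \<infinity>"
proof -
  obtain \<mu> where "\<mu> \<in> prob_measures" "free \<mu> < \<infinity>" using free_uniform_finite by blast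
  then have "free_inf < \<infinity>" unfolding free_inf_def by (meson INF_lower le_less_trans)
  moreover obtain b where "\<forall>\<mu>\<in>prob_measures. ereal b \<le> free \<mu>" using free_lower_bound by blast
  then have "ereal b \<le> free_inf" unfolding free_inf_def by (intro INF_greatest) auto
  ultimately show ?thesis by auto
qed

lemma closedin_preorbit: "closedin orbit_topology A \<Longrightarrow> closedin weak_topology (preorbit A)"
  using continuous_map_orbit unfolding continuous_map_closedin preorbit_def topspace_weak_topology
      by blast

text \<open>Upper bound for the mass of the preorbit, divided by the lower bound for the total mass;
  the latter uses a measure with nearly minimal free energy.\<close>

lemma limsup_law_le:
  assumes A: "closedin orbit_topology A" and a: "\<And>\<mu>. \<mu> \<in> preorbit A \<Longrightarrow> ereal a < free \<mu>"
      and b: "free_inf < ereal b"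
  shows "limsup (\<lambda>n. ereal (1 / real n) * log_prob (law n) A) \<le> ereal (- (a - b))"
proof -
  obtain C where C: "0 \<le> C" "\<And>n. n \<ge> 1 \<Longrightarrow> mass (1/2) n (preorbit A) \<le> ennreal (C * exp (- real n
      * a))"
    using mass_closed_le[OF closedin_preorbit[OF A], of "1/2" a] a by auto
  obtain \<mu> where \<mu>: "\<mu> \<in> prob_measures" "free \<mu> < ereal b"
    using b unfolding free_inf_def by (auto simp: INF_less_iff)
  have "\<forall>\<^sub>F n in sequentially. ennreal (exp (- real n * b))
      \<le> mass (1/2) n (preorbit (topspace orbit_topology))"
    using \<mu> by (intro mass_preorbit_ge[OF openin_topspace, of \<mu>]) (auto simp: preorbit_space)
  then have "\<forall>\<^sub>F n in sequentially. measure (law n) A \<le> (C + 1) * exp (- real n * (a - b))"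
    using eventually_ge_at_top[of 1]
  proof eventually_elim
    case (elim n)
    have "ennreal (measure (law n) A * exp (- real n * b)) = ennreal (measure (law n) A)
        * ennreal (exp (- real n * b))"
      by (simp add: ennreal_mult)
    also have "\<dots> \<le> ennreal (measure (law n) A) * mass (1/2) n prob_measures"
      using elim by (intro mult_left_mono) (auto simp: preorbit_space)
    also have "\<dots> = mass (1/2) n (preorbit A)"
      using elim by (intro measure_law_mult closedin_in_sets_borel_of A) auto
    also have "\<dots> \<le> ennreal (C * exp (- real n * a))" using C elim by auto
    finally have "measure (law n) A * exp (- real n * b) \<le> C * exp (- real n * a)"
      using C(1) by (subst (asm) ennreal_le_iff) auto
    also have "exp (- real n * a) = exp (- real n * (a - b)) * exp (- real n * b)"
      unfolding exp_add[symmetric] by (simp add: algebra_simps)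
    finally have "measure (law n) A \<le> C * exp (- real n * (a - b))"
      unfolding mult.assoc[symmetric] by (rule mult_right_le_imp_le) simp
    \<comment> \<open>Replacing \<open>C\<close> by \<open>C + 1\<close> provides the strictly
      positive prefactor whose logarithm is taken.\<close>
    also have "\<dots> \<le> (C + 1) * exp (- real n * (a - b))" by (intro mult_right_mono) auto
    finally show ?case .
  qed
  then show ?thesis using C(1) by (intro limsup_log_prob_le[of "C + 1"]) auto
qed

text \<open>The roles are exchanged: lower bound for the mass of the preorbit, upper bound for the
  total mass, the whole space being closed.\<close>

lemma liminf_law_ge:
  assumes A: "openin orbit_topology A" and \<mu>: "\<mu> \<in> preorbit A" and a: "free \<mu> < ereal a"
      and b: "ereal b < free_inf"
  shows "ereal (- (a - b)) \<le> liminf (\<lambda>n. ereal (1 / real n) * log_prob (law n) A)"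
proof -
  have lt: "ereal b < free \<nu>" if "\<nu> \<in> preorbit (topspace orbit_topology)" for \<nu>
    using b that unfolding free_inf_def preorbit_space by (meson INF_lower less_le_trans)
  obtain C where C: "0 \<le> C" "\<And>n. n \<ge> 1 \<Longrightarrow> mass (1/2) n prob_measures \<le> ennreal (C * exp (- real n
      * b))"
    using mass_closed_le[OF closedin_preorbit[OF closedin_topspace], of "1/2" b] lt
        by (auto simp: preorbit_space)
  have "\<forall>\<^sub>F n in sequentially. (1 / (C + 1)) * exp (- real n * (a - b)) \<le> measure (law n) A"
    using mass_preorbit_ge[OF A \<mu> a] eventually_ge_at_top[of 1]
  proof eventually_elim
    case (elim n)
    have "ennreal (exp (- real n * a)) \<le> mass (1/2) n (preorbit A)" using elim by simp
    also have "\<dots> = ennreal (measure (law n) A) * mass (1/2) n prob_measures"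
      using elim by (intro measure_law_mult[symmetric] openin_in_sets_borel_of A) auto
    also have "\<dots> \<le> ennreal (measure (law n) A) * ennreal (C * exp (- real n * b))"
      using C elim by (intro mult_left_mono) auto
    also have "\<dots> = ennreal (measure (law n) A * (C * exp (- real n * b)))"
      using C by (simp add: ennreal_mult)
    finally have "exp (- real n * a) \<le> measure (law n) A * (C * exp (- real n * b))"
      using C(1) by (subst (asm) ennreal_le_iff) auto
    also have "\<dots> \<le> measure (law n) A * ((C + 1) * exp (- real n * b))"
      by (intro mult_left_mono mult_right_mono) auto
    also have "exp (- real n * a) = exp (- real n * (a - b)) * exp (- real n * b)"
      unfolding exp_add[symmetric] by (simp add: algebra_simps)
    finally have "exp (- real n * (a - b)) \<le> measure (law n) A * (C + 1)"
      unfolding mult.assoc[symmetric] by (rule mult_right_le_imp_le) simp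
    then show ?case using C(1) by (simp add: pos_divide_le_eq)
  qed
  then show ?thesis using C(1) by (intro liminf_log_prob_ge[of "1 / (C + 1)"]) auto
qed

definition rate :: "real measure set \<Rightarrow> ereal"
  where "rate A = the_elem (free ` A) - free_inf"

lemma rate_orbit:
  assumes "\<mu> \<in> prob_measures"
  shows "rate (orbit \<mu>) = free \<mu> - free_inf"
proof -
  have "free ` orbit \<mu> = {free \<mu>}"
    using assms by (auto simp: orbit_def free_translate image_def set_eq_iff)
  then show ?thesis by (simp add: rate_def)
qed

lemma topspace_orbitE:
  assumes "A \<in> topspace orbit_topology"
  obtains \<mu> where "\<mu> \<in> prob_measures" "A = orbit \<mu>"
  using assms by (auto simp: orbit_topology_def topspace_quotient_topology topspace_weak_topology)

text \<open>Every orbit meets the located measures, so a level set is the continuous image of a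
  compact sublevel of located measures.\<close>

lemma good_rate: "good_rate_function orbit_topology rate"
  unfolding good_rate_function_def
proof (intro conjI ballI allI)
  obtain F where F: "free_inf = ereal F" using free_inf_finite by auto
  show "0 \<le> rate A" if A: "A \<in> topspace orbit_topology" for A
  proof -
    obtain \<mu> where \<mu>: "\<mu> \<in> prob_measures" "A = orbit \<mu>" using A by (rule topspace_orbitE)
    have "free_inf \<le> free \<mu>" unfolding free_inf_def by (rule INF_lower[OF \<mu>(1)])
    then show ?thesis using F \<mu> by (cases "free \<mu>") (auto simp: rate_orbit)
  qed
  obtain \<mu> where \<mu>: "\<mu> \<in> prob_measures" "free \<mu> < \<infinity>" using free_uniform_finite by blast
  have "orbit \<mu> \<in> topspace orbit_topology"
    using \<mu>(1) by (auto simp: orbit_topology_def topspace_quotient_topology topspace_weak_topology)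
  moreover have "rate (orbit \<mu>) < \<infinity>" using \<mu> F by (cases "free \<mu>") (auto simp: rate_orbit)
  ultimately show "\<exists>x\<in>topspace orbit_topology. rate x < \<infinity>" by blast
  fix a :: real
  let ?S = "{\<nu> \<in> prob_measures. free \<nu> \<le> ereal (a + F) \<and> located (1/2) 0 1 \<nu>}"
  have S: "compactin weak_topology ?S" by (rule compactin_free_sublevel) auto
  have iff: "rate (orbit \<nu>) \<le> ereal a \<longleftrightarrow> free \<nu> \<le> ereal (a + F)" if "\<nu> \<in> prob_measures" for \<nu>
    using F that by (cases "free \<nu>") (auto simp: rate_orbit)
  have "{x \<in> topspace orbit_topology. rate x \<le> ereal a} = orbit ` ?S"
  proof (intro set_eqI iffI)
    fix A assume "A \<in> {x \<in> topspace orbit_topology. rate x \<le> ereal a}"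
    then have A: "A \<in> topspace orbit_topology" "rate A \<le> ereal a" by auto
    obtain \<nu> where \<nu>: "\<nu> \<in> prob_measures" "A = orbit \<nu>" using A(1) by (rule topspace_orbitE)
    have "real_distribution \<nu>" using \<nu>(1) prob_measures_iff_real_distribution by blast
    then obtain y where "located (1/2) 0 1 (translate y \<nu>)"
        using exists_translate_location[of \<nu> "1/2"] by auto
    then have "translate y \<nu> \<in> ?S"
      using A \<nu> iff translate_in_prob_measures free_translate by simp
    moreover have "A = orbit (translate y \<nu>)" using \<nu> by (simp add: orbit_translate)
    ultimately show "A \<in> orbit ` ?S" by blast
  next
    fix A assume "A \<in> orbit ` ?S"
    then show "A \<in> {x \<in> topspace orbit_topology. rate x \<le> ereal a}"
      using iff by (auto simp: orbit_topology_def topspace_quotient_topology topspace_weak_topology)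
  qed
  then show "compactin orbit_topology {x \<in> topspace orbit_topology. rate x \<le> ereal a}"
    using image_compactin[OF S continuous_map_orbit] by simp
qed

lemma large_deviations: "large_deviation_principle orbit_topology real law rate"
  unfolding large_deviation_principle_def
proof (intro conjI allI impI)
  obtain F where F: "free_inf = ereal F" using free_inf_finite by auto
  fix G assume G: "openin orbit_topology G"
  let ?X = "liminf (\<lambda>n. ereal (1 / real n) * log_prob (law n) G)"
  have "- rate A \<le> ?X" if A: "A \<in> G" for A
  proof -
    have "A \<in> topspace orbit_topology" using A openin_subset[OF G] by blast
    then obtain \<mu> where \<mu>: "\<mu> \<in> prob_measures" "A = orbit \<mu>" by (rule topspace_orbitE)
    show ?thesis
    proof (cases "free \<mu> = \<infinity>")
      case True
      then show ?thesis using \<mu> F by (simp add: rate_orbit)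
    next
      case False
      have "free_inf \<le> free \<mu>" unfolding free_inf_def by (rule INF_lower[OF \<mu>(1)])
      then obtain f where f: "free \<mu> = ereal f" using False F by (cases "free \<mu>") auto
      \<comment> \<open>Half of e is spent above the free energy of \<mu> and half below its
        infimum, since the bounds need strict inequalities on both sides.\<close>
      have "ereal (- (f - F)) \<le> ?X + ereal e" if e: "0 < e" for e
      proof -
        have "ereal (- ((f + e / 2) - (F - e / 2))) \<le> ?X"
          using A \<mu> e f F by (intro liminf_law_ge[OF G, of \<mu>]) (auto simp: preorbit_def)
        then have "ereal (- ((f + e / 2) - (F - e / 2))) + ereal e \<le> ?X + ereal e"
            by (rule add_right_mono)
        moreover have "ereal (- ((f + e / 2) - (F - e / 2))) + ereal e = ereal (- (f - F))"
            by (simp add: field_simps)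
        ultimately show ?thesis by simp
      qed
      then have "ereal (- (f - F)) \<le> ?X" by (rule ereal_le_epsilon2[rule_format]) 
      then show ?thesis using \<mu> f F by (simp add: rate_orbit)
    qed
  qed
  then have "- ?X \<le> (INF A\<in>G. rate A)" by (intro INF_greatest) (metis ereal_minus_le_minus
      ereal_uminus_uminus)
  then show "- (INF A\<in>G. rate A) \<le> ?X" by (metis ereal_minus_le_minus ereal_uminus_uminus)
next
  obtain F where F: "free_inf = ereal F" using free_inf_finite by auto
  fix C assume C: "closedin orbit_topology C"
  let ?X = "limsup (\<lambda>n. ereal (1 / real n) * log_prob (law n) C)"
  have "(INF A\<in>C. rate A) \<le> - ?X"
  proof (rule dense_le)
    \<comment> \<open>Arguing with t strictly below the infimum also covers an infinite infimum, in
      particular the empty set.\<close>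
    fix t assume t: "t < (INF A\<in>C. rate A)"
    show "t \<le> - ?X"
    proof (cases t)
      case (real r)
      have lt: "ereal (r + F) < free \<mu>" if "\<mu> \<in> preorbit C" for \<mu>
      proof -
        have p: "\<mu> \<in> prob_measures" "orbit \<mu> \<in> C" using that by (auto simp: preorbit_def)
        have "ereal r < rate (orbit \<mu>)" using t real p(2) by (meson INF_lower less_le_trans)
        then show ?thesis using F p by (cases "free \<mu>") (auto simp: rate_orbit)
      qed
      have "?X \<le> ereal (- r) + ereal e" if e: "0 < e" for e
      proof -
        have "?X \<le> ereal (- ((r + F) - (F + e)))"
          using e F lt by (intro limsup_law_le[OF C]) auto
        then show ?thesis by simp
      qed
      then have "?X \<le> ereal (- r)" by (rule ereal_le_epsilon2[rule_format])
      then show ?thesis using real by (metis ereal_minus_le_minus ereal_uminus_uminus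
          uminus_ereal.simps(1))
    next
      case PInf
      then show ?thesis using t by simp
    qed simp
  qed
  then show "?X \<le> - (INF A\<in>C. rate A)" by (metis ereal_minus_le_minus ereal_uminus_uminus)
qed

end

theorem corollary2p19:
  fixes B B' :: "real \<Rightarrow> real" and \<sigma> :: real
  assumes "\<sigma>\<^sup>2 > 0"
    and "\<And>u. u \<in> {0..1} \<Longrightarrow> (B has_real_derivative B' u) (at u within {0..1})"
    and "continuous_on {0..1} B'"
    and "\<And>u. u \<in> {0..1} \<Longrightarrow> B u \<ge> 0"
    and "B 0 = 0" and "B 1 = 0"
    and "\<And>u. u \<in> {0<..<1} \<Longrightarrow> B u > 0"
    and "B' 0 > 0" and "0 > B' 1"
  shows "(\<forall>n\<ge>2. 0 < partition_fun B \<sigma> n \<and> partition_fun B \<sigma> n < \<infinity> \<and>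
                prob_space (orbit_law B \<sigma> n)) \<and>
         good_rate_function orbit_topology (rate_fun B \<sigma>) \<and>
         large_deviation_principle orbit_topology real (orbit_law B \<sigma>) (rate_fun B \<sigma>)"
proof -
  obtain L \<kappa> where "rank_energy B L \<kappa> (2 / \<sigma>\<^sup>2)"
    using rank_energyI[OF assms(2,3,5,6,7,8,9), of "2 / \<sigma>\<^sup>2"] assms(1) by auto
  then interpret rank_energy B L \<kappa> "2 / \<sigma>\<^sup>2" .
  have w: "gibbs_weight B \<sigma> n x = weight n x" for n x
    by (simp add: gibbs_weight_def weight_def)
  have Z: "partition_fun B \<sigma> n = shape_mass n prob_measures" if "n \<ge> 1" for n
    using that by (simp add: partition_fun_def w shape_mass_total)
  have law: "orbit_law B \<sigma> n = law n" if "n \<ge> 1" for n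
    using that by (simp add: orbit_law_def empirical_law_def gibbs_def law_def w Z)
  have f: "free_energy B \<sigma> = free" by (simp add: fun_eq_iff free_energy_def free_def)
  have r: "rate_fun B \<sigma> = rate"
    by (simp add: fun_eq_iff rate_fun_def rate_def orbit_free_energy_def free_energy_inf_def
        free_inf_def f)
  \<comment> \<open>The two laws are identified only for n \<ge> 1, which is enough for upper and
    lower limits.\<close>
  have ev: "\<forall>\<^sub>F n in sequentially. ereal (1 / real n) * log_prob (orbit_law B \<sigma> n) A
      = ereal (1 / real n) * log_prob (law n) A" for A
    using eventually_ge_at_top[of "1::nat"] by eventually_elim (simp add: law)
  have "large_deviation_principle orbit_topology real (orbit_law B \<sigma>) rate"
    using large_deviations unfolding large_deviation_principle_def
    by (simp add: Limsup_eq[OF ev] Liminf_eq[OF ev])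
  moreover have "0 < partition_fun B \<sigma> n \<and> partition_fun B \<sigma> n < \<infinity> \<and> prob_space (orbit_law B \<sigma> n)"
      if "n \<ge> 2" for n
    using that shape_mass_total_pos[of n] shape_mass_total_finite[of n] prob_space_law[of n]
        by (simp add: Z law)
  ultimately show ?thesis using good_rate unfolding r by blast
qed

end
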